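(* Let $\mathcal S=\{S_i\}_{1\le i\le N}$ be an IFS on $\mathbb R^d$ satisfying the open set condition, with invariant set $K$, and let $A=\{a_1,\dots,a_m\}$ be a skeleton of $\mathcal S$. Suppose there exist a vector $\beta\in\{-1,1\}^N$ and an Euler-partition $P_1+\dots+P_m$ of $G(\mathcal S,A,\beta)$ which is consistent, primitive and potentially contains pure cells. Let $\tau$ be its induced edge-to-trail substitution and $\{E_v\}_{v\in V}$ the invariant sets of its induced GIFS. Then: (i) $K=\bigcup_{v\in V^+}E_v$ is a disjoint union in the $s$-dimensional Hausdorff measure, where $s=\dim_HK$; (ii) the edge-to-trail substitution $\tau$ leads to a space-filling curve of $K$.
   Context: An IFS is a finite family $\mathcal S=\{S_j\}_{j=1}^N$, $N\ge2$, of contractive similitudes of $\mathbb R^d$; its invariant set $K$ is the unique nonempty compact set with $K=\bigcup_jS_j(K)$. For $I=i_1\dots i_n\in\Sigma^n$, $\Sigma=\{1,\dots,N\}$, put $S_I=S_{i_1}\circ\dots\circ S_{i_n}$. Open set condition: there is a nonempty open $U$ with $\bigcup_iS_i(U)\subset U$ and the $S_i(U)$ pairwise disjoint. Skeleton. For finite $A\subset K$, the Hata graph $H(\mathcal S,A)$ is the undirected graph with vertices $S_1,\dots,S_N$ in which $S_i,S_j$ ($i\ne j$) are adjacent iff $S_i(A)\cap S_j(A)\neq\emptyset$. If $K$ is connected, a finite $A\subset K$ is a skeleton if $A\subset\bigcup_jS_j(A)$ and $H(\mathcal S,A)$ is connected. Graphs. Walks are written $e_1+\dots+e_k$; a trail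 is a walk with distinct edges; an Euler tour is a closed trail containing all edges of the graph. Let $v_j=\overrightarrow{a_ja_{j+1}}$ ($a_{m+1}=a_1$), $v_j^{-1}$ its reverse, $\Lambda=v_1+\dots+v_m$, $\Lambda^{-1}=v_m^{-1}+\dots+v_1^{-1}$, $V^+=\{v_1,\dots,v_m\}$, $V^-=\{v_1^{-1},\dots,v_m^{-1}\}$, $V=V^+\cup V^-$ ($2m$ distinct formal edges), $(v^{-1})^{-1}=v$. $G(\mathcal S,A,\beta)=\bigcup_{j=1}^NS_j(\Lambda^{\beta_j})$ is the directed multigraph with an edge $S_j(e)=(e,S_j)$ from $S_j(x)$ to $S_j(y)$ for every $j$ and every edge $e$ of $\Lambda^{\beta_j}$ from $x$ to $y$ (different pairs are different edges; vertices are points of $\mathbb R^d$). Euler-partition. An Euler tour $P$ of $G(\mathcal S,A,\beta)$ written as a concatenation $P=P_1+\dots+P_m$ of trails whose origins are a permutation of $a_1,\dots,a_m$. It is consistent if $P_j$ has the same origin and terminus as $v_j$ for each $j$. Write $P_j=S_{j,1}(u_{j,1})+\dots+S_{j,\ell_j}(u_{j,\ell_j})$, $S_{j,k}\in\mathcal S$, $u_{j,k}\in V$, and $P_j^{-1}=S_{j,\ell_j}(u_{j,\ell_j}^{-1})+\dots+S_{j,1}(u_{j,1}^{-1})$. The induced edge-to-trail substitution is $\tau:v_j\mapsto P_j,\ v_j^{-1}\mapsto P_j^{-1}$. The induced GIFS has invariant sets $\{E_v\}_{v\in V}$: the unique nonempty compact sets with $E_{v_j}=\bigcup_kS_{j,k}(E_{u_{j,k}})$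 and $E_{v_j^{-1}}=\bigcup_kS_{j,k}(E_{u_{j,k}^{-1}})$. Primitive. With $|v|=|v^{-1}|=v$ for $v\in V^+$, the induced morphism is $\tau^*:v_j\mapsto|u_{j,1}|\,|u_{j,2}|\cdots|u_{j,\ell_j}|$ on words over $V^+$; the (consistent) partition is primitive if there is $n$ such that $v_i$ appears in $(\tau^* )^n(v_j)$ for all $i,j$. Potentially contains pure cells. Iterate $\tau$ by $\tau(S_I(u))=S_I(\gamma_1)+\dots+S_I(\gamma_\ell)$ if $\tau(u)=\gamma_1+\dots+\gamma_\ell$ (where $S_I(S_j(e))=S_{Ij}(e)$), and $\tau(w_1+\dots+w_k)=\tau(w_1)+\dots+\tau(w_k)$. The positive and negative $S_I$-cells are the edge sets $\{S_I(v):v\in V^+\}$ and $\{S_I(v):v\in V^-\}$. The partition potentially contains pure cells if there are $n\ge1$, $I\in\Sigma^n$ and $u\in V$ such that all edges of the positive $S_I$-cell, or all edges of the negative $S_I$-cell, occur in $\tau^n(u)$. Disjoint union in $\mathcal H^s$ means $\mathcal H^s(E_v\cap E_w)=0$ for distinct $v,w\in V^+$. Space-filling curve means optimal parametrization: for compact $F$ with $0<\mathcal H^s(F)<\infty$, an onto map $\psi:[0,1]\to F$ such that (i) there are full-measure $F'\subset F$, $I'\subset[0,1]$ with $\psi:I'\to F'$ bijective; (ii) with $c=\mathcal H^s(F)$, $\mathcal H^s(\psi(X))=c\,\mathcal L(X)$ for Borel $X\subset[0,1]$ and $\mathcal L(\psi^{-1}(B))=c^{-1}\mathcal H^s(B)$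 for Borel $B\subset F$; (iii) $|\psi(x)-\psi(y)|\le c'|x-y|^{1/s}$ for some $c'>0$. We say $\tau$ leads to a space-filling curve of $K$ if there is a trail $w_1+\dots+w_k$ of edges of $V$ such that $K=\bigcup_iE_{w_i}$, $\mathcal H^s(E_{w_i}\cap E_{w_j})=0$ for $i\neq j$, each $E_{w_i}$ has an optimal parametrization $\varphi_i$ with $\varphi_i(0),\varphi_i(1)$ the origin and terminus of $w_i$, and the concatenation of $\varphi_1,\dots,\varphi_k$ (with $\varphi_i$ run on an interval of length $\mathcal H^s(E_{w_i})/\mathcal H^s(K)$) is an optimal parametrization of $K$. *)

theory Defs
  imports "HOL-Analysis.Analysis" "HOL-Library.Multiset" "Graph_Theory.Arc_Walk"
begin

text \<open>The \<open>s\<close>-th power of the diameter, with the usual conventions for \<open>s = 0\<close>: the empty set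
  counts \<open>0\<close> and every other set counts \<open>1\<close> (recall that \<open>0 powr 0 = 0\<close>).\<close>
definition diam_pow :: "real \<Rightarrow> 'a::metric_space set \<Rightarrow> ennreal" where
  "diam_pow s U = (if U = {} then 0 else if s = 0 then 1 else ennreal (diameter U powr s))"

text \<open>Boundedness is required because \<^const>\<open>diameter\<close> is meaningless on unbounded sets.\<close>
definition hausdorff_content :: "real \<Rightarrow> real \<Rightarrow> 'a::metric_space set \<Rightarrow> ennreal" where
  "hausdorff_content s \<delta> X =
     (INF U \<in> {U :: nat \<Rightarrow> 'a set. X \<subseteq> (\<Union>i. U i) \<and> (\<forall>i. bounded (U i) \<and> diameter (U i) \<le> \<delta>)}.
        (\<Sum>i. diam_pow s (U i)))"

definition hausdorff_measure :: "real \<Rightarrow> 'a::metric_space set \<Rightarrow> ennreal" where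
  "hausdorff_measure s X = (SUP \<delta>\<in>{0<..}. hausdorff_content s \<delta> X)"

text \<open>In a Euclidean space the set on the right is never empty, so the real infimum is the
  genuine one.\<close>
definition hausdorff_dim :: "'a::euclidean_space set \<Rightarrow> real" where
  "hausdorff_dim X = Inf {s. 0 \<le> s \<and> hausdorff_measure s X = 0}"

text \<open>A family \<open>S\<^sub>1, \<dots>, S\<^sub>N\<close> is a function on indices, of which only \<open>0, \<dots>, N - 1\<close> are used;
  likewise for \<open>a\<^sub>1, \<dots>, a\<^sub>m\<close>.\<close>

definition contractive_similitude :: "('a::metric_space \<Rightarrow> 'a) \<Rightarrow> bool" where
  "contractive_similitude f \<longleftrightarrow> (\<exists>r. 0 < r \<and> r < 1 \<and> (\<forall>x y. dist (f x) (f y) = r * dist x y))"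

definition is_ifs :: "(nat \<Rightarrow> 'a::metric_space \<Rightarrow> 'a) \<Rightarrow> nat \<Rightarrow> bool" where
  "is_ifs S N \<longleftrightarrow> N \<ge> 2 \<and> (\<forall>i<N. contractive_similitude (S i))"

definition is_invariant_set ::
    "(nat \<Rightarrow> 'a::topological_space \<Rightarrow> 'a) \<Rightarrow> nat \<Rightarrow> 'a set \<Rightarrow> bool" where
  "is_invariant_set S N K \<longleftrightarrow> compact K \<and> K \<noteq> {} \<and> K = (\<Union>j<N. S j ` K)"

definition open_set_condition ::
    "(nat \<Rightarrow> 'a::topological_space \<Rightarrow> 'a) \<Rightarrow> nat \<Rightarrow> bool" where
  "open_set_condition S N \<longleftrightarrow>
     (\<exists>U. open U \<and> U \<noteq> {} \<and> (\<Union>i<N. S i ` U) \<subseteq> U \<and> disjoint_family_on (\<lambda>i. S i ` U) {..<N})"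

definition hata_adj :: "(nat \<Rightarrow> 'a \<Rightarrow> 'a) \<Rightarrow> nat \<Rightarrow> 'a set \<Rightarrow> (nat \<times> nat) set" where
  "hata_adj S N A = {(i, j). i < N \<and> j < N \<and> i \<noteq> j \<and> S i ` A \<inter> S j ` A \<noteq> {}}"

definition hata_connected :: "(nat \<Rightarrow> 'a \<Rightarrow> 'a) \<Rightarrow> nat \<Rightarrow> 'a set \<Rightarrow> bool" where
  "hata_connected S N A \<longleftrightarrow> (\<forall>i<N. \<forall>j<N. (i, j) \<in> (hata_adj S N A)\<^sup>*)"

definition is_skeleton ::
    "(nat \<Rightarrow> 'a::topological_space \<Rightarrow> 'a) \<Rightarrow> nat \<Rightarrow> 'a set \<Rightarrow> 'a set \<Rightarrow> bool" where
  "is_skeleton S N K A \<longleftrightarrow>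
     connected K \<and> finite A \<and> A \<subseteq> K \<and> A \<subseteq> (\<Union>j<N. S j ` A) \<and> hata_connected S N A"

text \<open>\<open>Fwd j\<close> is the formal edge \<open>v\<^sub>j\<close> and \<open>Bwd j\<close> its reverse.\<close>
datatype fedge = Fwd nat | Bwd nat

fun inv_edge :: "fedge \<Rightarrow> fedge" where
  "inv_edge (Fwd j) = Bwd j"
| "inv_edge (Bwd j) = Fwd j"

fun abs_edge :: "fedge \<Rightarrow> fedge" where
  "abs_edge (Fwd j) = Fwd j"
| "abs_edge (Bwd j) = Fwd j"

definition Vpos :: "nat \<Rightarrow> fedge set" where
  "Vpos m = Fwd ` {..<m}"

definition Vneg :: "nat \<Rightarrow> fedge set" where
  "Vneg m = Bwd ` {..<m}"

definition Vall :: "nat \<Rightarrow> fedge set" where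
  "Vall m = Vpos m \<union> Vneg m"

fun edge_origin :: "(nat \<Rightarrow> 'a) \<Rightarrow> nat \<Rightarrow> fedge \<Rightarrow> 'a" where
  "edge_origin a m (Fwd j) = a j"
| "edge_origin a m (Bwd j) = a (Suc j mod m)"

fun edge_terminus :: "(nat \<Rightarrow> 'a) \<Rightarrow> nat \<Rightarrow> fedge \<Rightarrow> 'a" where
  "edge_terminus a m (Fwd j) = a (Suc j mod m)"
| "edge_terminus a m (Bwd j) = a j"

definition formal_graph :: "(nat \<Rightarrow> 'a) \<Rightarrow> nat \<Rightarrow> ('a, fedge) pre_digraph" where
  "formal_graph a m =
     \<lparr> verts = a ` {..<m}, arcs = Vall m, tail = edge_origin a m, head = edge_terminus a m \<rparr>"

text \<open>\<open>\<Lambda>\<close> for \<open>b = 1\<close> and \<open>\<Lambda>\<^sup>-\<^sup>1\<close> for \<open>b = -1\<close>; other values of \<open>b\<close> do not occur.\<close>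
definition Lam :: "nat \<Rightarrow> int \<Rightarrow> fedge list" where
  "Lam m b = (if b = 1 then map Fwd [0..<m] else rev (map Bwd [0..<m]))"

text \<open>The edge \<open>S\<^sub>j(e)\<close> is the pair \<open>(j, e)\<close>.\<close>
definition skel_graph ::
    "(nat \<Rightarrow> 'a \<Rightarrow> 'a) \<Rightarrow> nat \<Rightarrow> (nat \<Rightarrow> 'a) \<Rightarrow> nat \<Rightarrow> (nat \<Rightarrow> int) \<Rightarrow> ('a, nat \<times> fedge) pre_digraph"
  where
  "skel_graph S N a m \<beta> =
     \<lparr> verts = (\<Union>j<N. S j ` a ` {..<m}),
       arcs = {(j, e). j < N \<and> e \<in> set (Lam m (\<beta> j))},
       tail = (\<lambda>(j, e). S j (edge_origin a m e)),
       head = (\<lambda>(j, e). S j (edge_terminus a m e)) \<rparr>"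

definition euler_tour :: "('a, 'b) pre_digraph \<Rightarrow> 'b list \<Rightarrow> bool" where
  "euler_tour G p \<longleftrightarrow> (\<exists>x. pre_digraph.trail G x p x) \<and> set p = arcs G"

text \<open>The list \<open>Ps\<close> is \<open>[P\<^sub>1, \<dots>, P\<^sub>m]\<close>. The trails are nonempty, so that they have an origin.\<close>
definition euler_partition ::
    "('a, 'b) pre_digraph \<Rightarrow> (nat \<Rightarrow> 'a) \<Rightarrow> nat \<Rightarrow> 'b list list \<Rightarrow> bool" where
  "euler_partition G a m Ps \<longleftrightarrow>
     length Ps = m \<and>
     (\<forall>p\<in>set Ps. p \<noteq> [] \<and> (\<exists>x y. pre_digraph.trail G x p y)) \<and>
     euler_tour G (concat Ps) \<and>
     mset (map (\<lambda>p. tail G (hd p)) Ps) = mset (map a [0..<m])"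

definition consistent_partition ::
    "('a, 'b) pre_digraph \<Rightarrow> (nat \<Rightarrow> 'a) \<Rightarrow> nat \<Rightarrow> 'b list list \<Rightarrow> bool" where
  "consistent_partition G a m Ps \<longleftrightarrow>
     (\<forall>j<m. tail G (hd (Ps ! j)) = edge_origin a m (Fwd j) \<and>
            head G (last (Ps ! j)) = edge_terminus a m (Fwd j))"

definition inv_trail :: "(nat \<times> fedge) list \<Rightarrow> (nat \<times> fedge) list" where
  "inv_trail p = rev (map (\<lambda>(k, u). (k, inv_edge u)) p)"

fun subst_edge :: "(nat \<times> fedge) list list \<Rightarrow> fedge \<Rightarrow> (nat \<times> fedge) list" where
  "subst_edge Ps (Fwd j) = Ps ! j"
| "subst_edge Ps (Bwd j) = inv_trail (Ps ! j)"

text \<open>In iterates of a substitution \<open>\<tau>\<close>, the edge \<open>S\<^sub>I(u)\<close> is the pair \<open>(I, u)\<close> of a word and a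
  formal edge; \<open>u\<close> itself is \<open>([], u)\<close>.\<close>
definition subst_walk ::
    "(fedge \<Rightarrow> (nat \<times> fedge) list) \<Rightarrow> (nat list \<times> fedge) list \<Rightarrow> (nat list \<times> fedge) list" where
  "subst_walk \<tau> w = concat (map (\<lambda>(I, u). map (\<lambda>(j, e). (I @ [j], e)) (\<tau> u)) w)"

definition induced_morphism ::
    "(fedge \<Rightarrow> (nat \<times> fedge) list) \<Rightarrow> fedge list \<Rightarrow> fedge list" where
  "induced_morphism \<tau> w = concat (map (\<lambda>v. map (\<lambda>(j, u). abs_edge u) (\<tau> v)) w)"

definition primitive_subst :: "nat \<Rightarrow> (fedge \<Rightarrow> (nat \<times> fedge) list) \<Rightarrow> bool" where
  "primitive_subst m \<tau> \<longleftrightarrow>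
     (\<exists>n. \<forall>v\<in>Vpos m. \<forall>w\<in>Vpos m. v \<in> set ((induced_morphism \<tau> ^^ n) [w]))"

definition potentially_pure :: "nat \<Rightarrow> nat \<Rightarrow> (fedge \<Rightarrow> (nat \<times> fedge) list) \<Rightarrow> bool" where
  "potentially_pure N m \<tau> \<longleftrightarrow>
     (\<exists>n\<ge>1. \<exists>I. length I = n \<and> set I \<subseteq> {..<N} \<and>
        (\<exists>u\<in>Vall m. {(I, v) | v. v \<in> Vpos m} \<subseteq> set ((subst_walk \<tau> ^^ n) [([], u)]) \<or>
                     {(I, v) | v. v \<in> Vneg m} \<subseteq> set ((subst_walk \<tau> ^^ n) [([], u)])))"

definition gifs_invariant_sets ::
    "(nat \<Rightarrow> 'a::topological_space \<Rightarrow> 'a) \<Rightarrow> nat \<Rightarrow> (fedge \<Rightarrow> (nat \<times> fedge) list) \<Rightarrow>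
     (fedge \<Rightarrow> 'a set) \<Rightarrow> bool" where
  "gifs_invariant_sets S m \<tau> E \<longleftrightarrow>
     (\<forall>v\<in>Vall m. compact (E v) \<and> E v \<noteq> {} \<and> E v = (\<Union>(j, u)\<in>set (\<tau> v). S j ` E u))"

text \<open>Values of \<open>\<psi>\<close> outside the unit interval are irrelevant.\<close>
definition optimal_parametrization ::
    "real \<Rightarrow> 'a::euclidean_space set \<Rightarrow> (real \<Rightarrow> 'a) \<Rightarrow> bool" where
  "optimal_parametrization s F \<psi> \<longleftrightarrow>
     compact F \<and> 0 < hausdorff_measure s F \<and> hausdorff_measure s F < \<infinity> \<and>
     \<psi> ` {0..1} = F \<and>
     (\<exists>F' I'. F' \<subseteq> F \<and> hausdorff_measure s (F - F') = 0 \<and>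
              I' \<subseteq> {0..1} \<and> {0..1} - I' \<in> null_sets lebesgue \<and> bij_betw \<psi> I' F') \<and>
     (\<forall>X\<in>sets borel. X \<subseteq> {0..1} \<longrightarrow>
        hausdorff_measure s (\<psi> ` X) = hausdorff_measure s F * emeasure lebesgue X) \<and>
     (\<forall>B\<in>sets borel. B \<subseteq> F \<longrightarrow>
        emeasure lebesgue (\<psi> -` B \<inter> {0..1}) = hausdorff_measure s B / hausdorff_measure s F) \<and>
     (\<exists>c'>0. \<forall>x\<in>{0..1}. \<forall>y\<in>{0..1}. dist (\<psi> x) (\<psi> y) \<le> c' * \<bar>x - y\<bar> powr (1 / s))"

text \<open>\<open>\<psi>\<close> runs through \<open>\<phi> 0, \<dots>, \<phi> (k - 1)\<close>, each reparametrized affinely from the unit interval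
  to consecutive intervals of lengths \<open>l 0, \<dots>, l (k - 1)\<close> starting at \<open>0\<close>.\<close>
definition is_concatenation ::
    "nat \<Rightarrow> (nat \<Rightarrow> real) \<Rightarrow> (nat \<Rightarrow> real \<Rightarrow> 'a) \<Rightarrow> (real \<Rightarrow> 'a) \<Rightarrow> bool" where
  "is_concatenation k l \<phi> \<psi> \<longleftrightarrow>
     (\<forall>i<k. \<forall>x\<in>{0..1}. \<psi> ((\<Sum>p<i. l p) + l i * x) = \<phi> i x)"

text \<open>\<open>E\<close> stands for the invariant sets of the GIFS of the substitution.\<close>
definition leads_to_space_filling_curve ::
    "real \<Rightarrow> (nat \<Rightarrow> 'a::euclidean_space) \<Rightarrow> nat \<Rightarrow> (fedge \<Rightarrow> 'a set) \<Rightarrow> 'a set \<Rightarrow> bool" where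
  "leads_to_space_filling_curve s a m E K \<longleftrightarrow>
     (\<exists>ws x y \<phi> \<psi>.
        pre_digraph.trail (formal_graph a m) x ws y \<and>
        K = (\<Union>w\<in>set ws. E w) \<and>
        (\<forall>i<length ws. \<forall>j<length ws. i \<noteq> j \<longrightarrow>
           hausdorff_measure s (E (ws ! i) \<inter> E (ws ! j)) = 0) \<and>
        (\<forall>i<length ws. optimal_parametrization s (E (ws ! i)) (\<phi> i) \<and>
           \<phi> i 0 = edge_origin a m (ws ! i) \<and> \<phi> i 1 = edge_terminus a m (ws ! i)) \<and>
        is_concatenation (length ws)
          (\<lambda>i. enn2real (hausdorff_measure s (E (ws ! i))) / enn2real (hausdorff_measure s K)) \<phi> \<psi> \<and>
        optimal_parametrization s K \<psi>)"

end

theory Submission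
  imports Defs
begin

text \<open>Write \<open>h v\<close> for the \<open>s\<close>-dimensional Hausdorff measure of \<open>E v\<close>, where \<open>s\<close> solves Moran's equation
  \<open>\<Sum>i. r i powr s = 1\<close>.

  Under the open set condition \<open>K\<close> has positive finite \<open>s\<close>-measure, so \<open>s\<close> is its dimension.  For
  finiteness cover \<open>K\<close> by its level-\<open>n\<close> copies.  For positivity, stop every word when its ratio drops
  to \<open>\<rho>\<close>: the copies of the open set along stopped words are disjoint and of size about \<open>\<rho>\<close>, so a
  volume count shows that a ball of radius \<open>\<rho>\<close> meets copies of \<open>K\<close> of total weight at most
  \<open>q * \<rho> powr s\<close>, and an efficient cover would leave some of the total weight \<open>1\<close> uncovered.

  The set equations give \<open>h v \<le> \<Sum> r j powr s * h u\<close>, summed over the edges \<open>S\<^sub>j(u)\<close> of the trail of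
  \<open>v\<close>.  Add these inequalities for all \<open>v\<close>.  The trails together form an Euler tour, so the right-hand
  side contains each \<open>S\<^sub>j\<close> with every edge exactly once, up to orientation, and orientation does not
  affect \<open>h\<close>.  By Moran's equation both totals agree, so every inequality is an equality
  (\<open>h_eq\<close>): the pieces of \<open>E v\<close>, on every level, overlap in null sets only.  If one \<open>E u\<close> has all
  \<open>S\<^sub>I(E v)\<close> among its pieces (a pure cell), these copies are essentially disjoint, and cancelling the
  similitude \<open>S\<^sub>I\<close> shows that the \<open>E v\<close> are (\<open>E_overlap_null\<close>).  Primitivity spreads positivity from
  one \<open>h v\<close> to all of them (\<open>h_pos\<close>).

  To parametrize \<open>E v\<close>, cut the interval \<open>[0, h v]\<close> into consecutive intervals of the lengths
  \<open>r j powr s * h u\<close> and let the curve of \<open>v\<close> follow the curves of the \<open>u\<close>, mapped by \<open>S\<^sub>j\<close>.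
  Consistency says that consecutive curves fit together, so the infinitely refined curve is well
  defined (\<open>parametrization_exists\<close>).  Since lengths scale with \<open>r powr s\<close> and distances with \<open>r\<close>, it
  is Hoelder continuous with exponent \<open>1 / s\<close> (\<open>g_holder\<close>); it spends in each piece exactly the
  measure of that piece, hence in each Borel set the measure of that set (\<open>time_in_eq\<close>); and double
  points lie in the null overlaps of pieces (\<open>double_point\<close>).  These properties make it an optimal
  parametrization (\<open>optimal_parametrizationI\<close>).  Finally \<open>K\<close> is treated as one more vertex whose trail
  is the whole Euler tour, so the same result applies to it, and its curve is the concatenation of the
  curves of \<open>v\<^sub>1, \<dots>, v\<^sub>m\<close>.\<close>

section \<open>Hausdorff measure as a Borel measure\<close>

lemma diameter_le_dist:
  fixes X :: "'a::metric_space set"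
  assumes "0 \<le> d" and "\<And>x y. x \<in> X \<Longrightarrow> y \<in> X \<Longrightarrow> dist x y \<le> d"
  shows "diameter X \<le> d"
  using assms by (auto simp: diameter_def intro!: cSUP_least)

lemma diam_pow_empty [simp]: "diam_pow s {} = 0"
  by (simp add: diam_pow_def)

lemma diam_pow_pos: "0 < s \<Longrightarrow> diam_pow s U = ennreal (diameter U powr s)"
  by (simp add: diam_pow_def)

lemma diam_pow_mono:
  assumes "0 \<le> s" "U \<subseteq> W" "bounded W"
  shows "diam_pow s U \<le> diam_pow s W"
  using assms diameter_subset[OF assms(2,3)] diameter_ge_0[OF bounded_subset[OF assms(3,2)]]
  by (auto simp: diam_pow_def intro!: ennreal_leI powr_mono2)

lemma hausdorff_content_le_sum:
  assumes "X \<subseteq> (\<Union>i. U i)" "\<And>i. bounded (U i)" "\<And>i. diameter (U i) \<le> \<delta>"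
  shows "hausdorff_content s \<delta> X \<le> (\<Sum>i. diam_pow s (U i))"
  unfolding hausdorff_content_def using assms by (intro INF_lower) auto

lemma hausdorff_content_greatest:
  assumes "\<And>U. X \<subseteq> (\<Union>i. U i) \<Longrightarrow> (\<And>i. bounded (U i)) \<Longrightarrow> (\<And>i. diameter (U i) \<le> \<delta>)
    \<Longrightarrow> c \<le> (\<Sum>i. diam_pow s (U i))"
  shows "c \<le> hausdorff_content s \<delta> X"
  unfolding hausdorff_content_def using assms by (intro INF_greatest) auto

lemma hausdorff_content_mono: "X \<subseteq> Y \<Longrightarrow> hausdorff_content s \<delta> X \<le> hausdorff_content s \<delta> Y"
  by (intro hausdorff_content_greatest hausdorff_content_le_sum) auto

lemma hausdorff_content_antimono:
  "\<delta> \<le> \<delta>' \<Longrightarrow> hausdorff_content s \<delta>' X \<le> hausdorff_content s \<delta> X"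
  by (intro hausdorff_content_greatest hausdorff_content_le_sum) (auto intro: order_trans)

lemma hausdorff_content_close:
  assumes "hausdorff_content s \<delta> X < c"
  obtains U where "X \<subseteq> (\<Union>i. U i)" "\<And>i::nat. bounded (U i)" "\<And>i. diameter (U i) \<le> \<delta>"
    "(\<Sum>i. diam_pow s (U i)) < c"
proof -
  from assms[unfolded hausdorff_content_def INF_less_iff] obtain U where
    "U \<in> {U. X \<subseteq> (\<Union>i. U i) \<and> (\<forall>i::nat. bounded (U i) \<and> diameter (U i) \<le> \<delta>)}"
    "(\<Sum>i. diam_pow s (U i)) < c" by blast
  with that show thesis by auto
qed

lemma hausdorff_content_countably_subadditive:
  "hausdorff_content s \<delta> (\<Union>i. A i) \<le> (\<Sum>i. hausdorff_content s \<delta> (A i))"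
proof (rule ennreal_le_epsilon)
  fix e :: real
  assume "0 < e" "(\<Sum>n. hausdorff_content s \<delta> (A n)) < top"
  then have *: "hausdorff_content s \<delta> (A n) < hausdorff_content s \<delta> (A n) + e * (1/2)^Suc n" for n
    by (auto simp add: less_top dest!: ennreal_suminf_lessD)
  have "\<forall>n. \<exists>U. A n \<subseteq> (\<Union>i. U i) \<and> (\<forall>i::nat. bounded (U i)) \<and> (\<forall>i. diameter (U i) \<le> \<delta>) \<and>
    (\<Sum>i. diam_pow s (U i)) \<le> hausdorff_content s \<delta> (A n) + e * (1/2)^Suc n"
    using hausdorff_content_close[OF *] by (metis less_imp_le)
  then obtain B where B: "\<And>n. A n \<subseteq> (\<Union>i::nat. B n i)" "\<And>n i. bounded (B n i)"
      "\<And>n i. diameter (B n i) \<le> \<delta>"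
      "\<And>n. (\<Sum>i. diam_pow s (B n i)) \<le> hausdorff_content s \<delta> (A n) + e * (1/2)^Suc n"
    by metis
  define C where "C = case_prod B o prod_decode"
  have "(\<Union>i. A i) \<subseteq> (\<Union>i. C i)"
    using B(1) by (auto simp add: C_def subset_eq) (metis prod.case prod_encode_inverse)
  then have "hausdorff_content s \<delta> (\<Union>i. A i) \<le> (\<Sum>i. diam_pow s (C i))"
    using B(2,3) by (intro hausdorff_content_le_sum) (auto simp: C_def split: prod.split)
  also have "\<dots> = (\<Sum>n. \<Sum>i. diam_pow s (B n i))"
    unfolding C_def comp_def
    using suminf_ennreal_2dimen[of "\<lambda>n. \<Sum>i. diam_pow s (B n i)" "\<lambda>p. diam_pow s (case_prod B p)"]
    by simp
  also have "\<dots> \<le> (\<Sum>n. hausdorff_content s \<delta> (A n) + e * (1/2) ^ Suc n)"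
    using B(4) by (intro suminf_le) auto
  also have "\<dots> = (\<Sum>n. hausdorff_content s \<delta> (A n)) + (\<Sum>n. ennreal e * ennreal ((1/2) ^ Suc n))"
    using \<open>0 < e\<close> by (subst suminf_add[symmetric])
                     (auto simp del: ennreal_suminf_cmult simp add: ennreal_mult[symmetric])
  also have "\<dots> = (\<Sum>n. hausdorff_content s \<delta> (A n)) + e"
    unfolding ennreal_suminf_cmult
    by (subst suminf_ennreal_eq[OF zero_le_power power_half_series]) auto
  finally show "hausdorff_content s \<delta> (\<Union>i. A i) \<le> (\<Sum>n. hausdorff_content s \<delta> (A n)) + e" .
qed

lemma hausdorff_content_le_measure:
  "0 < \<delta> \<Longrightarrow> hausdorff_content s \<delta> X \<le> hausdorff_measure s X"
  unfolding hausdorff_measure_def by (intro SUP_upper) auto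

lemma hausdorff_measure_least:
  assumes "\<And>\<delta>. 0 < \<delta> \<Longrightarrow> hausdorff_content s \<delta> X \<le> c"
  shows "hausdorff_measure s X \<le> c"
  unfolding hausdorff_measure_def using assms by (intro SUP_least) auto

lemma hausdorff_measure_empty [simp]: "hausdorff_measure s ({} :: 'a::metric_space set) = 0"
proof -
  have "hausdorff_measure s ({} :: 'a set) \<le> 0"
  proof (rule hausdorff_measure_least)
    fix \<delta> :: real assume "0 < \<delta>"
    then have "hausdorff_content s \<delta> ({}::'a set) \<le> (\<Sum>i::nat. diam_pow s ({} :: 'a set))"
      by (intro hausdorff_content_le_sum[of _ "\<lambda>_. {}"]) auto
    then show "hausdorff_content s \<delta> ({}::'a set) \<le> 0" by simp
  qed
  then show ?thesis by simp
qed

lemma hausdorff_measure_mono: "X \<subseteq> Y \<Longrightarrow> hausdorff_measure s X \<le> hausdorff_measure s Y"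
  unfolding hausdorff_measure_def by (intro SUP_mono) (auto intro: hausdorff_content_mono)

lemma hausdorff_measure_countably_subadditive:
  "hausdorff_measure s (\<Union>i::nat. A i) \<le> (\<Sum>i. hausdorff_measure s (A i))"
proof (rule hausdorff_measure_least)
  fix \<delta> :: real assume "0 < \<delta>"
  have "hausdorff_content s \<delta> (\<Union>i. A i) \<le> (\<Sum>i. hausdorff_content s \<delta> (A i))"
    by (rule hausdorff_content_countably_subadditive)
  also have "\<dots> \<le> (\<Sum>i. hausdorff_measure s (A i))"
    using \<open>0 < \<delta>\<close> by (intro suminf_le hausdorff_content_le_measure) auto
  finally show "hausdorff_content s \<delta> (\<Union>i. A i) \<le> (\<Sum>i. hausdorff_measure s (A i))" .
qed

lemma hausdorff_outer_measure: "outer_measure_space UNIV (hausdorff_measure s)"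
  unfolding outer_measure_space_def
  by (auto simp: positive_def increasing_def countably_subadditive_def
      intro: hausdorff_measure_mono hausdorff_measure_countably_subadditive)

lemma hausdorff_measure_Un_le:
  "hausdorff_measure s (X \<union> Y) \<le> hausdorff_measure s X + hausdorff_measure s Y"
proof -
  have "hausdorff_measure s (X \<union> Y) = hausdorff_measure s (\<Union>i::nat. if i = 0 then X else if i = 1 then Y else {})"
    by (intro arg_cong[where f="hausdorff_measure s"]) (auto split: if_splits)
  also have "\<dots> \<le> (\<Sum>i::nat. hausdorff_measure s (if i = 0 then X else if i = 1 then Y else {}))"
    by (rule hausdorff_measure_countably_subadditive)
  also have "\<dots> = (\<Sum>i\<in>{..<2::nat}. hausdorff_measure s (if i = 0 then X else if i = 1 then Y else {}))"
    by (rule suminf_finite) auto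
  also have "\<dots> = hausdorff_measure s X + hausdorff_measure s Y"
    by (simp add: numeral_2_eq_2)
  finally show ?thesis .
qed

text \<open>A cover by sets smaller than the gap between \<open>A\<close> and \<open>B\<close> splits into a cover of \<open>A\<close> and a
  cover of \<open>B\<close>: no set of the cover meets both.\<close>
lemma hausdorff_measure_separated:
  fixes A B :: "'a::metric_space set"
  assumes "0 \<le> s" "0 < d" and sep: "\<And>x y. x \<in> A \<Longrightarrow> y \<in> B \<Longrightarrow> d \<le> dist x y"
  shows "hausdorff_measure s A + hausdorff_measure s B \<le> hausdorff_measure s (A \<union> B)"
proof -
  have *: "hausdorff_content s \<delta> A + hausdorff_content s \<delta> B \<le> hausdorff_content s \<delta> (A \<union> B)"
    if "0 < \<delta>" "\<delta> < d" for \<delta>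
  proof (rule hausdorff_content_greatest)
    fix U :: "nat \<Rightarrow> 'a set"
    assume U: "A \<union> B \<subseteq> (\<Union>i. U i)" "\<And>i. bounded (U i)" "\<And>i. diameter (U i) \<le> \<delta>"
    have d: "diameter (U i \<inter> C) \<le> \<delta>" for i C
      using diameter_subset[of "U i \<inter> C" "U i"] U(2,3)[of i] by auto
    have "hausdorff_content s \<delta> A + hausdorff_content s \<delta> B
        \<le> (\<Sum>i. diam_pow s (U i \<inter> A)) + (\<Sum>i. diam_pow s (U i \<inter> B))"
      using U d by (intro add_mono hausdorff_content_le_sum) (auto intro: bounded_Int)
    also have "\<dots> = (\<Sum>i. diam_pow s (U i \<inter> A) + diam_pow s (U i \<inter> B))"
      by (rule suminf_add) auto
    also have "\<dots> \<le> (\<Sum>i. diam_pow s (U i))"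
    proof (intro suminf_le)
      fix i
      have "U i \<inter> A = {} \<or> U i \<inter> B = {}"
      proof (rule ccontr)
        assume "\<not> ?thesis"
        then obtain x y where xy: "x \<in> U i \<inter> A" "y \<in> U i \<inter> B" by blast
        then have "dist x y \<le> \<delta>"
          using diameter_bounded_bound[OF U(2), of x i y] U(3)[of i] by auto
        moreover have "d \<le> dist x y" using sep xy by auto
        ultimately show False using that by linarith
      qed
      then show "diam_pow s (U i \<inter> A) + diam_pow s (U i \<inter> B) \<le> diam_pow s (U i)"
        using diam_pow_mono[OF \<open>0 \<le> s\<close> _ U(2)[of i], of "U i \<inter> A"]
          diam_pow_mono[OF \<open>0 \<le> s\<close> _ U(2)[of i], of "U i \<inter> B"] by auto
    qed auto
    finally show "hausdorff_content s \<delta> A + hausdorff_content s \<delta> B \<le> (\<Sum>i. diam_pow s (U i))" .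
  qed
  have "hausdorff_measure s A + hausdorff_measure s B
      = (SUP \<delta>\<in>{0<..}. hausdorff_content s \<delta> A + hausdorff_content s \<delta> B)"
    unfolding hausdorff_measure_def
  proof (rule SUP_add_directed_ennreal[symmetric])
    fix i j :: real assume "i \<in> {0<..}" "j \<in> {0<..}"
    then show "\<exists>k\<in>{0<..}. hausdorff_content s i A + hausdorff_content s j B
        \<le> hausdorff_content s k A + hausdorff_content s k B"
      by (intro bexI[of _ "min i j"] add_mono hausdorff_content_antimono) auto
  qed
  also have "\<dots> \<le> hausdorff_measure s (A \<union> B)"
  proof (rule SUP_least)
    fix \<delta> :: real assume "\<delta> \<in> {0<..}"
    define e where "e = min \<delta> (d / 2)"
    have e: "0 < e" "e < d" "e \<le> \<delta>" using \<open>\<delta> \<in> _\<close> \<open>0 < d\<close> by (auto simp: e_def)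
    have "hausdorff_content s \<delta> A + hausdorff_content s \<delta> B \<le> hausdorff_content s e A + hausdorff_content s e B"
      using e by (intro add_mono hausdorff_content_antimono)
    also have "\<dots> \<le> hausdorff_content s e (A \<union> B)" using * e by simp
    also have "\<dots> \<le> hausdorff_measure s (A \<union> B)" using e(1) by (rule hausdorff_content_le_measure)
    finally show "hausdorff_content s \<delta> A + hausdorff_content s \<delta> B \<le> hausdorff_measure s (A \<union> B)" .
  qed
  finally show ?thesis .
qed

text \<open>The Caratheodory criterion for metric outer measures.  Outside the closed set \<open>F\<close>, cut \<open>X\<close>
  into the part \<open>Xn n\<close> at distance at least \<open>1 / Suc n\<close> from \<open>F\<close> and thin shells \<open>D n\<close> between
  consecutive such parts.  Every second shell is separated from the previous ones, so the measures
  of the shells are summable and the measure of \<open>Xn n\<close> tends to that of \<open>X - F\<close>.\<close>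
lemma closed_caratheodory_hausdorff:
  fixes F X :: "'a::metric_space set"
  assumes s: "0 \<le> s" and F: "closed F"
  shows "hausdorff_measure s (X \<inter> F) + hausdorff_measure s (X - F) \<le> hausdorff_measure s X"
proof (cases "F = {} \<or> hausdorff_measure s X = top")
  case True
  then show ?thesis by auto
next
  case False
  then have fin: "hausdorff_measure s X < top" and ne: "F \<noteq> {}" by (auto simp: less_top)
  define H where "H = (hausdorff_measure s :: 'a set \<Rightarrow> ennreal)"
  define Xn where "Xn n = {x \<in> X. 1 / Suc n \<le> infdist x F}" for n
  define D where "D n = Xn (Suc n) - Xn n" for n
  have HX: "H Y < top" if "Y \<subseteq> X" for Y
    using hausdorff_measure_mono[OF that, of s] fin by (auto simp: H_def)
  have XnX: "Xn n \<subseteq> X" for n by (auto simp: Xn_def)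
  have Xn_mono: "Xn n \<subseteq> Xn k" if "n \<le> k" for n k
  proof
    fix x assume "x \<in> Xn n"
    moreover have "1 / real (Suc k) \<le> 1 / Suc n" using that by (simp add: frac_le)
    ultimately show "x \<in> Xn k" by (auto simp: Xn_def)
  qed
  have sep1: "H (X \<inter> F) + H (Xn n) \<le> H X" for n
  proof -
    have "H (X \<inter> F) + H (Xn n) \<le> H ((X \<inter> F) \<union> Xn n)"
      unfolding H_def
    proof (rule hausdorff_measure_separated[OF s, of "1 / Suc n"])
      fix x y assume "x \<in> X \<inter> F" "y \<in> Xn n"
      then show "1 / real (Suc n) \<le> dist x y"
        using infdist_le[of x F y] by (auto simp: Xn_def dist_commute)
    qed auto
    also have "\<dots> \<le> H X" unfolding H_def using XnX by (intro hausdorff_measure_mono) auto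
    finally show ?thesis .
  qed
  have sep2: "H (Xn n) + H (D (Suc n)) \<le> H (Xn n \<union> D (Suc n))" for n
    unfolding H_def
  proof (rule hausdorff_measure_separated[OF s, of "1 / Suc n - 1 / Suc (Suc n)"])
    fix x y assume "x \<in> Xn n" "y \<in> D (Suc n)"
    then have "1 / Suc n \<le> infdist x F" "infdist y F < 1 / Suc (Suc n)"
      by (auto simp: Xn_def D_def not_le)
    then show "1 / real (Suc n) - 1 / real (Suc (Suc n)) \<le> dist x y"
      using infdist_triangle[of x F y] by linarith
  next
    show "0 < 1 / real (Suc n) - 1 / real (Suc (Suc n))"
      using frac_less2[of 1 1 "real (Suc n)" "real (Suc (Suc n))"] by simp
  qed
  have step: "H (Xn n) + H (D (Suc n)) \<le> H (Xn (n + 2))" for n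
  proof -
    have "Xn n \<union> D (Suc n) \<subseteq> Xn (n + 2)" using Xn_mono[of n "n + 2"] by (auto simp: D_def)
    then show ?thesis using sep2[of n] hausdorff_measure_mono[of _ _ s] unfolding H_def
      by (meson order_trans)
  qed
  have partial: "(\<Sum>k<n. H (D (Suc (2 * k + i)))) \<le> H (Xn (2 * n + i))" for n i
  proof (induction n)
    case (Suc n)
    then have "(\<Sum>k<Suc n. H (D (Suc (2 * k + i)))) \<le> H (Xn (2 * n + i)) + H (D (Suc (2 * n + i)))"
      by (simp add: add_right_mono)
    also have "\<dots> \<le> H (Xn (2 * Suc n + i))" using step[of "2 * n + i"] by simp
    finally show ?case .
  qed simp
  define f where "f k = enn2real (H (D k))" for k
  have f: "ennreal (f k) = H (D k)" for k
    unfolding f_def using HX[of "D k"] XnX by (intro ennreal_enn2real) (auto simp: D_def)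
  have f0: "0 \<le> f k" for k by (simp add: f_def)
  have half: "(\<Sum>k<n. f (Suc (2 * k + i))) \<le> enn2real (H X)" for n i
  proof -
    have "ennreal (\<Sum>k<n. f (Suc (2 * k + i))) = (\<Sum>k<n. H (D (Suc (2 * k + i))))"
      using f0 by (simp add: f[symmetric])
    also have "\<dots> \<le> H X"
      using partial[where n = n and i = i] hausdorff_measure_mono[OF XnX, of s "2 * n + i"] unfolding H_def
      by (meson order_trans)
    also have "\<dots> = ennreal (enn2real (H X))" using HX[of X] by simp
    finally show ?thesis by (simp add: ennreal_le_iff)
  qed
  have double: "(\<Sum>k<2 * n. g k) = (\<Sum>k<n. g (2 * k)) + (\<Sum>k<n. g (2 * k + 1))" for g :: "nat \<Rightarrow> real" and n
    by (induction n) auto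
  have "(\<Sum>k<n. f (Suc k)) \<le> 2 * enn2real (H X)" for n
  proof -
    have "(\<Sum>k<n. f (Suc k)) \<le> (\<Sum>k<2 * n. f (Suc k))"
      using f0 by (intro sum_mono2) auto
    then show ?thesis using half[where n=n and i=0] half[where n=n and i=1] double[of "\<lambda>k. f (Suc k)" n] by simp
  qed
  then have "summable (\<lambda>k. f (Suc k))"
    using f0 by (intro summableI_nonneg_bounded)
  then have summ: "summable f" by (simp add: summable_Suc_iff)
  show ?thesis
  proof (rule ennreal_le_epsilon)
    fix e :: real assume "0 < e"
    obtain n where n: "norm (\<Sum>i. f (i + n)) < e"
      using suminf_exist_split[OF \<open>0 < e\<close> summ] by blast
    have "X - F \<subseteq> Xn n \<union> (\<Union>k. D (k + n))"
    proof
      fix x assume x: "x \<in> X - F"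
      then have "0 < infdist x F" using F ne in_closed_iff_infdist_zero infdist_nonneg
        by (metis DiffD2 order_less_le)
      then obtain q where "1 / real (Suc q) < infdist x F"
        using nat_approx_posE by blast
      then have "x \<in> Xn q" using x by (auto simp: Xn_def)
      then have ex: "\<exists>q. x \<in> Xn q" ..
      define p where "p = (LEAST q. x \<in> Xn q)"
      have p: "x \<in> Xn p" and least: "q < p \<Longrightarrow> x \<notin> Xn q" for q
        using LeastI_ex[OF ex] not_less_Least unfolding p_def by auto
      show "x \<in> Xn n \<union> (\<Union>k. D (k + n))"
      proof (cases "p \<le> n")
        case True
        then show ?thesis using p Xn_mono by auto
      next
        case False
        then have "x \<in> D (p - 1)" "p - 1 = (p - 1 - n) + n" using p least[of "p - 1"] by (auto simp: D_def)
        then show ?thesis by (metis UN_I UNIV_I UnI2)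
      qed
    qed
    then have "H (X - F) \<le> H (Xn n \<union> (\<Union>k. D (k + n)))"
      unfolding H_def by (rule hausdorff_measure_mono)
    also have "\<dots> \<le> H (Xn n) + H (\<Union>k. D (k + n))"
      unfolding H_def by (rule hausdorff_measure_Un_le)
    also have "H (\<Union>k. D (k + n)) \<le> (\<Sum>k. H (D (k + n)))"
      unfolding H_def by (rule hausdorff_measure_countably_subadditive)
    also have "(\<Sum>k. H (D (k + n))) = ennreal (\<Sum>k. f (k + n))"
      unfolding f[symmetric] using summ f0 by (intro suminf_ennreal2) (auto simp: summable_iff_shift)
    also have "\<dots> \<le> ennreal e" using n by (intro ennreal_leI) auto
    finally have "H (X - F) \<le> H (Xn n) + ennreal e" by (simp add: add_left_mono)
    then have "H (X \<inter> F) + H (X - F) \<le> H (X \<inter> F) + H (Xn n) + ennreal e"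
      by (metis add.assoc add_left_mono)
    also have "\<dots> \<le> H X + ennreal e" using sep1 by (rule add_right_mono)
    finally show "hausdorff_measure s (X \<inter> F) + hausdorff_measure s (X - F) \<le> hausdorff_measure s X + ennreal e"
      by (simp add: H_def)
  qed
qed

lemma borel_lambda_system_hausdorff:
  assumes "0 \<le> s"
  shows "sets borel \<subseteq> lambda_system UNIV UNIV (hausdorff_measure s :: 'a::metric_space set \<Rightarrow> ennreal)"
proof -
  interpret sigma_algebra UNIV "UNIV :: 'a set set"
    using sigma_algebra_Pow[of "UNIV :: 'a set"] by simp
  have "measure_space UNIV (lambda_system UNIV UNIV (hausdorff_measure s)) (hausdorff_measure s :: 'a set \<Rightarrow> ennreal)"
    by (rule caratheodory_lemma[OF hausdorff_outer_measure])
  then have sig: "sigma_algebra UNIV (lambda_system UNIV UNIV (hausdorff_measure s :: 'a set \<Rightarrow> ennreal))"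
    by (simp add: measure_space_def)
  have "C \<in> lambda_system UNIV UNIV (hausdorff_measure s)" if "closed C" for C :: "'a set"
    unfolding lambda_system_eq
  proof (intro CollectI conjI ballI antisym)
    fix X :: "'a set"
    show "hausdorff_measure s (X \<inter> C) + hausdorff_measure s (X - C) \<le> hausdorff_measure s X"
      by (rule closed_caratheodory_hausdorff[OF assms that])
    show "hausdorff_measure s X \<le> hausdorff_measure s (X \<inter> C) + hausdorff_measure s (X - C)"
      using hausdorff_measure_Un_le[of s "X \<inter> C" "X - C"] by (simp add: Int_Diff_Un)
  qed auto
  then show ?thesis
    unfolding borel_eq_closed by (auto simp: intro!: sigma_algebra.sigma_sets_subset[OF sig])
qed

text \<open>Hausdorff measure as an object of type \<open>measure\<close>, which gives access to continuity along
  monotone sequences of Borel sets.\<close>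
definition hausdorff_borel :: "real \<Rightarrow> 'a::metric_space measure" where
  "hausdorff_borel s = measure_of UNIV (sets borel) (hausdorff_measure s)"

lemma sets_hausdorff_borel [simp, measurable_cong]: "sets (hausdorff_borel s) = sets borel"
  and space_hausdorff_borel [simp]: "space (hausdorff_borel s) = UNIV"
  unfolding hausdorff_borel_def
   apply (metis sets.sets_measure_of_eq space_borel)
  by (metis sets.space_measure_of_eq space_borel)

lemma emeasure_hausdorff_borel:
  assumes "0 \<le> s" "B \<in> sets borel"
  shows "emeasure (hausdorff_borel s) B = hausdorff_measure s B"
proof -
  interpret sigma_algebra UNIV "UNIV :: 'a set set"
    using sigma_algebra_Pow[of "UNIV :: 'a set"] by simp
  have "measure_space UNIV (lambda_system UNIV UNIV (hausdorff_measure s)) (hausdorff_measure s :: 'a set \<Rightarrow> ennreal)"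
    by (rule caratheodory_lemma[OF hausdorff_outer_measure])
  then have ca: "countably_additive (lambda_system UNIV UNIV (hausdorff_measure s)) (hausdorff_measure s :: 'a set \<Rightarrow> ennreal)"
    by (simp add: measure_space_def)
  have "countably_additive (sets borel) (hausdorff_measure s :: 'a set \<Rightarrow> ennreal)"
    using ca borel_lambda_system_hausdorff[OF assms(1)] unfolding countably_additive_def by blast
  then show ?thesis
    using assms(2) sets.sigma_sets_eq[of "borel :: 'a measure"] unfolding hausdorff_borel_def
    by (intro emeasure_measure_of[OF refl]) (auto simp: positive_def)
qed

lemma hausdorff_measure_split:
  assumes "0 \<le> s" "C \<in> sets borel"
  shows "hausdorff_measure s X = hausdorff_measure s (X \<inter> C) + hausdorff_measure s (X - C)"
proof -
  interpret sigma_algebra UNIV "UNIV :: 'a set set"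
    using sigma_algebra_Pow[of "UNIV :: 'a set"] by simp
  show ?thesis
    using subsetD[OF borel_lambda_system_hausdorff[OF assms(1)] assms(2)] unfolding lambda_system_eq by auto
qed

subsection \<open>Similitudes and dimension\<close>

text \<open>The Lipschitz bound is required on \<open>X\<close> only, so that the lemma also applies to the inverse of a
  similitude, which is Lipschitz on its range.\<close>
lemma hausdorff_measure_image_le:
  fixes f :: "'a::metric_space \<Rightarrow> 'b::metric_space"
  assumes "0 < s" "0 < L" and lip: "\<And>x y. x \<in> X \<Longrightarrow> y \<in> X \<Longrightarrow> dist (f x) (f y) \<le> L * dist x y"
  shows "hausdorff_measure s (f ` X) \<le> ennreal (L powr s) * hausdorff_measure s X"
proof (rule hausdorff_measure_least)
  fix \<delta> :: real assume "0 < \<delta>"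
  have "hausdorff_content s \<delta> (f ` X) / ennreal (L powr s) \<le> hausdorff_content s (\<delta> / L) X"
  proof (rule hausdorff_content_greatest)
    fix U :: "nat \<Rightarrow> 'a set"
    assume U: "X \<subseteq> (\<Union>i. U i)" "\<And>i. bounded (U i)" "\<And>i. diameter (U i) \<le> \<delta> / L"
    have dist: "dist x y \<le> L * diameter (U i)" if "x \<in> f ` (U i \<inter> X)" "y \<in> f ` (U i \<inter> X)" for x y i
    proof -
      from that obtain x' y' where xy: "x = f x'" "y = f y'" "x' \<in> U i \<inter> X" "y' \<in> U i \<inter> X" by auto
      then have "dist x y \<le> L * dist x' y'" using lip by auto
      also have "\<dots> \<le> L * diameter (U i)"
        using xy U(2) \<open>0 < L\<close> by (intro mult_left_mono diameter_bounded_bound) auto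
      finally show ?thesis .
    qed
    then have bdd: "bounded (f ` (U i \<inter> X))" for i
      unfolding bounded_two_points by blast
    have diam: "diameter (f ` (U i \<inter> X)) \<le> L * diameter (U i)" for i
      using dist \<open>0 < L\<close> diameter_ge_0[OF U(2)] by (intro diameter_le_dist) auto
    have "hausdorff_content s \<delta> (f ` X) \<le> (\<Sum>i. diam_pow s (f ` (U i \<inter> X)))"
    proof (rule hausdorff_content_le_sum)
      show "diameter (f ` (U i \<inter> X)) \<le> \<delta>" for i
      proof -
        have "L * diameter (U i) \<le> \<delta>" using U(3)[of i] \<open>0 < L\<close> by (simp add: field_simps)
        then show ?thesis using diam[of i] by linarith
      qed
    qed (use U(1) bdd in blast)+
    also have "\<dots> \<le> (\<Sum>i. ennreal (L powr s) * diam_pow s (U i))"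
    proof (intro suminf_le)
      fix i
      have "diameter (f ` (U i \<inter> X)) powr s \<le> (L * diameter (U i)) powr s"
        using diam[of i] diameter_ge_0[OF bdd] \<open>0 < s\<close> by (intro powr_mono2) auto
      also have "\<dots> = L powr s * diameter (U i) powr s"
        using \<open>0 < L\<close> diameter_ge_0[OF U(2)] by (simp add: powr_mult)
      finally show "diam_pow s (f ` (U i \<inter> X)) \<le> ennreal (L powr s) * diam_pow s (U i)"
        using \<open>0 < s\<close> by (simp add: diam_pow_pos ennreal_leI flip: ennreal_mult)
    qed auto
    also have "\<dots> = ennreal (L powr s) * (\<Sum>i. diam_pow s (U i))" by simp
    finally show "hausdorff_content s \<delta> (f ` X) / ennreal (L powr s) \<le> (\<Sum>i. diam_pow s (U i))"
      using \<open>0 < L\<close> by (intro divide_le_posI_ennreal) (auto simp: mult.commute)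
  qed
  also have "\<dots> \<le> hausdorff_measure s X"
    using \<open>0 < \<delta>\<close> \<open>0 < L\<close> by (intro hausdorff_content_le_measure) auto
  finally have "ennreal (L powr s) * (hausdorff_content s \<delta> (f ` X) / ennreal (L powr s))
      \<le> ennreal (L powr s) * hausdorff_measure s X"
    by (rule mult_left_mono) simp
  then show "hausdorff_content s \<delta> (f ` X) \<le> ennreal (L powr s) * hausdorff_measure s X"
    using mult_divide_eq_ennreal[of "ennreal (L powr s)" "hausdorff_content s \<delta> (f ` X)"] \<open>0 < L\<close>
    by (simp add: ennreal_times_divide mult.commute)
qed

lemma hausdorff_measure_similitude:
  fixes f :: "'a::metric_space \<Rightarrow> 'b::metric_space"
  assumes "0 < s" "0 < r" and sim: "\<And>x y. dist (f x) (f y) = r * dist x y"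
  shows "hausdorff_measure s (f ` X) = ennreal (r powr s) * hausdorff_measure s X"
proof (rule antisym)
  show "hausdorff_measure s (f ` X) \<le> ennreal (r powr s) * hausdorff_measure s X"
    using assms by (intro hausdorff_measure_image_le) auto
  have inj: "inj f"
    using sim \<open>0 < r\<close> by (metis injI dist_self mult_eq_0_iff less_irrefl dist_eq_0_iff)
  have "hausdorff_measure s (inv f ` (f ` X)) \<le> ennreal ((1 / r) powr s) * hausdorff_measure s (f ` X)"
    using assms(1,2) sim inj by (intro hausdorff_measure_image_le) auto
  also have "inv f ` (f ` X) = X" using inj by simp
  finally have "ennreal (r powr s) * hausdorff_measure s X
      \<le> ennreal (r powr s) * (ennreal ((1 / r) powr s) * hausdorff_measure s (f ` X))"
    by (rule mult_left_mono) simp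
  also have "\<dots> = ennreal (r powr s * (1 / r) powr s) * hausdorff_measure s (f ` X)"
    by (simp add: ennreal_mult mult.assoc)
  also have "r powr s * (1 / r) powr s = 1"
    using \<open>0 < r\<close> by (simp flip: powr_mult)
  finally show "ennreal (r powr s) * hausdorff_measure s X \<le> hausdorff_measure s (f ` X)" by simp
qed

text \<open>A set of diameter at most \<open>\<delta>\<close> has \<open>u\<close>-power at most \<open>\<delta> powr (u - t)\<close> times its
  \<open>t\<close>-power, so a finite \<open>t\<close>-measure forces the \<open>u\<close>-measure to vanish for \<open>t < u\<close>.\<close>
lemma hausdorff_measure_larger_exponent:
  fixes X :: "'a::metric_space set"
  assumes "0 \<le> t" "t < u" and fin: "hausdorff_measure t X < \<infinity>"
  shows "hausdorff_measure u X = 0"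
proof -
  define M where "M = enn2real (hausdorff_measure t X)"
  have M: "hausdorff_measure t X = ennreal M" using fin by (simp add: M_def)
  have key: "hausdorff_content u \<delta> X \<le> ennreal (\<delta> powr (u - t) * (M + 1))" if "0 < \<delta>" for \<delta>
  proof -
    have "hausdorff_content t \<delta> X \<le> ennreal M"
      using hausdorff_content_le_measure[OF that] M by metis
    also have "\<dots> < ennreal (M + 1)" by (simp add: M_def ennreal_less_iff)
    finally obtain U where U: "X \<subseteq> (\<Union>i. U i)" "\<And>i::nat. bounded (U i)" "\<And>i. diameter (U i) \<le> \<delta>"
      "(\<Sum>i. diam_pow t (U i)) < ennreal (M + 1)"
      by (rule hausdorff_content_close) blast
    have "hausdorff_content u \<delta> X \<le> (\<Sum>i. diam_pow u (U i))"
      using U by (intro hausdorff_content_le_sum)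
    also have "\<dots> \<le> (\<Sum>i. ennreal (\<delta> powr (u - t)) * diam_pow t (U i))"
    proof (intro suminf_le)
      fix i
      show "diam_pow u (U i) \<le> ennreal (\<delta> powr (u - t)) * diam_pow t (U i)"
      proof (cases "U i = {} \<or> diameter (U i) = 0")
        case True
        then show ?thesis using assms by (auto simp: diam_pow_def)
      next
        case False
        then have p: "0 < diameter (U i)" using diameter_ge_0[OF U(2)[of i]] by simp
        have "diameter (U i) powr u = diameter (U i) powr (u - t) * diameter (U i) powr t"
          by (simp flip: powr_add)
        also have "\<dots> \<le> \<delta> powr (u - t) * diameter (U i) powr t"
          using p U(3)[of i] assms by (intro mult_right_mono powr_mono2) auto
        finally have "diameter (U i) powr u \<le> \<delta> powr (u - t) * diameter (U i) powr t" .
        moreover have "diam_pow t (U i) = ennreal (diameter (U i) powr t)"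
          using False p by (simp add: diam_pow_def)
        ultimately show ?thesis using False assms
          by (simp add: diam_pow_pos ennreal_leI flip: ennreal_mult)
      qed
    qed auto
    also have "\<dots> = ennreal (\<delta> powr (u - t)) * (\<Sum>i. diam_pow t (U i))" by simp
    also have "\<dots> \<le> ennreal (\<delta> powr (u - t)) * ennreal (M + 1)"
      using U(4) by (intro mult_left_mono) auto
    also have "\<dots> = ennreal (\<delta> powr (u - t) * (M + 1))"
      by (simp add: ennreal_mult M_def)
    finally show ?thesis .
  qed
  have lim: "((\<lambda>\<delta>. \<delta> powr (u - t) * (M + 1)) \<longlongrightarrow> 0) (at_right 0)"
    using assms by (auto intro!: tendsto_eq_intros simp: eventually_at_right_less eventually_at_filter)
  have "hausdorff_measure u X \<le> 0"
  proof (rule hausdorff_measure_least)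
    fix \<delta> :: real assume "0 < \<delta>"
    have "hausdorff_content u \<delta> X \<le> 0 + ennreal e" if "0 < e" for e
    proof -
      have "\<forall>\<^sub>F d in at_right 0. d powr (u - t) * (M + 1) < e"
        using order_tendstoD(2)[OF lim that] .
      moreover have "\<forall>\<^sub>F d in at_right 0. 0 < d \<and> d < \<delta>"
        using \<open>0 < \<delta>\<close> by (auto simp: eventually_at_right_field)
      ultimately have "\<forall>\<^sub>F d in at_right 0. d powr (u - t) * (M + 1) < e \<and> 0 < d \<and> d < \<delta>"
        by (rule eventually_conj)
      then obtain d where d: "d powr (u - t) * (M + 1) < e" "0 < d" "d < \<delta>"
        using eventually_happens[of _ "at_right (0::real)"] by (auto simp: trivial_limit_at_right_real)
      have "hausdorff_content u \<delta> X \<le> hausdorff_content u d X"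
        using d by (intro hausdorff_content_antimono) auto
      also have "\<dots> \<le> ennreal e" using key[OF d(2)] d(1) by (meson ennreal_leI less_imp_le order_trans)
      finally show ?thesis by simp
    qed
    then show "hausdorff_content u \<delta> X \<le> 0" by (rule ennreal_le_epsilon)
  qed
  then show ?thesis by simp
qed

lemma hausdorff_dim_eqI:
  fixes X :: "'a::euclidean_space set"
  assumes "0 < s" "0 < hausdorff_measure s X" "hausdorff_measure s X < \<infinity>"
  shows "hausdorff_dim X = s"
proof -
  have "{t. 0 \<le> t \<and> hausdorff_measure t X = 0} = {s<..}"
  proof (intro set_eqI iffI)
    fix t assume t: "t \<in> {t. 0 \<le> t \<and> hausdorff_measure t X = 0}"
    then have "t \<noteq> s" using assms by auto
    moreover have "\<not> t < s"
      using t hausdorff_measure_larger_exponent[of t s X] assms by auto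
    ultimately show "t \<in> {s<..}" by auto
  next
    fix t assume "t \<in> {s<..}"
    then show "t \<in> {t. 0 \<le> t \<and> hausdorff_measure t X = 0}"
      using hausdorff_measure_larger_exponent[of s t X] assms by auto
  qed
  then show ?thesis by (simp add: hausdorff_dim_def cInf_greaterThan)
qed

section \<open>Self-similar sets under the open set condition\<close>

text \<open>Up to scaling and translation \<open>f\<close> is an isometry fixing the origin, hence orthogonal, hence onto.
  An image of a ball is a full ball only because \<open>f\<close> is onto.\<close>
lemma similitude_image_ball:
  fixes f :: "'a::euclidean_space \<Rightarrow> 'a"
  assumes "0 < r" and sim: "\<And>x y. dist (f x) (f y) = r * dist x y"
  shows "f ` ball z b = ball (f z) (r * b)"
proof -
  define g where "g x = (1 / r) *\<^sub>R (f x - f 0)" for x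
  have "dist (g x) (g y) = dist x y" for x y
    using sim[of x y] \<open>0 < r\<close> by (simp add: g_def dist_norm flip: scaleR_diff_right)
  then have "orthogonal_transformation g"
    by (metis orthogonal_transformation_isometry diff_self g_def scaleR_zero_right)
  then have surj: "surj g" by (rule orthogonal_transformation_surj)
  have "\<exists>x. f x = y" for y
  proof -
    obtain x where "g x = (1 / r) *\<^sub>R (y - f 0)" using surj by (metis surj_def)
    then show ?thesis using \<open>0 < r\<close> by (auto simp: g_def)
  qed
  note onto = this
  show ?thesis
  proof (intro set_eqI iffI)
    fix y assume "y \<in> ball (f z) (r * b)"
    moreover obtain x where "f x = y" using onto by blast
    ultimately show "y \<in> f ` ball z b" using sim[of z x] \<open>0 < r\<close> by auto
  qed (use sim \<open>0 < r\<close> in auto)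
qed

lemma card_disjoint_balls_le:
  fixes c :: "'i \<Rightarrow> 'a::euclidean_space"
  assumes "finite F" "0 < t" "0 \<le> R" and sub: "\<And>i. i \<in> F \<Longrightarrow> ball (c i) t \<subseteq> ball x R"
    and disj: "disjoint_family_on (\<lambda>i. ball (c i) t) F"
  shows "real (card F) \<le> (R / t) ^ DIM('a)"
proof -
  let ?u = "unit_ball_vol (DIM('a))"
  have "real (card F) * (?u * t ^ DIM('a)) = (\<Sum>i\<in>F. measure lborel (ball (c i) t))"
    using \<open>0 < t\<close> by (simp add: content_ball)
  also have "\<dots> = measure lborel (\<Union>i\<in>F. ball (c i) t)"
    using assms by (intro measure_finite_Union[symmetric]) (auto simp: emeasure_ball)
  also have "\<dots> \<le> measure lborel (ball x R)"
    using sub \<open>0 \<le> R\<close> by (intro measure_mono_fmeasurable) (auto simp: fmeasurable_def emeasure_ball intro!: borel_open open_UN)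
  also have "\<dots> = ?u * R ^ DIM('a)" using \<open>0 \<le> R\<close> by (simp add: content_ball)
  finally have "?u * (real (card F) * t ^ DIM('a)) \<le> ?u * R ^ DIM('a)" by (simp add: mult_ac)
  then have "real (card F) * t ^ DIM('a) \<le> R ^ DIM('a)"
    by (subst (asm) mult_le_cancel_left_pos) auto
  then show ?thesis using \<open>0 < t\<close> by (simp add: field_simps power_divide)
qed

lemma sum_UN_le:
  fixes f :: "'b \<Rightarrow> real"
  assumes "finite C" "\<And>i. i \<in> C \<Longrightarrow> finite (W i)" "\<And>x. 0 \<le> f x"
  shows "sum f (\<Union>i\<in>C. W i) \<le> (\<Sum>i\<in>C. sum f (W i))"
  using assms(1,2)
proof (induction C rule: finite_induct)
  case (insert i C)
  then have "sum f (W i \<union> (\<Union>i\<in>C. W i)) \<le> sum f (W i) + sum f (\<Union>i\<in>C. W i)"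
    using assms(3) by (subst sum_Un) (auto intro: sum_nonneg)
  with insert show ?case by force
qed simp

locale similitudes =
  fixes S :: "nat \<Rightarrow> 'a::euclidean_space \<Rightarrow> 'a" and N :: nat and r :: "nat \<Rightarrow> real"
  assumes ratio: "\<And>i. i < N \<Longrightarrow> 0 < r i" "\<And>i. i < N \<Longrightarrow> r i < 1"
    and similitude: "\<And>i x y. i < N \<Longrightarrow> dist (S i x) (S i y) = r i * dist x y"
    and N2: "2 \<le> N"
begin

definition word_ratio :: "nat list \<Rightarrow> real" where
  "word_ratio I = prod_list (map r I)"

definition rmax :: real where "rmax = Max (r ` {..<N})"
definition rmin :: real where "rmin = Min (r ` {..<N})"

definition words :: "nat \<Rightarrow> nat list set" where
  "words n = {I. set I \<subseteq> {..<N} \<and> length I = n}"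

lemma word_ratio_simps [simp]:
  "word_ratio [] = 1" "word_ratio (i # I) = r i * word_ratio I"
  "word_ratio (I @ J) = word_ratio I * word_ratio J"
  by (simp_all add: word_ratio_def)

lemma rmax: "0 < rmax" "rmax < 1" "i < N \<Longrightarrow> r i \<le> rmax"
proof -
  have ne: "r ` {..<N} \<noteq> {}" using N2 by (auto simp: lessThan_empty_iff)
  have "rmax \<in> r ` {..<N}" unfolding rmax_def using ne by (intro Max_in) auto
  then show "0 < rmax" "rmax < 1" using ratio by auto
  show "i < N \<Longrightarrow> r i \<le> rmax" unfolding rmax_def by (intro Max_ge) auto
qed

lemma rmin: "0 < rmin" "i < N \<Longrightarrow> rmin \<le> r i"
proof -
  have ne: "r ` {..<N} \<noteq> {}" using N2 by (auto simp: lessThan_empty_iff)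
  have "rmin \<in> r ` {..<N}" unfolding rmin_def using ne by (intro Min_in) auto
  then show "0 < rmin" using ratio by auto
  show "i < N \<Longrightarrow> rmin \<le> r i" unfolding rmin_def by (intro Min_le) auto
qed

lemma finite_words [simp]: "finite (words n)"
  unfolding words_def by (rule finite_lists_length_eq) simp

lemma words_0: "words 0 = {[]}" by (auto simp: words_def)

lemma words_Suc: "words (Suc n) = (\<lambda>(i, I). i # I) ` ({..<N} \<times> words n)"
  by (auto simp: words_def length_Suc_conv)

lemma word_ratio_pos: "set I \<subseteq> {..<N} \<Longrightarrow> 0 < word_ratio I"
  by (induction I) (auto simp: ratio)

lemma word_ratio_le: "set I \<subseteq> {..<N} \<Longrightarrow> word_ratio I \<le> rmax ^ length I"
proof (induction I)
  case (Cons i I)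
  then show ?case
    using rmax word_ratio_pos[of I] by (auto intro!: mult_mono)
qed simp

lemma word_ratio_le_1: "set I \<subseteq> {..<N} \<Longrightarrow> word_ratio I \<le> 1"
  using word_ratio_le[of I] rmax power_le_one[of rmax "length I"] by linarith

lemma dist_foldr:
  "set I \<subseteq> {..<N} \<Longrightarrow> dist (foldr S I x) (foldr S I y) = word_ratio I * dist x y"
  by (induction I) (auto simp: similitude)

lemma foldr_image_append: "foldr S (I @ J) ` X = foldr S I ` (foldr S J ` X)"
  by (auto simp: image_image)

lemma inj_S: "i < N \<Longrightarrow> inj (S i)"
  by (metis injI dist_eq_0_iff mult_eq_0_iff ratio(1) similitude less_irrefl)

lemma continuous_S: "j < N \<Longrightarrow> continuous_on X (S j)"
  by (rule lipschitz_on_continuous_on[of "r j"], rule lipschitz_onI)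
     (auto simp: similitude ratio less_imp_le)

lemma S_vimage_borel: "j < N \<Longrightarrow> B \<in> sets borel \<Longrightarrow> S j -` B \<in> sets borel"
  using measurable_sets_borel[OF borel_measurable_continuous_onI[OF continuous_S]] by blast

lemma compact_S_image: "j < N \<Longrightarrow> compact X \<Longrightarrow> compact (S j ` X)"
  by (rule compact_continuous_image[OF continuous_S])

lemma sum_word_ratio_powr:
  assumes "(\<Sum>i<N. r i powr s) = 1"
  shows "(\<Sum>I\<in>words n. word_ratio I powr s) = 1"
proof (induction n)
  case 0
  then show ?case by (simp add: words_0)
next
  case (Suc n)
  have "(\<Sum>I\<in>words (Suc n). word_ratio I powr s)
      = (\<Sum>(i, I)\<in>{..<N} \<times> words n. r i powr s * word_ratio I powr s)"
    unfolding words_Suc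
    by (subst sum.reindex) (auto simp: inj_on_def words_def intro!: sum.cong powr_mult)
  also have "\<dots> = (\<Sum>i<N. r i powr s) * (\<Sum>I\<in>words n. word_ratio I powr s)"
    by (simp add: sum_product sum.cartesian_product)
  finally show ?case using Suc assms by simp
qed

text \<open>The sum is \<open>N \<ge> 2\<close> at \<open>s = 0\<close> and at most \<open>1\<close> at the \<open>s1\<close> for which \<open>rmax powr s1 = 1 / N\<close>;
  apply the intermediate value theorem.\<close>
lemma similarity_exponent: "\<exists>s>0. (\<Sum>i<N. r i powr s) = 1"
proof -
  define s1 where "s1 = ln N / - ln rmax"
  have ln: "ln rmax < 0" using rmax by simp
  have s1: "0 < s1" using ln N2 by (simp add: s1_def divide_pos_neg)
  have "rmax powr s1 = 1 / N"
    using ln rmax N2 by (simp add: powr_def s1_def exp_minus inverse_eq_divide)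
  then have "r i powr s1 \<le> 1 / N" if "i < N" for i
    using powr_mono2[of s1 "r i" rmax] that ratio rmax s1 by (metis less_imp_le)
  then have "(\<Sum>i<N. r i powr s1) \<le> (\<Sum>i<N. 1 / N)" by (intro sum_mono) auto
  then have "(\<Sum>i<N. r i powr s1) \<le> 1" using N2 by simp
  moreover have sum0: "(\<Sum>i<N. r i powr 0) = N"
  proof -
    have "(\<Sum>i<N. r i powr 0) = (\<Sum>i<N. 1)" using ratio(1) by (intro sum.cong) fastforce+
    then show ?thesis by simp
  qed
  moreover have "continuous_on {0..s1} (\<lambda>s. \<Sum>i<N. r i powr s)"
    using ratio(1) by (intro continuous_intros) fastforce+
  ultimately obtain s where s: "0 \<le> s" "s \<le> s1" "(\<Sum>i<N. r i powr s) = 1"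
    using IVT2'[of "\<lambda>s. \<Sum>i<N. r i powr s" s1 1 0] s1 N2 by auto
  have "s \<noteq> 0" using s(3) sum0 N2 by auto
  then show ?thesis using s by (intro exI[of _ s]) auto
qed

lemma foldr_images_subset:
  assumes "(\<Union>j<N. S j ` X) \<subseteq> X" "set I \<subseteq> {..<N}"
  shows "foldr S I ` X \<subseteq> X"
  using assms(2)
proof (induction I)
  case (Cons i I)
  then have "S i ` (foldr S I ` X) \<subseteq> S i ` X" "i < N" by auto
  then show ?case using assms(1) by (auto simp: image_comp comp_def)
qed simp

lemma invariant_set_words:
  assumes "K = (\<Union>j<N. S j ` K)"
  shows "K = (\<Union>I\<in>words n. foldr S I ` K)"
proof (induction n)
  case 0
  then show ?case by (simp add: words_0)
next
  case (Suc n)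
  have "(\<Union>I\<in>words (Suc n). foldr S I ` K) = (\<Union>i<N. S i ` (\<Union>I\<in>words n. foldr S I ` K))"
    unfolding words_Suc by (fastforce simp: image_UN image_image)
  then show ?case using Suc assms by simp
qed

text \<open>By Moran's equation the level-\<open>n\<close> copies of \<open>K\<close> have, for every \<open>n\<close>, the same sum
  \<open>diameter K powr s\<close> of \<open>s\<close>-powers of diameters, while the diameters tend to zero.\<close>
lemma hausdorff_measure_invariant_set_finite:
  assumes K: "compact K" "K = (\<Union>j<N. S j ` K)" and s: "0 < s" "(\<Sum>i<N. r i powr s) = 1"
  shows "hausdorff_measure s K < \<infinity>"
proof -
  define d where "d = diameter K"
  have d0: "0 \<le> d" using diameter_ge_0 compact_imp_bounded K(1) by (auto simp: d_def)
  have "hausdorff_measure s K \<le> ennreal (d powr s)"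
  proof (rule hausdorff_measure_least)
    fix \<delta> :: real assume "0 < \<delta>"
    have "(\<lambda>n. rmax ^ n * d) \<longlonglongrightarrow> 0 * d"
      using rmax by (intro tendsto_intros LIMSEQ_power_zero) auto
    then have "\<forall>\<^sub>F n in sequentially. rmax ^ n * d < \<delta>"
      using \<open>0 < \<delta>\<close> by (intro order_tendstoD) auto
    then obtain n where n: "rmax ^ n * d < \<delta>" by (auto simp: eventually_sequentially)
    obtain xs where xs: "set xs = words n" "distinct xs"
      using finite_distinct_list[OF finite_words] by blast
    define U where "U i = (if i < length xs then foldr S (xs ! i) ` K else {})" for i
    have w: "set (xs ! i) \<subseteq> {..<N}" "length (xs ! i) = n" if "i < length xs" for i
      using nth_mem[OF that] xs by (auto simp: words_def)
    have dd: "dist x y \<le> word_ratio (xs ! i) * d"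
      if "i < length xs" "x \<in> foldr S (xs ! i) ` K" "y \<in> foldr S (xs ! i) ` K" for i x y
      using that w[OF that(1)] word_ratio_pos[OF w(1)[OF that(1)]]
        diameter_bounded_bound[OF compact_imp_bounded[OF K(1)]]
      by (auto simp: dist_foldr d_def)
    have diamU: "diameter (U i) \<le> word_ratio (xs ! i) * d" if "i < length xs" for i
      using that dd[OF that] d0 word_ratio_pos[OF w(1)[OF that]]
      by (auto simp: U_def intro!: diameter_le_dist)
    have bdd: "bounded (U i)" for i
    proof (cases "i < length xs")
      case True
      then show ?thesis unfolding bounded_two_points using dd[OF True] by (auto simp: U_def)
    qed (simp add: U_def)
    have "hausdorff_content s \<delta> K \<le> (\<Sum>i. diam_pow s (U i))"
    proof (rule hausdorff_content_le_sum)
      have "K \<subseteq> (\<Union>I\<in>words n. foldr S I ` K)" using invariant_set_words[OF K(2)] by simp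
      also have "\<dots> \<subseteq> (\<Union>i. U i)"
        unfolding xs(1)[symmetric] by (auto simp: U_def in_set_conv_nth) (metis imageI)
      finally show "K \<subseteq> (\<Union>i. U i)" .
      show "bounded (U i)" for i by (rule bdd)
      show "diameter (U i) \<le> \<delta>" for i
      proof (cases "i < length xs")
        case True
        then have "word_ratio (xs ! i) * d \<le> rmax ^ n * d"
          using word_ratio_le[OF w(1)[OF True]] w(2)[OF True] d0 by (intro mult_right_mono) auto
        then show ?thesis using diamU[OF True] n by linarith
      next
        case False
        then show ?thesis using \<open>0 < \<delta>\<close> by (simp add: U_def)
      qed
    qed
    also have "\<dots> = (\<Sum>i<length xs. diam_pow s (U i))"
      by (rule suminf_finite) (auto simp: U_def)
    also have "\<dots> \<le> (\<Sum>i<length xs. ennreal (word_ratio (xs ! i) powr s * d powr s))"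
    proof (intro sum_mono)
      fix i assume "i \<in> {..<length xs}"
      then have i: "i < length xs" by simp
      have "diameter (U i) powr s \<le> (word_ratio (xs ! i) * d) powr s"
        using diamU[OF i] diameter_ge_0[OF bdd] s by (intro powr_mono2) auto
      then show "diam_pow s (U i) \<le> ennreal (word_ratio (xs ! i) powr s * d powr s)"
        using s word_ratio_pos[OF w(1)[OF i]] d0 by (simp add: diam_pow_pos ennreal_leI powr_mult)
    qed
    also have "\<dots> = ennreal ((\<Sum>i<length xs. word_ratio (xs ! i) powr s) * d powr s)"
      by (simp add: sum_distrib_right)
    also have "(\<Sum>i<length xs. word_ratio (xs ! i) powr s) = (\<Sum>I\<in>words n. word_ratio I powr s)"
      using xs bij_betw_nth[OF xs(2) refl xs(1)[symmetric]]
      by (intro sum.reindex_bij_betw) auto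
    also have "\<dots> = 1" by (rule sum_word_ratio_powr[OF s(2)])
    finally show "hausdorff_content s \<delta> K \<le> ennreal (d powr s)" by simp
  qed
  then show ?thesis by (auto simp: order_le_less_trans)
qed

subsection \<open>Positive measure\<close>

lemma disjoint_incomparable_words:
  assumes U: "(\<Union>j<N. S j ` U) \<subseteq> U" "disjoint_family_on (\<lambda>i. S i ` U) {..<N}"
  shows "set I \<subseteq> {..<N} \<Longrightarrow> set J \<subseteq> {..<N} \<Longrightarrow> (\<And>L. J \<noteq> I @ L) \<Longrightarrow> (\<And>L. I \<noteq> J @ L) \<Longrightarrow>
    foldr S I ` U \<inter> foldr S J ` U = {}"
proof (induction I arbitrary: J)
  case Nil
  from Nil.prems(3)[of J] show ?case by simp
next
  case (Cons i I)
  from Cons.prems(4) obtain j J' where J: "J = j # J'" by (cases J) auto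
  show ?case
  proof (cases "i = j")
    case True
    have "foldr S I ` U \<inter> foldr S J' ` U = {}"
      using Cons.prems J True by (intro Cons.IH) auto
    then have "S i ` (foldr S I ` U \<inter> foldr S J' ` U) = {}" by simp
    then have "S i ` foldr S I ` U \<inter> S i ` foldr S J' ` U = {}"
      using inj_S[of i] Cons.prems(1) by (subst image_Int[symmetric]) auto
    then show ?thesis using J True by (simp add: image_image)
  next
    case False
    have sub: "foldr S I ` U \<subseteq> U" "foldr S J' ` U \<subseteq> U"
      using foldr_images_subset[OF U(1)] Cons.prems J by auto
    then have "S i ` foldr S I ` U \<inter> S j ` foldr S J' ` U \<subseteq> S i ` U \<inter> S j ` U" by blast
    moreover have "S i ` U \<inter> S j ` U = {}"
      using U(2) Cons.prems J False by (auto simp: disjoint_family_on_def)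
    ultimately have "S i ` foldr S I ` U \<inter> S j ` foldr S J' ` U = {}" by blast
    then show ?thesis by (simp add: J image_image)
  qed
qed

text \<open>The words whose ratio has just dropped to \<open>\<rho>\<close>.  For \<open>0 < \<rho> < 1\<close> every sufficiently long word has
  exactly one prefix of this kind.\<close>
definition stopping_words :: "real \<Rightarrow> nat list set" where
  "stopping_words \<rho> = {I. I \<noteq> [] \<and> set I \<subseteq> {..<N} \<and> word_ratio I \<le> \<rho> \<and> \<rho> < word_ratio (butlast I)}"

lemma stopping_incomparable:
  assumes "I \<in> stopping_words \<rho>" "J \<in> stopping_words \<rho>" "I \<noteq> J"
  shows "J \<noteq> I @ L"
proof
  assume J: "J = I @ L"
  with assms have "L \<noteq> []" by auto
  with J have "butlast J = I @ butlast L" by (simp add: butlast_append)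
  moreover have "set (butlast L) \<subseteq> {..<N}"
    using assms J \<open>L \<noteq> []\<close> by (auto simp: stopping_words_def dest: in_set_butlastD)
  ultimately have "word_ratio (butlast J) \<le> word_ratio I"
    using word_ratio_le_1[of "butlast L"] word_ratio_pos[of I] assms by (auto simp: stopping_words_def)
  with assms show False by (auto simp: stopping_words_def)
qed

lemma stopping_ratio_ge:
  assumes "I \<in> stopping_words \<rho>" shows "rmin * \<rho> \<le> word_ratio I"
proof -
  have I: "I = butlast I @ [last I]" using assms by (auto simp: stopping_words_def)
  have "last I < N" using assms last_in_set[of I] unfolding stopping_words_def by blast
  have "rmin * \<rho> \<le> r (last I) * word_ratio (butlast I)"
  proof (cases "0 \<le> \<rho>")
    case True
    then show ?thesis using rmin(2)[OF \<open>last I < N\<close>] ratio(1)[OF \<open>last I < N\<close>] assms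
      by (intro mult_mono) (auto simp: stopping_words_def)
  next
    case False
    then have "\<rho> < 0" by simp
    have "set I \<subseteq> {..<N}" using assms by (simp add: stopping_words_def)
    then have "0 < word_ratio I" by (rule word_ratio_pos)
    then show ?thesis using assms \<open>\<rho> < 0\<close> by (auto simp: stopping_words_def)
  qed
  then show ?thesis by (subst I) (simp add: mult.commute)
qed

text \<open>The sets \<open>S\<^sub>I(U)\<close>, \<open>I \<in> stopping_words \<rho>\<close>, are disjoint and contain balls of radius comparable to
  \<open>\<rho>\<close>, so by volume only boundedly many of them come within distance \<open>\<rho>\<close> of a given point.\<close>
lemma card_stopping_meeting_ball:
  assumes K: "compact K" and osc: "open_set_condition S N"
  shows "\<exists>q. \<forall>x \<rho> M. 0 < \<rho> \<longrightarrow> finite M \<longrightarrow> M \<subseteq> stopping_words \<rho> \<longrightarrow>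
    (\<forall>I\<in>M. foldr S I ` K \<inter> ball x \<rho> \<noteq> {}) \<longrightarrow> real (card M) \<le> q"
proof -
  obtain U where U: "open U" "U \<noteq> {}" "(\<Union>i<N. S i ` U) \<subseteq> U" "disjoint_family_on (\<lambda>i. S i ` U) {..<N}"
    using osc by (auto simp: open_set_condition_def)
  obtain z b where zb: "0 < b" "ball z b \<subseteq> U" using U(1,2) open_contains_ball by blast
  obtain D where D: "\<And>k. k \<in> K \<Longrightarrow> dist z k \<le> D" "0 \<le> D"
    using compact_imp_bounded[OF K] unfolding bounded_any_center[of K z]
    by (metis (mono_tags, lifting) max.cobounded1 max.cobounded2 order_trans)
  have "real (card M) \<le> ((b + D + 1) / (rmin * b)) ^ DIM('a)"
    if "0 < \<rho>" "finite M" and MC: "M \<subseteq> stopping_words \<rho>" and meet: "\<forall>I\<in>M. foldr S I ` K \<inter> ball x \<rho> \<noteq> {}" for x \<rho> M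
  proof -
    have setI: "set I \<subseteq> {..<N}" "word_ratio I \<le> \<rho>" "rmin * \<rho> \<le> word_ratio I" if "I \<in> M" for I
      using MC that stopping_ratio_ge by (auto simp: stopping_words_def)
    have rho: "0 < rmin * \<rho>" using rmin \<open>0 < \<rho>\<close> by simp
    have sub: "ball (foldr S I z) (rmin * \<rho> * b) \<subseteq> foldr S I ` ball z b" if "I \<in> M" for I
    proof -
      have "foldr S I ` ball z b = ball (foldr S I z) (word_ratio I * b)"
        using dist_foldr[OF setI(1)[OF that]] word_ratio_pos[OF setI(1)[OF that]]
        by (intro similitude_image_ball) auto
      moreover have "rmin * \<rho> * b \<le> word_ratio I * b"
        using setI(3)[OF that] zb(1) by (intro mult_right_mono) auto
      ultimately show ?thesis by (simp add: subset_ball)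
    qed
    have "real (card M) \<le> ((\<rho> * (b + D + 1)) / (rmin * \<rho> * b)) ^ DIM('a)"
    proof (rule card_disjoint_balls_le[OF \<open>finite M\<close>])
      show "0 < rmin * \<rho> * b" using rho zb by simp
      show "0 \<le> \<rho> * (b + D + 1)" using \<open>0 < \<rho>\<close> zb D by simp
      show "disjoint_family_on (\<lambda>I. ball (foldr S I z) (rmin * \<rho> * b)) M"
        unfolding disjoint_family_on_def
      proof (intro ballI impI)
        fix I J assume IJ: "I \<in> M" "J \<in> M" "I \<noteq> J"
        have "foldr S I ` U \<inter> foldr S J ` U = {}"
          using IJ setI subsetD[OF MC]
          by (intro disjoint_incomparable_words[OF U(3,4)] stopping_incomparable[of _ \<rho>]) auto
        moreover have "ball (foldr S I z) (rmin * \<rho> * b) \<subseteq> foldr S I ` U"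
          using sub[OF IJ(1)] image_mono[OF zb(2)] by (rule order_trans)
        moreover have "ball (foldr S J z) (rmin * \<rho> * b) \<subseteq> foldr S J ` U"
          using sub[OF IJ(2)] image_mono[OF zb(2)] by (rule order_trans)
        ultimately show "ball (foldr S I z) (rmin * \<rho> * b) \<inter> ball (foldr S J z) (rmin * \<rho> * b) = {}"
          by (metis Int_mono subset_empty)
      qed
      show "ball (foldr S I z) (rmin * \<rho> * b) \<subseteq> ball x (\<rho> * (b + D + 1))" if IM: "I \<in> M" for I
      proof
        fix y assume "y \<in> ball (foldr S I z) (rmin * \<rho> * b)"
        then obtain y' where y': "y = foldr S I y'" "dist z y' < b" using sub[OF IM] by auto
        obtain k where k: "k \<in> K" "dist x (foldr S I k) < \<rho>" using meet IM by force
        have "dist x y \<le> dist x (foldr S I k) + dist (foldr S I k) y" by (rule dist_triangle)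
        also have "dist (foldr S I k) y = word_ratio I * dist k y'"
          using dist_foldr[OF setI(1)[OF IM]] y' by simp
        also have "\<dots> \<le> \<rho> * (b + D)"
        proof (intro mult_mono)
          show "dist k y' \<le> b + D"
            using dist_triangle[of k y' z] D(1)[OF k(1)] y'(2) by (simp add: dist_commute)
        qed (use setI[OF IM] \<open>0 < \<rho>\<close> in auto)
        finally show "y \<in> ball x (\<rho> * (b + D + 1))" using k(2) by (simp add: algebra_simps)
      qed
    qed
    also have "(\<rho> * (b + D + 1)) / (rmin * \<rho> * b) = (b + D + 1) / (rmin * b)"
      using \<open>0 < \<rho>\<close> by simp
    finally show ?thesis .
  qed
  then show ?thesis by blast
qed

text \<open>The weight of a word is \<open>word_ratio I powr s\<close>, and words of a given length have total weight \<open>1\<close>.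
  Group long words by their prefix in \<open>stopping_words \<rho>\<close>.  The extensions of a prefix have together
  the weight of the prefix, at most \<open>\<rho> powr s\<close>, and boundedly many prefixes belong to copies of \<open>K\<close>
  that meet a ball of radius \<open>\<rho>\<close>.\<close>
lemma weight_meeting_ball:
  assumes K: "compact K" "K = (\<Union>j<N. S j ` K)" and osc: "open_set_condition S N"
    and s: "0 < s" "(\<Sum>i<N. r i powr s) = 1"
  shows "\<exists>q\<ge>1. \<forall>x \<rho>. 0 < \<rho> \<longrightarrow> (\<forall>\<^sub>F n in sequentially.
    (\<Sum>I | I \<in> words n \<and> foldr S I ` K \<inter> ball x \<rho> \<noteq> {}. word_ratio I powr s) \<le> q * \<rho> powr s)"
proof -
  obtain q where q: "\<And>x \<rho> M. 0 < \<rho> \<Longrightarrow> finite M \<Longrightarrow> M \<subseteq> stopping_words \<rho> \<Longrightarrow>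
    (\<forall>I\<in>M. foldr S I ` K \<inter> ball x \<rho> \<noteq> {}) \<Longrightarrow> real (card M) \<le> q"
    using card_stopping_meeting_ball[OF K(1) osc] by blast
  have bound: "(\<Sum>I | I \<in> words n \<and> foldr S I ` K \<inter> ball x \<rho> \<noteq> {}. word_ratio I powr s) \<le> max 1 q * \<rho> powr s"
    if \<rho>: "0 < \<rho>" and n: "rmax ^ n < \<rho>" for x \<rho> n
  proof (cases "\<rho> < 1")
    case False
    have "(\<Sum>I | I \<in> words n \<and> foldr S I ` K \<inter> ball x \<rho> \<noteq> {}. word_ratio I powr s)
        \<le> (\<Sum>I\<in>words n. word_ratio I powr s)"
      by (intro sum_mono2) auto
    also have "\<dots> = 1 * 1" using sum_word_ratio_powr[OF s(2)] by simp
    also have "\<dots> \<le> max 1 q * \<rho> powr s"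
      using False s ge_one_powr_ge_zero[of \<rho> s] by (intro mult_mono) auto
    finally show ?thesis .
  next
    case True
    define W where "W = {I. I \<in> words n \<and> foldr S I ` K \<inter> ball x \<rho> \<noteq> {}}"
    define p where "p I = take (LEAST k. word_ratio (take k I) \<le> \<rho>) I" for I
    have finW: "finite W" by (simp add: W_def)
    have W: "set I \<subseteq> {..<N}" "length I = n" if "I \<in> W" for I
      using that by (auto simp: W_def words_def)
    have p_cut: "p I \<in> stopping_words \<rho>" if "I \<in> W" for I
    proof -
      define k where "k = (LEAST k. word_ratio (take k I) \<le> \<rho>)"
      have "word_ratio (take n I) \<le> \<rho>"
        using word_ratio_le[OF W(1)[OF that]] n W(2)[OF that] by simp
      then have k: "word_ratio (take k I) \<le> \<rho>" "k \<le> n"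
        unfolding k_def by (rule LeastI, rule Least_le)
      have "k \<noteq> 0"
      proof
        assume "k = 0"
        then show False using k(1) True by simp
      qed
      then have "\<not> word_ratio (take (k - 1) I) \<le> \<rho>"
        unfolding k_def by (intro not_less_Least) auto
      moreover have "take (k - 1) I = butlast (take k I)"
        using k(2) W(2)[OF that] by (simp add: butlast_take)
      moreover have "take k I \<noteq> []" using \<open>k \<noteq> 0\<close> k(2) W(2)[OF that] by auto
      moreover have "set (take k I) \<subseteq> {..<N}" using W(1)[OF that] set_take_subset[of k I] by blast
      ultimately show ?thesis
        using k(1) by (simp add: stopping_words_def p_def k_def[symmetric])
    qed
    have p_decomp: "I = p I @ drop (length (p I)) I" for I
      by (simp add: p_def min_def)
    have p_meet: "foldr S (p I) ` K \<inter> ball x \<rho> \<noteq> {}" if "I \<in> W" for I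
    proof -
      have "set (drop (length (p I)) I) \<subseteq> {..<N}" using W(1)[OF that] set_drop_subset by fastforce
      then have "foldr S (drop (length (p I)) I) ` K \<subseteq> K"
        using K(2) by (intro foldr_images_subset) auto
      then have "foldr S I ` K \<subseteq> foldr S (p I) ` K"
        by (subst p_decomp[of I], subst foldr_image_append) (rule image_mono)
      then show ?thesis using that by (auto simp: W_def)
    qed
    have card: "real (card (p ` W)) \<le> q"
      using p_cut p_meet \<rho> finW by (intro q[of \<rho> _ x]) auto
    have "(\<Sum>I\<in>W. word_ratio I powr s) = (\<Sum>J\<in>p ` W. \<Sum>I | I \<in> W \<and> p I = J. word_ratio I powr s)"
      by (rule sum.image_gen[OF finW])
    also have "\<dots> \<le> (\<Sum>J\<in>p ` W. \<rho> powr s)"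
    proof (rule sum_mono)
      fix J assume "J \<in> p ` W"
      then have J: "J \<in> stopping_words \<rho>" using p_cut by auto
      then have JN: "set J \<subseteq> {..<N}" "word_ratio J \<le> \<rho>" by (auto simp: stopping_words_def)
      have "(\<Sum>I | I \<in> W \<and> p I = J. word_ratio I powr s)
          \<le> (\<Sum>I\<in>(@) J ` words (n - length J). word_ratio I powr s)"
      proof (rule sum_mono2)
        show "{I \<in> W. p I = J} \<subseteq> (@) J ` words (n - length J)"
        proof
          fix I assume "I \<in> {I \<in> W. p I = J}"
          then have I: "I \<in> W" "I = J @ drop (length J) I" using p_decomp[of I] by auto
          moreover have "drop (length J) I \<in> words (n - length J)"
            using W[OF I(1)] set_drop_subset[of "length J" I] by (auto simp: words_def)
          ultimately show "I \<in> (@) J ` words (n - length J)" by blast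
        qed
      qed auto
      also have "\<dots> = (\<Sum>L\<in>words (n - length J). word_ratio J powr s * word_ratio L powr s)"
        using word_ratio_pos JN
        by (subst sum.reindex) (auto simp: inj_on_def words_def powr_mult less_imp_le intro!: sum.cong)
      also have "\<dots> = word_ratio J powr s"
        using sum_word_ratio_powr[OF s(2)] by (simp flip: sum_distrib_left)
      also have "\<dots> \<le> \<rho> powr s"
        using JN word_ratio_pos[OF JN(1)] s by (intro powr_mono2) auto
      finally show "(\<Sum>I | I \<in> W \<and> p I = J. word_ratio I powr s) \<le> \<rho> powr s" .
    qed
    also have "\<dots> = real (card (p ` W)) * \<rho> powr s" by simp
    also have "\<dots> \<le> max 1 q * \<rho> powr s" using card by (intro mult_right_mono) auto
    finally show ?thesis by (simp add: W_def)
  qed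
  have small: "\<forall>\<^sub>F n in sequentially. rmax ^ n < \<rho>" if "0 < \<rho>" for \<rho> :: real
    using rmax LIMSEQ_power_zero[of rmax] that by (intro order_tendstoD) auto
  have *: "\<forall>\<^sub>F n in sequentially.
    (\<Sum>I | I \<in> words n \<and> foldr S I ` K \<inter> ball x \<rho> \<noteq> {}. word_ratio I powr s) \<le> max 1 q * \<rho> powr s"
    if "0 < \<rho>" for x \<rho>
    using small[OF that]
  proof (rule eventually_mono)
    fix n assume "rmax ^ n < \<rho>"
    then show "(\<Sum>I | I \<in> words n \<and> foldr S I ` K \<inter> ball x \<rho> \<noteq> {}. word_ratio I powr s) \<le> max 1 q * \<rho> powr s"
      by (rule bound[OF that])
  qed
  show ?thesis
  proof (rule exI[of _ "max 1 q"], intro conjI allI impI)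
    fix x \<rho> assume "0 < (\<rho>::real)"
    then show "\<forall>\<^sub>F n in sequentially.
      (\<Sum>I | I \<in> words n \<and> foldr S I ` K \<inter> ball x \<rho> \<noteq> {}. word_ratio I powr s) \<le> max 1 q * \<rho> powr s"
      by (rule *)
  qed simp
qed

text \<open>The mass distribution principle, with the words of one large length in the place of a measure.
  Enlarge the sets of a cover slightly to open balls and pass to finitely many of them; words of some
  common length then all have copies that meet these balls, so the weights that the balls can account
  for must add up to \<open>1\<close>.\<close>
lemma hausdorff_measure_invariant_set_pos:
  assumes K: "compact K" "K \<noteq> {}" "K = (\<Union>j<N. S j ` K)" and osc: "open_set_condition S N"
    and s: "0 < s" "(\<Sum>i<N. r i powr s) = 1"
  shows "0 < hausdorff_measure s K"
proof -
  obtain q where "1 \<le> q \<and> (\<forall>x \<rho>. 0 < \<rho> \<longrightarrow> (\<forall>\<^sub>F n in sequentially.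
    (\<Sum>I | I \<in> words n \<and> foldr S I ` K \<inter> ball x \<rho> \<noteq> {}. word_ratio I powr s) \<le> q * \<rho> powr s))"
    using weight_meeting_ball[OF K(1,3) osc s] by (rule exE)
  then have q1: "1 \<le> q" and q: "\<And>x \<rho>. 0 < \<rho> \<Longrightarrow> (\<forall>\<^sub>F n in sequentially.
    (\<Sum>I | I \<in> words n \<and> foldr S I ` K \<inter> ball x \<rho> \<noteq> {}. word_ratio I powr s) \<le> q * \<rho> powr s)"
    by simp_all
  have "ennreal (1 / (2 * q)) \<le> hausdorff_content s 1 K"
  proof (rule hausdorff_content_greatest)
    fix U :: "nat \<Rightarrow> 'a set"
    assume U: "K \<subseteq> (\<Union>i. U i)" "\<And>i. bounded (U i)" "\<And>i. diameter (U i) \<le> 1"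
    \<comment> \<open>The enlargement of the \<open>i\<close>-th set costs \<open>e i\<close>; the total cost is half of the target \<open>1 / q\<close>.\<close>
    define e where "e i = 1 / (2 * q) * (1 / 2) ^ Suc i" for i :: nat
    have e0: "0 < e i" for i using q1 by (simp add: e_def)
    define \<rho> where "\<rho> i = (diameter (U i) powr s + e i) powr (1 / s)" for i
    have \<rho>: "0 < \<rho> i" "\<rho> i powr s = diameter (U i) powr s + e i" for i
    proof -
      have "0 < diameter (U i) powr s + e i" using e0[of i] by (intro add_nonneg_pos) auto
      then show "0 < \<rho> i" "\<rho> i powr s = diameter (U i) powr s + e i"
        using s by (auto simp: \<rho>_def powr_powr)
    qed
    have d\<rho>: "diameter (U i) < \<rho> i" for i
    proof -
      have "diameter (U i) = (diameter (U i) powr s) powr (1 / s)"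
        using s diameter_ge_0[OF U(2)] by (simp add: powr_powr)
      also have "\<dots> < \<rho> i" unfolding \<rho>_def using s e0[of i] by (intro powr_less_mono2) auto
      finally show ?thesis .
    qed
    define x where "x i = (SOME x. x \<in> U i)" for i
    have UB: "U i \<subseteq> ball (x i) (\<rho> i)" for i
    proof
      fix y assume y: "y \<in> U i"
      then have "x i \<in> U i" unfolding x_def by (rule someI)
      then show "y \<in> ball (x i) (\<rho> i)"
        using diameter_bounded_bound[OF U(2), of "x i" i y] y d\<rho>[of i] by auto
    qed
    have "K \<subseteq> (\<Union>i\<in>UNIV. ball (x i) (\<rho> i))"
      by (rule order_trans[OF U(1) UN_mono[OF subset_refl UB]])
    then obtain C where C: "finite C" "K \<subseteq> (\<Union>i\<in>C. ball (x i) (\<rho> i))"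
      using compactE_image[OF K(1), of UNIV "\<lambda>i. ball (x i) (\<rho> i)"] by auto
    define W where "W n i = {I. I \<in> words n \<and> foldr S I ` K \<inter> ball (x i) (\<rho> i) \<noteq> {}}" for n i
    have "\<forall>\<^sub>F n in sequentially. \<forall>i\<in>C. (\<Sum>I\<in>W n i. word_ratio I powr s) \<le> q * \<rho> i powr s"
      unfolding W_def by (intro eventually_ball_finite ballI q \<rho>(1) C(1))
    then have "\<exists>n. \<forall>i\<in>C. (\<Sum>I\<in>W n i. word_ratio I powr s) \<le> q * \<rho> i powr s"
      by (rule eventually_happens'[OF sequentially_bot])
    then obtain n where n: "\<forall>i\<in>C. (\<Sum>I\<in>W n i. word_ratio I powr s) \<le> q * \<rho> i powr s" ..
    have "words n \<subseteq> (\<Union>i\<in>C. W n i)"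
    proof
      fix I assume I: "I \<in> words n"
      obtain k where k: "k \<in> K" using K(2) by blast
      have "foldr S I ` K \<subseteq> K"
        using I by (intro foldr_images_subset[OF equalityD2[OF K(3)]]) (simp add: words_def)
      then have "foldr S I k \<in> K" using k by blast
      then obtain i where "i \<in> C" "foldr S I k \<in> ball (x i) (\<rho> i)" using C(2) by blast
      then have "I \<in> W n i" using I k unfolding W_def by blast
      then show "I \<in> (\<Union>i\<in>C. W n i)" using \<open>i \<in> C\<close> by blast
    qed
    moreover have "W n i \<subseteq> words n" for i unfolding W_def by blast
    ultimately have eq: "words n = (\<Union>i\<in>C. W n i)" by blast
    have "1 = (\<Sum>I\<in>words n. word_ratio I powr s)" using sum_word_ratio_powr[OF s(2)] by simp
    also have "\<dots> \<le> (\<Sum>i\<in>C. \<Sum>I\<in>W n i. word_ratio I powr s)"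
      unfolding eq
      using C(1) finite_subset[OF \<open>\<And>i. W n i \<subseteq> words n\<close> finite_words] by (intro sum_UN_le) auto
    also have "\<dots> \<le> (\<Sum>i\<in>C. q * \<rho> i powr s)" using n by (intro sum_mono) simp
    also have "\<dots> = q * (\<Sum>i\<in>C. diameter (U i) powr s + e i)" by (simp add: sum_distrib_left \<rho>(2))
    finally have one: "1 / q \<le> (\<Sum>i\<in>C. diameter (U i) powr s + e i)" using q1 by (simp add: field_simps)
    have sume: "(\<Sum>i. ennreal (e i)) = ennreal (1 / (2 * q))"
    proof -
      have "(\<lambda>i. e i) sums (1 / (2 * q) * 1)" unfolding e_def by (intro sums_mult power_half_series)
      then show ?thesis using e0 by (intro suminf_ennreal_eq) (auto simp: less_imp_le)
    qed
    have "ennreal (1 / (2 * q)) + ennreal (1 / (2 * q)) = ennreal (1 / q)"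
      using q1 by (simp flip: ennreal_plus)
    also have "\<dots> \<le> ennreal (\<Sum>i\<in>C. diameter (U i) powr s + e i)" using one by (rule ennreal_leI)
    also have "\<dots> = (\<Sum>i\<in>C. diam_pow s (U i) + ennreal (e i))"
    proof -
      have "diam_pow s (U i) + ennreal (e i) = ennreal (diameter (U i) powr s + e i)" for i
        using e0[of i] s by (simp add: diam_pow_pos ennreal_plus)
      then show ?thesis using e0 by (simp only: sum_ennreal add_nonneg_nonneg powr_ge_zero less_imp_le)
    qed
    also have "\<dots> \<le> (\<Sum>i. diam_pow s (U i) + ennreal (e i))"
      by (rule sum_le_suminf[OF summableI C(1)]) auto
    also have "\<dots> = (\<Sum>i. diam_pow s (U i)) + ennreal (1 / (2 * q))"
      unfolding sume[symmetric] by (rule suminf_add[symmetric]) auto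
    finally have "ennreal (1 / (2 * q)) + ennreal (1 / (2 * q)) \<le> ennreal (1 / (2 * q)) + (\<Sum>i. diam_pow s (U i))"
      by (simp only: add.commute)
    then show "ennreal (1 / (2 * q)) \<le> (\<Sum>i. diam_pow s (U i))"
      unfolding ennreal_add_left_cancel_le by simp
  qed
  also have "\<dots> \<le> hausdorff_measure s K" by (rule hausdorff_content_le_measure) simp
  finally have "ennreal (1 / (2 * q)) \<le> hausdorff_measure s K" .
  moreover have "0 < ennreal (1 / (2 * q))" using q1 by simp
  ultimately show ?thesis by (rule order_less_le_trans[rotated])
qed

end

section \<open>Contraction arguments\<close>

text \<open>The common core of all uniqueness arguments below: if the value at every point is at most
  \<open>R\<close> times the value at some other point, then it is at most \<open>R ^ n\<close> times the bound.\<close>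
lemma contraction_vanish:
  fixes f :: "'x \<Rightarrow> real"
  assumes R: "0 \<le> R" "R < 1" and bound: "\<And>x. x \<in> X \<Longrightarrow> f x \<le> B"
    and step: "\<And>x. x \<in> X \<Longrightarrow> \<exists>y\<in>X. f x \<le> R * f y" and "x \<in> X"
  shows "f x \<le> 0"
proof -
  have *: "f x \<le> R ^ n * max B 0" if "x \<in> X" for n x
    using that
  proof (induction n arbitrary: x)
    case 0
    then show ?case using bound[of x] by simp
  next
    case (Suc n)
    then obtain y where y: "y \<in> X" "f x \<le> R * f y" using step by blast
    have "R * f y \<le> R * (R ^ n * max B 0)" using Suc.IH[OF y(1)] R by (intro mult_left_mono)
    then show ?case using y by simp
  qed
  have "(\<lambda>n. R ^ n * max B 0) \<longlonglongrightarrow> 0 * max B 0"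
    using R by (intro tendsto_intros LIMSEQ_power_zero) auto
  then show ?thesis using *[OF \<open>x \<in> X\<close>] by (intro LIMSEQ_le_const[of _ 0]) auto
qed

text \<open>A dynamical system \<open>T\<close> whose points carry contractions \<open>F x\<close> has a coding map: the point
  coded by \<open>x\<close> is the limit of \<open>F x \<circ> F (T x) \<circ> F (T (T x)) \<circ> \<dots>\<close>.\<close>
lemma coding_map_exists:
  fixes F :: "'x \<Rightarrow> 'a::banach \<Rightarrow> 'a"
  assumes R: "0 \<le> R" "R < 1" and T: "\<And>x. x \<in> X \<Longrightarrow> T x \<in> X"
    and contr: "\<And>x y z. x \<in> X \<Longrightarrow> dist (F x y) (F x z) \<le> R * dist y z"
    and D: "\<And>x. x \<in> X \<Longrightarrow> dist (F x p) p \<le> D"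
  shows "\<exists>G. \<forall>x\<in>X. G x = F x (G (T x)) \<and> dist (G x) p \<le> D / (1 - R)"
proof -
  define A where "A n = ((\<lambda>G x. F x (G (T x))) ^^ n) (\<lambda>_. p)" for n
  have A0: "A 0 x = p" and ASuc: "A (Suc n) x = F x (A n (T x))" for n x
    by (simp_all add: A_def)
  have step: "dist (A (Suc n) x) (A n x) \<le> R ^ n * D" if "x \<in> X" for n x
    using that
  proof (induction n arbitrary: x)
    case 0
    then show ?case using D by (simp add: A0 ASuc)
  next
    case (Suc n)
    have "dist (A (Suc (Suc n)) x) (A (Suc n) x) \<le> R * dist (A (Suc n) (T x)) (A n (T x))"
      unfolding ASuc[of "Suc n"] ASuc[of n x] by (rule contr[OF Suc.prems])
    also have "\<dots> \<le> R * (R ^ n * D)" using R Suc T by (intro mult_left_mono) auto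
    finally show ?case by simp
  qed
  have geo: "summable (\<lambda>n. R ^ n * D)" "(\<Sum>n. R ^ n * D) = D / (1 - R)"
    using R sums_mult2[OF geometric_sums[of R], of D] by (auto simp: sums_iff)
  define G where "G x = p + (\<Sum>n. A (Suc n) x - A n x)" for x
  have lim: "(\<lambda>n. A n x) \<longlonglongrightarrow> G x" and bnd: "dist (G x) p \<le> D / (1 - R)" if "x \<in> X" for x
  proof -
    have norm: "norm (A (Suc n) x - A n x) \<le> R ^ n * D" for n
      using step[OF that] by (simp add: dist_norm)
    have summ: "summable (\<lambda>n. A (Suc n) x - A n x)"
      using norm by (intro summable_comparison_test'[OF geo(1)])
    have "(\<lambda>n. p + (\<Sum>i<n. A (Suc i) x - A i x)) \<longlonglongrightarrow> G x"
      unfolding G_def by (intro tendsto_intros summable_LIMSEQ summ)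
    then show "(\<lambda>n. A n x) \<longlonglongrightarrow> G x"
      by (simp only: sum_lessThan_telescope[where f="\<lambda>n. A n x"] A0) simp
    have "norm (\<Sum>n. A (Suc n) x - A n x) \<le> (\<Sum>n. R ^ n * D)"
      using norm geo(1) by (rule norm_suminf_le)
    then show "dist (G x) p \<le> D / (1 - R)" by (simp add: G_def dist_norm geo(2))
  qed
  have "G x = F x (G (T x))" if "x \<in> X" for x
  proof (rule LIMSEQ_unique)
    show "(\<lambda>n. A (Suc n) x) \<longlonglongrightarrow> G x" using lim[OF that] by (rule LIMSEQ_Suc)
    show "(\<lambda>n. A (Suc n) x) \<longlonglongrightarrow> F x (G (T x))"
    proof (rule LIM_zero_cancel, rule Lim_null_comparison)
      show "(\<lambda>n. R * dist (A n (T x)) (G (T x))) \<longlonglongrightarrow> 0"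
        using lim[OF T[OF that]] by (intro tendsto_mult_right_zero) (rule tendsto_dist_iff[THEN iffD1])
      show "\<forall>\<^sub>F n in sequentially. norm (A (Suc n) x - F x (G (T x))) \<le> R * dist (A n (T x)) (G (T x))"
        unfolding ASuc dist_norm[symmetric] using contr[OF that] by (intro always_eventually allI)
    qed
  qed
  then show ?thesis using bnd by blast
qed

context similitudes
begin

text \<open>The distance of a point of \<open>E v\<close> from \<open>F v\<close> is at most \<open>rmax\<close> times such a distance for
  some successor of \<open>v\<close>.\<close>
lemma gifs_subset:
  fixes \<tau> :: "'v \<Rightarrow> (nat \<times> 'v) list"
  assumes V: "finite V" and \<tau>: "\<And>v j u. v \<in> V \<Longrightarrow> (j, u) \<in> set (\<tau> v) \<Longrightarrow> j < N \<and> u \<in> V"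
    and E: "\<And>v. v \<in> V \<Longrightarrow> E v \<subseteq> (\<Union>(j, u)\<in>set (\<tau> v). S j ` E u)" "\<And>v. v \<in> V \<Longrightarrow> bounded (E v)"
    and F: "\<And>v. v \<in> V \<Longrightarrow> (\<Union>(j, u)\<in>set (\<tau> v). S j ` F u) \<subseteq> F v"
      "\<And>v. v \<in> V \<Longrightarrow> closed (F v)" "\<And>v. v \<in> V \<Longrightarrow> F v \<noteq> {}"
    and v: "v \<in> V"
  shows "E v \<subseteq> F v"
proof
  fix x assume x: "x \<in> E v"
  define q where "q v = (SOME y. y \<in> F v)" for v
  have q: "q v \<in> F v" if "v \<in> V" for v
    using F(3)[OF that] unfolding q_def by (simp add: some_in_eq)
  define Q where "Q = (\<Union>v\<in>V. E v) \<union> q ` V"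
  have "bounded Q"
    using V E(2) by (auto simp: Q_def intro: finite_imp_bounded)
  then obtain B where B: "\<forall>x\<in>Q. \<forall>y\<in>Q. dist x y \<le> B"
    unfolding bounded_two_points by (rule exE)
  have "(\<lambda>(v, x). infdist x (F v)) (v, x) \<le> 0"
  proof (rule contraction_vanish[where X = "{(v, x). v \<in> V \<and> x \<in> E v}" and R = rmax and B = B])
    fix z assume "z \<in> {(v, x). v \<in> V \<and> x \<in> E v}"
    then obtain v x where z: "z = (v, x)" "v \<in> V" "x \<in> E v" by blast
    have "infdist x (F v) \<le> dist x (q v)" using q[OF z(2)] by (rule infdist_le)
    also have "\<dots> \<le> B" using z B by (auto simp: Q_def)
    finally show "(case z of (v, x) \<Rightarrow> infdist x (F v)) \<le> B" using z by simp
    from E(1)[OF z(2)] z(3) obtain j u y where y: "(j, u) \<in> set (\<tau> v)" "y \<in> E u" "x = S j y" by blast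
    have ju: "j < N" "u \<in> V" using \<tau>[OF z(2) y(1)] by auto
    have "infdist (S j y) (F v) \<le> r j * infdist y (F u)"
    proof -
      obtain w where w: "w \<in> F u" "infdist y (F u) = dist y w"
        using infdist_attains_inf[OF F(2)[OF ju(2)] F(3)[OF ju(2)]] by metis
      have "S j w \<in> F v" using F(1)[OF z(2)] y(1) w(1) by blast
      then have "infdist (S j y) (F v) \<le> dist (S j y) (S j w)" by (rule infdist_le)
      then show ?thesis using w(2) similitude[OF ju(1)] by simp
    qed
    also have "\<dots> \<le> rmax * infdist y (F u)"
      using rmax(3)[OF ju(1)] infdist_nonneg by (intro mult_right_mono)
    finally show "\<exists>y\<in>{(v, x). v \<in> V \<and> x \<in> E v}.
        (case z of (v, x) \<Rightarrow> infdist x (F v)) \<le> rmax * (case y of (v, x) \<Rightarrow> infdist x (F v))"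
      using z y ju by (intro bexI[of _ "(u, y)"]) auto
  qed (use rmax v x in auto)
  then have "infdist x (F v) = 0" using infdist_nonneg[of x "F v"] by simp
  then show "x \<in> F v" using F(2,3)[OF v] in_closed_iff_infdist_zero by blast
qed

end

section \<open>Unions without overlap\<close>

lemma sum_list_ennreal:
  "(\<And>x. x \<in> set xs \<Longrightarrow> 0 \<le> f x) \<Longrightarrow> (\<Sum>x\<leftarrow>xs. ennreal (f x)) = ennreal (\<Sum>x\<leftarrow>xs. f x)"
proof (induction xs)
  case (Cons x xs)
  have "0 \<le> (\<Sum>x\<leftarrow>xs. f x)" using Cons.prems by (intro sum_list_nonneg) auto
  then show ?case using Cons by (simp add: ennreal_plus)
qed simp

lemma hausdorff_measure_Union_list_le:
  "hausdorff_measure s (\<Union>(set Ys)) \<le> (\<Sum>Y\<leftarrow>Ys. hausdorff_measure s Y)"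
proof (induction Ys)
  case (Cons Y Ys)
  have "hausdorff_measure s (\<Union>(set (Y # Ys))) \<le> hausdorff_measure s Y + hausdorff_measure s (\<Union>(set Ys))"
    using hausdorff_measure_Un_le[of s Y "\<Union>(set Ys)"] by simp
  also have "\<dots> \<le> hausdorff_measure s Y + (\<Sum>Y\<leftarrow>Ys. hausdorff_measure s Y)"
    using Cons by (rule add_left_mono)
  finally show ?case by simp
qed simp

text \<open>Once the pieces add up to the measure of the union, no Borel set can see an overlap: it and
  its complement would both have to gain from subadditivity.\<close>
lemma hausdorff_measure_additive_pieces:
  fixes Ys :: "'a::metric_space set list"
  assumes s: "0 \<le> s" and eq: "hausdorff_measure s (\<Union>(set Ys)) = (\<Sum>Y\<leftarrow>Ys. hausdorff_measure s Y)"
    and fin: "hausdorff_measure s (\<Union>(set Ys)) < \<infinity>" and B: "B \<in> sets borel"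
  shows "(\<Sum>Y\<leftarrow>Ys. hausdorff_measure s (Y \<inter> B)) = hausdorff_measure s (\<Union>(set Ys) \<inter> B)"
proof (rule antisym)
  let ?H = "hausdorff_measure s :: 'a set \<Rightarrow> ennreal"
  have le: "?H (\<Union>(set Ys) \<inter> C) \<le> (\<Sum>Y\<leftarrow>Ys. ?H (Y \<inter> C))" for C
  proof -
    have "\<Union>(set Ys) \<inter> C = \<Union>(set (map (\<lambda>Y. Y \<inter> C) Ys))" by auto
    then show ?thesis using hausdorff_measure_Union_list_le[of s "map (\<lambda>Y. Y \<inter> C) Ys"]
      by (simp add: comp_def)
  qed
  show "?H (\<Union>(set Ys) \<inter> B) \<le> (\<Sum>Y\<leftarrow>Ys. ?H (Y \<inter> B))" by (rule le)
  have "(\<Sum>Y\<leftarrow>Ys. ?H Y) = (\<Sum>Y\<leftarrow>Ys. ?H (Y \<inter> B) + ?H (Y \<inter> - B))"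
    by (simp only: Diff_eq[symmetric] hausdorff_measure_split[OF s B, symmetric])
  also have "\<dots> = (\<Sum>Y\<leftarrow>Ys. ?H (Y \<inter> B)) + (\<Sum>Y\<leftarrow>Ys. ?H (Y \<inter> - B))"
    by (simp add: sum_list_addf)
  finally have sum: "(\<Sum>Y\<leftarrow>Ys. ?H Y) = (\<Sum>Y\<leftarrow>Ys. ?H (Y \<inter> B)) + (\<Sum>Y\<leftarrow>Ys. ?H (Y \<inter> - B))" .
  have "?H (\<Union>(set Ys)) = ?H (\<Union>(set Ys) \<inter> B) + ?H (\<Union>(set Ys) \<inter> - B)"
    by (simp only: Diff_eq[symmetric] hausdorff_measure_split[OF s B, symmetric])
  also have "\<dots> \<le> ?H (\<Union>(set Ys) \<inter> B) + (\<Sum>Y\<leftarrow>Ys. ?H (Y \<inter> - B))"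
    using le by (rule add_left_mono)
  finally have "(\<Sum>Y\<leftarrow>Ys. ?H (Y \<inter> - B)) + (\<Sum>Y\<leftarrow>Ys. ?H (Y \<inter> B))
      \<le> (\<Sum>Y\<leftarrow>Ys. ?H (Y \<inter> - B)) + ?H (\<Union>(set Ys) \<inter> B)"
    unfolding eq sum by (simp only: add.commute)
  moreover have "(\<Sum>Y\<leftarrow>Ys. ?H (Y \<inter> - B)) \<noteq> top"
    using fin unfolding eq sum by auto
  ultimately show "(\<Sum>Y\<leftarrow>Ys. ?H (Y \<inter> B)) \<le> ?H (\<Union>(set Ys) \<inter> B)"
    unfolding ennreal_add_left_cancel_le by auto
qed

text \<open>The common part of two pieces would be counted twice in the sum.\<close>
lemma hausdorff_measure_pieces_null:
  fixes Ys :: "'a::metric_space set list"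
  assumes s: "0 \<le> s" and eq: "hausdorff_measure s (\<Union>(set Ys)) = (\<Sum>Y\<leftarrow>Ys. hausdorff_measure s Y)"
    and fin: "hausdorff_measure s (\<Union>(set Ys)) < \<infinity>"
    and borel: "\<And>Y. Y \<in> set Ys \<Longrightarrow> Y \<in> sets borel"
    and ij: "i < length Ys" "j < length Ys" "i \<noteq> j"
  shows "hausdorff_measure s (Ys ! i \<inter> Ys ! j) = 0"
proof -
  define B where "B = Ys ! i \<inter> Ys ! j"
  let ?H = "hausdorff_measure s :: 'a set \<Rightarrow> ennreal"
  have B: "B \<in> sets borel" using borel ij by (auto simp: B_def)
  have "?H B + ?H B = (\<Sum>k\<in>{i, j}. ?H (Ys ! k \<inter> B))"
    using ij by (simp add: B_def Int_ac)
  also have "\<dots> \<le> (\<Sum>k<length Ys. ?H (Ys ! k \<inter> B))"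
    using ij by (intro sum_mono2) auto
  also have "\<dots> = (\<Sum>Y\<leftarrow>Ys. ?H (Y \<inter> B))"
    by (simp add: sum_list_sum_nth atLeast0LessThan)
  also have "\<dots> = ?H (\<Union>(set Ys) \<inter> B)"
    by (rule hausdorff_measure_additive_pieces[OF s eq fin B])
  also have "\<Union>(set Ys) \<inter> B = B" using nth_mem[OF ij(1)] by (auto simp: B_def)
  finally have "?H B + ?H B \<le> ?H B + 0" by simp
  moreover have "?H B \<noteq> top"
  proof -
    have "B \<subseteq> \<Union>(set Ys)" using nth_mem[OF ij(1)] by (auto simp: B_def)
    then have "?H B \<le> ?H (\<Union>(set Ys))" by (rule hausdorff_measure_mono)
    then show ?thesis using fin by auto
  qed
  ultimately have "?H B \<le> 0" unfolding ennreal_add_left_cancel_le by auto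
  then show ?thesis by (simp add: B_def)
qed

lemma hausdorff_measure_finite_UN_null:
  assumes "finite I" "\<And>i. i \<in> I \<Longrightarrow> hausdorff_measure t (A i) = 0"
  shows "hausdorff_measure t (\<Union>i\<in>I. A i) = 0"
  using assms
proof (induction I)
  case (insert i I)
  then show ?case using hausdorff_measure_Un_le[of t "A i" "\<Union>i\<in>I. A i"] by simp
qed simp

lemma hausdorff_measure_UN_eq_sum:
  fixes A :: "'i \<Rightarrow> 'a::metric_space set"
  assumes "0 \<le> s" "finite I" "\<And>i. i \<in> I \<Longrightarrow> A i \<in> sets borel"
    "\<And>i j. i \<in> I \<Longrightarrow> j \<in> I \<Longrightarrow> i \<noteq> j \<Longrightarrow> hausdorff_measure s (A i \<inter> A j) = 0"
  shows "hausdorff_measure s (\<Union>i\<in>I. A i) = (\<Sum>i\<in>I. hausdorff_measure s (A i))"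
  using assms(2-)
proof (induction I)
  case (insert i I)
  let ?U = "\<Union>i\<in>I. A i"
  have "hausdorff_measure s (\<Union>j\<in>I. A j \<inter> A i) = 0"
    using insert.prems(2) insert.hyps by (intro hausdorff_measure_finite_UN_null) auto
  moreover have "?U \<inter> A i = (\<Union>j\<in>I. A j \<inter> A i)" by blast
  ultimately have null: "hausdorff_measure s (?U \<inter> A i) = 0" by (simp only:)
  have bor: "A i \<in> sets borel" using insert.prems(1) by simp
  have "hausdorff_measure s (A i \<union> ?U) = hausdorff_measure s (A i) + hausdorff_measure s (?U - A i)"
  proof -
    have "(A i \<union> ?U) \<inter> A i = A i" "(A i \<union> ?U) - A i = ?U - A i" by blast+
    then show ?thesis using hausdorff_measure_split[OF assms(1) bor, of "A i \<union> ?U"] by simp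
  qed
  also have "hausdorff_measure s (?U - A i) = hausdorff_measure s ?U"
    using hausdorff_measure_split[OF assms(1) bor, of ?U] null by simp
  also have "\<dots> = (\<Sum>i\<in>I. hausdorff_measure s (A i))"
    using insert.prems by (intro insert.IH) auto
  finally show ?case using insert.hyps by simp
qed simp

section \<open>Recognizing optimal parametrizations\<close>

lemma continuous_on_holder:
  fixes g :: "real \<Rightarrow> 'a::real_normed_vector"
  assumes "0 < \<alpha>" and holder: "\<And>x y. x \<in> X \<Longrightarrow> y \<in> X \<Longrightarrow> dist (g x) (g y) \<le> C * \<bar>x - y\<bar> powr \<alpha>"
  shows "continuous_on X g"
  unfolding continuous_on_def
proof
  fix x assume x: "x \<in> X"
  show "(g \<longlongrightarrow> g x) (at x within X)"
  proof (rule LIM_zero_cancel, rule Lim_null_comparison)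
    show "\<forall>\<^sub>F y in at x within X. norm (g y - g x) \<le> C * \<bar>y - x\<bar> powr \<alpha>"
      unfolding eventually_at_filter using holder[OF _ x] by (auto simp: dist_norm)
    have "((\<lambda>y. \<bar>y - x\<bar>) \<longlongrightarrow> 0) (at x within X)"
      by (auto intro!: tendsto_eq_intros)
    then have "((\<lambda>y. \<bar>y - x\<bar> powr \<alpha>) \<longlongrightarrow> 0) (at x within X)"
      using \<open>0 < \<alpha>\<close> by (intro tendsto_zero_powrI[where b = \<alpha>]) auto
    then show "((\<lambda>y. C * \<bar>y - x\<bar> powr \<alpha>) \<longlongrightarrow> 0) (at x within X)"
      by (rule tendsto_mult_right_zero)
  qed
qed

lemma borel_vimage_continuous_on:
  fixes g :: "real \<Rightarrow> 'a::topological_space"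
  assumes "continuous_on X g" "X \<in> sets borel" "B \<in> sets borel"
  shows "g -` B \<inter> X \<in> sets borel"
proof -
  have "g -` B \<inter> space (restrict_space borel X) \<in> sets (restrict_space borel X)"
    using borel_measurable_continuous_on_restrict[OF assms(1)] assms(3) by (rule measurable_sets)
  then show ?thesis using assms(2) by (simp add: sets_restrict_space_iff space_restrict_space)
qed

text \<open>For Hausdorff measure of images of Borel sets of parameters (which need not be Borel), approximate
  the set of parameters from inside by compact sets.  This gives the lower bound directly and the
  upper bound by passing to the complement, in both cases because double points are negligible.\<close>
lemma optimal_parametrizationI:
  fixes g :: "real \<Rightarrow> 'a::euclidean_space"
  assumes s: "0 < s" and c: "0 < c" and F: "compact F" "hausdorff_measure s F = ennreal c"
    and onto: "g ` {0..c} = F"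
    and holder: "0 < C" "\<And>x y. x \<in> {0..c} \<Longrightarrow> y \<in> {0..c} \<Longrightarrow> dist (g x) (g y) \<le> C * \<bar>x - y\<bar> powr (1 / s)"
    and meas: "\<And>B. B \<in> sets borel \<Longrightarrow> B \<subseteq> F \<Longrightarrow> emeasure lborel (g -` B \<inter> {0..c}) = hausdorff_measure s B"
    and Z: "Z \<in> sets borel" "Z \<subseteq> F" "hausdorff_measure s Z = 0"
    and inj: "\<And>x y. x \<in> {0..c} \<Longrightarrow> y \<in> {0..c} \<Longrightarrow> g x = g y \<Longrightarrow> x \<noteq> y \<Longrightarrow> g x \<in> Z"
  shows "optimal_parametrization s F (\<lambda>t. g (c * t))"
proof -
  define \<psi> where "\<psi> t = g (c * t)" for t
  let ?H = "hausdorff_measure s :: 'a set \<Rightarrow> ennreal"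
  have img: "(*) c ` {0..1} = {0..c}"
    using c image_mult_atLeastAtMost[of c 0 1] by simp
  have \<psi>_onto: "\<psi> ` {0..1} = F"
    unfolding onto[symmetric] img[symmetric] by (auto simp: \<psi>_def image_image)
  have \<psi>_holder: "dist (\<psi> x) (\<psi> y) \<le> (C * c powr (1 / s)) * \<bar>x - y\<bar> powr (1 / s)"
    if "x \<in> {0..1}" "y \<in> {0..1}" for x y
  proof -
    have "c * x \<in> {0..c}" "c * y \<in> {0..c}" using that c by auto
    then have "dist (\<psi> x) (\<psi> y) \<le> C * \<bar>c * x - c * y\<bar> powr (1 / s)"
      unfolding \<psi>_def by (rule holder(2))
    also have "\<bar>c * x - c * y\<bar> = c * \<bar>x - y\<bar>" using c by (simp add: abs_mult flip: right_diff_distrib)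
    finally show ?thesis using c by (simp add: powr_mult)
  qed
  have cont: "continuous_on {0..1} \<psi>"
    using s \<psi>_holder by (intro continuous_on_holder[where \<alpha> = "1 / s"]) auto
  have contg: "continuous_on {0..c} g"
    using s holder(2) by (intro continuous_on_holder[where \<alpha> = "1 / s"]) auto
  have pre: "\<psi> -` B \<inter> {0..1} \<in> sets borel" if "B \<in> sets borel" for B
    by (rule borel_vimage_continuous_on[OF cont _ that]) simp
  have \<psi>_meas: "ennreal c * emeasure lborel (\<psi> -` B \<inter> {0..1}) = ?H B" if B: "B \<in> sets borel" "B \<subseteq> F" for B
  proof -
    have "g -` B \<inter> {0..c} = (\<lambda>x. c *\<^sub>R x + 0) ` (\<psi> -` B \<inter> {0..1})"
      unfolding img[symmetric] by (auto simp: \<psi>_def)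
    then have "emeasure lebesgue (g -` B \<inter> {0..c}) = ennreal c * emeasure lebesgue (\<psi> -` B \<inter> {0..1})"
      using c by (simp only: emeasure_lebesgue_affine) simp
    moreover have "g -` B \<inter> {0..c} \<in> sets borel"
      by (rule borel_vimage_continuous_on[OF contg _ B(1)]) simp
    ultimately show ?thesis using meas[OF B] pre[OF B(1)] by simp
  qed
  have \<psi>_inj: "\<psi> x \<in> Z" if "x \<in> {0..1}" "y \<in> {0..1}" "\<psi> x = \<psi> y" "x \<noteq> y" for x y
    using inj[of "c * x" "c * y"] that c by (auto simp: \<psi>_def)
  have null: "emeasure lborel (\<psi> -` Z \<inter> {0..1}) = 0"
    using \<psi>_meas[OF Z(1,2)] Z(3) c by simp
  \<comment> \<open>Compact sets of parameters are carried to sets of the right measure, because only double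
    points can enlarge the preimage of the image.\<close>
  have compact_image: "?H (\<psi> ` X) = ennreal c * emeasure lborel X" if X: "compact X" "X \<subseteq> {0..1}" for X
  proof -
    have co: "compact (\<psi> ` X)"
      using cont X continuous_on_subset compact_continuous_image by blast
    have sub: "\<psi> ` X \<subseteq> F" using X \<psi>_onto by blast
    have bor: "\<psi> ` X \<in> sets borel" using co by (simp add: compact_imp_closed borel_closed)
    have "?H (\<psi> ` X) = ennreal c * emeasure lborel (\<psi> -` (\<psi> ` X) \<inter> {0..1})"
      using \<psi>_meas[OF bor sub] ..
    also have "emeasure lborel (\<psi> -` (\<psi> ` X) \<inter> {0..1}) = emeasure lborel X"
    proof (rule antisym)
      have "\<psi> -` (\<psi> ` X) \<inter> {0..1} \<subseteq> X \<union> (\<psi> -` Z \<inter> {0..1})"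
        using \<psi>_inj X(2) by (auto simp: subset_eq) metis
      then have "emeasure lborel (\<psi> -` (\<psi> ` X) \<inter> {0..1}) \<le> emeasure lborel (X \<union> (\<psi> -` Z \<inter> {0..1}))"
        using pre[OF Z(1)] X(1) by (intro emeasure_mono) (auto simp: compact_imp_closed borel_closed)
      also have "\<dots> \<le> emeasure lborel X + emeasure lborel (\<psi> -` Z \<inter> {0..1})"
        using pre[OF Z(1)] X(1) by (intro emeasure_subadditive) (auto simp: compact_imp_closed borel_closed)
      finally show "emeasure lborel (\<psi> -` (\<psi> ` X) \<inter> {0..1}) \<le> emeasure lborel X" using null by simp
      show "emeasure lborel X \<le> emeasure lborel (\<psi> -` (\<psi> ` X) \<inter> {0..1})"
        using pre[OF bor] X(2) by (intro emeasure_mono) auto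
    qed
    finally show ?thesis .
  qed
  have image_meas: "?H (\<psi> ` X) = ennreal c * emeasure lborel X" if X: "X \<in> sets borel" "X \<subseteq> {0..1}" for X
  proof (rule antisym)
    have approx: "\<exists>C. compact C \<and> C \<subseteq> Y \<and> emeasure lborel (Y - C) < ennreal e"
      if Y: "Y \<in> sets borel" "Y \<subseteq> {0..1}" and e: "0 < e" for Y :: "real set" and e
    proof -
      have "Y \<in> sets lebesgue" using Y by simp
      then obtain C where C: "closed C" "C \<subseteq> Y" "emeasure lebesgue (Y - C) < ennreal e"
        using sets_lebesgue_inner_closed[OF _ e] by metis
      then have "compact C" using Y(2) bounded_subset[of "{0..1::real}" C] by (auto simp: compact_eq_bounded_closed)
      then show ?thesis using C Y by (intro exI[of _ C]) (auto simp: borel_closed)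
    qed
    show "ennreal c * emeasure lborel X \<le> ?H (\<psi> ` X)"
    proof (rule ennreal_le_epsilon)
      fix e :: real assume "0 < e"
      then obtain C where C: "compact C" "C \<subseteq> X" "emeasure lborel (X - C) < ennreal (e / c)"
        using approx[OF X, of "e / c"] c by auto
      have "emeasure lborel X \<le> emeasure lborel C + emeasure lborel (X - C)"
        using emeasure_subadditive[of C lborel "X - C"] C(1,2) X(1)
        by (simp add: compact_imp_closed borel_closed Un_absorb1)
      also have "\<dots> \<le> emeasure lborel C + ennreal (e / c)" using C(3) by (intro add_left_mono) simp
      finally have "ennreal c * emeasure lborel X \<le> ennreal c * (emeasure lborel C + ennreal (e / c))"
        by (rule mult_left_mono) simp
      also have "\<dots> = ?H (\<psi> ` C) + ennreal e"
        using compact_image[OF C(1)] C(2) X(2) c \<open>0 < e\<close>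
        by (simp add: distrib_left flip: ennreal_mult)
      also have "\<dots> \<le> ?H (\<psi> ` X) + ennreal e"
        using C(2) by (intro add_right_mono hausdorff_measure_mono) auto
      finally show "ennreal c * emeasure lborel X \<le> ?H (\<psi> ` X) + ennreal e" .
    qed
    show "?H (\<psi> ` X) \<le> ennreal c * emeasure lborel X"
    proof (rule ennreal_le_epsilon)
      fix e :: real assume "0 < e"
      define X' where "X' = {0..1} - X"
      have X': "X' \<in> sets borel" "X' \<subseteq> {0..1}" using X by (auto simp: X'_def)
      obtain C where C: "compact C" "C \<subseteq> X'" "emeasure lborel (X' - C) < ennreal (e / c)"
        using approx[OF X', of "e / c"] c \<open>0 < e\<close> by auto
      have C01: "C \<subseteq> {0..1}" using C X' by auto
      have bC: "C \<in> sets borel" using C by (simp add: compact_imp_closed borel_closed)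
      have bor: "\<psi> ` C \<in> sets borel"
        using compact_continuous_image[OF continuous_on_subset[OF cont C01] C(1)]
        by (simp add: compact_imp_closed borel_closed)
      have "\<psi> ` X \<subseteq> (F - \<psi> ` C) \<union> Z"
        using \<psi>_inj X(2) C01 C(2) \<psi>_onto unfolding X'_def by (auto simp: subset_eq) metis
      then have "?H (\<psi> ` X) \<le> ?H ((F - \<psi> ` C) \<union> Z)" by (rule hausdorff_measure_mono)
      also have "\<dots> \<le> ?H (F - \<psi> ` C)" using hausdorff_measure_Un_le[of s "F - \<psi> ` C" Z] Z(3) by simp
      finally have 1: "?H (\<psi> ` X) \<le> ?H (F - \<psi> ` C)" .
      have "F \<inter> \<psi> ` C = \<psi> ` C" using C01 \<psi>_onto by blast
      then have "ennreal c = ?H (\<psi> ` C) + ?H (F - \<psi> ` C)"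
        using hausdorff_measure_split[of s "\<psi> ` C" F] s bor F(2) by simp
      also have "?H (\<psi> ` C) = ennreal c * emeasure lborel C" by (rule compact_image[OF C(1) C01])
      finally have 2: "ennreal c = ennreal c * emeasure lborel C + ?H (F - \<psi> ` C)" .
      have finC: "ennreal c * emeasure lborel C \<noteq> top" using 2 by auto
      have "emeasure lborel {0..1::real} \<le> emeasure lborel (C \<union> (X \<union> (X' - C)))"
        using X X' bC by (intro emeasure_mono) (auto simp: X'_def)
      also have "\<dots> \<le> emeasure lborel C + emeasure lborel (X \<union> (X' - C))"
        using X X' bC by (intro emeasure_subadditive) auto
      also have "emeasure lborel (X \<union> (X' - C)) \<le> emeasure lborel X + emeasure lborel (X' - C)"
        using X X' bC by (intro emeasure_subadditive) auto
      also have "\<dots> \<le> emeasure lborel X + ennreal (e / c)" using C(3) by (intro add_left_mono) simp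
      finally have "1 \<le> emeasure lborel C + (emeasure lborel X + ennreal (e / c))"
        by (simp add: add_left_mono)
      then have "ennreal c * 1 \<le> ennreal c * (emeasure lborel C + (emeasure lborel X + ennreal (e / c)))"
        by (rule mult_left_mono) simp
      also have "\<dots> = ennreal c * emeasure lborel C + (ennreal c * emeasure lborel X + ennreal e)"
        using c \<open>0 < e\<close> by (simp add: distrib_left flip: ennreal_mult)
      finally have "ennreal c * emeasure lborel C + ?H (F - \<psi> ` C)
          \<le> ennreal c * emeasure lborel C + (ennreal c * emeasure lborel X + ennreal e)"
        using 2 by simp
      then have "?H (F - \<psi> ` C) \<le> ennreal c * emeasure lborel X + ennreal e"
        using finC unfolding ennreal_add_left_cancel_le by simp
      with 1 show "?H (\<psi> ` X) \<le> ennreal c * emeasure lborel X + ennreal e" by (rule order_trans)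
    qed
  qed
  have "bij_betw \<psi> ({0..1} - \<psi> -` Z) (F - Z)"
    unfolding bij_betw_def
  proof
    show "inj_on \<psi> ({0..1} - \<psi> -` Z)" using \<psi>_inj by (fastforce simp: inj_on_def)
    show "\<psi> ` ({0..1} - \<psi> -` Z) = F - Z" unfolding \<psi>_onto[symmetric] by auto
  qed
  moreover have "?H (F - (F - Z)) = 0"
    using Z(3) hausdorff_measure_mono[of "F - (F - Z)" Z s] by auto
  moreover have "{0..1} - ({0..1} - \<psi> -` Z) \<in> null_sets lebesgue"
  proof -
    have "{0..1} - ({0..1} - \<psi> -` Z) = \<psi> -` Z \<inter> {0..1}" by auto
    then show ?thesis using null pre[OF Z(1)] by (auto simp: null_sets_def)
  qed
  ultimately have bij: "\<exists>F' I'. F' \<subseteq> F \<and> ?H (F - F') = 0 \<and> I' \<subseteq> {0..1} \<and>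
      {0..1} - I' \<in> null_sets lebesgue \<and> bij_betw \<psi> I' F'"
    by (intro exI[of _ "F - Z"] exI[of _ "{0..1} - \<psi> -` Z"] conjI) auto
  have pull: "emeasure lebesgue (\<psi> -` B \<inter> {0..1}) = ?H B / ?H F" if B: "B \<in> sets borel" "B \<subseteq> F" for B
  proof -
    have "?H B / ?H F = (emeasure lborel (\<psi> -` B \<inter> {0..1}) * ennreal c) / ennreal c"
      using \<psi>_meas[OF B] F(2) by (simp add: mult.commute)
    also have "\<dots> = emeasure lborel (\<psi> -` B \<inter> {0..1})"
      using c by (intro mult_divide_eq_ennreal) auto
    finally show ?thesis using pre[OF B(1)] by simp
  qed
  have "0 < C * c powr (1 / s)" using holder(1) c by simp
  then have "optimal_parametrization s F \<psi>"
    unfolding optimal_parametrization_def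
    using F c \<psi>_onto bij image_meas pull \<psi>_holder
    by (intro conjI ballI impI) (auto intro!: exI[of _ "C * c powr (1 / s)"])
  then show ?thesis by (simp add: \<psi>_def[abs_def])
qed

section \<open>Parametrizing a linear graph-directed system\<close>

lemma append_positions:
  assumes "xs @ p # ys = xs' @ q # ys'" "length xs < length xs'"
  obtains zs where "xs' = xs @ p # zs" "ys = zs @ q # ys'"
  using assms by (auto simp: append_eq_append_conv2 Cons_eq_append_conv)

lemma powr_scale_root:
  fixes r :: real
  assumes "0 < r" "0 \<le> y" "0 < s"
  shows "(r powr s * y) powr (1 / s) = r * y powr (1 / s)"
  using assms by (simp add: powr_mult powr_powr)

text \<open>A graph-directed system whose set equations are ordered: \<open>\<tau> v\<close> lists the pieces \<open>S j ` E u\<close> of \<open>E v\<close>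
  in such a way that each piece ends where the next one begins.  By \<open>mass_eq\<close> the measures of the
  pieces add up to that of \<open>E v\<close>, so pieces overlap in null sets only.\<close>
locale linear_gifs = similitudes S N r
  for S :: "nat \<Rightarrow> 'a::euclidean_space \<Rightarrow> 'a" and N r +
  fixes V :: "'v set" and \<tau> :: "'v \<Rightarrow> (nat \<times> 'v) list" and E :: "'v \<Rightarrow> 'a set"
    and orig :: "'v \<Rightarrow> 'a" and dest :: "'v \<Rightarrow> 'a" and s :: real
  assumes finite_V: "finite V"
    and \<tau>_closed: "\<And>v j u. v \<in> V \<Longrightarrow> (j, u) \<in> set (\<tau> v) \<Longrightarrow> j < N \<and> u \<in> V"
    and E_compact: "\<And>v. v \<in> V \<Longrightarrow> compact (E v)"
    and E_eq: "\<And>v. v \<in> V \<Longrightarrow> E v = (\<Union>(j, u)\<in>set (\<tau> v). S j ` E u)"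
    and s_pos: "0 < s"
    and mass_pos: "\<And>v. v \<in> V \<Longrightarrow> 0 < hausdorff_measure s (E v)"
    and mass_finite: "\<And>v. v \<in> V \<Longrightarrow> hausdorff_measure s (E v) < \<infinity>"
    and mass_eq: "\<And>v. v \<in> V \<Longrightarrow> enn2real (hausdorff_measure s (E v)) =
      (\<Sum>(j, u)\<leftarrow>\<tau> v. r j powr s * enn2real (hausdorff_measure s (E u)))"
    and orig_eq: "\<And>v j u ys. v \<in> V \<Longrightarrow> \<tau> v = (j, u) # ys \<Longrightarrow> orig v = S j (orig u)"
    and dest_eq: "\<And>v j u xs. v \<in> V \<Longrightarrow> \<tau> v = xs @ [(j, u)] \<Longrightarrow> dest v = S j (dest u)"
    and linked: "\<And>v xs j u k w ys. v \<in> V \<Longrightarrow> \<tau> v = xs @ (j, u) # (k, w) # ys \<Longrightarrow>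
      S j (dest u) = S k (orig w)"
begin

definition h :: "'v \<Rightarrow> real" where
  "h v = enn2real (hausdorff_measure s (E v))"

text \<open>The length of the part of the parameter interval that a list of pieces occupies; a point of the
  piece after \<open>xs\<close> has a parameter \<open>weight xs + r j powr s * y\<close>.\<close>
definition weight :: "(nat \<times> 'v) list \<Rightarrow> real" where
  "weight L = (\<Sum>(j, u)\<leftarrow>L. r j powr s * h u)"

lemma weight_simps [simp]:
  "weight [] = 0" "weight ((j, u) # L) = r j powr s * h u + weight L"
  "weight (xs @ ys) = weight xs + weight ys"
  by (simp_all add: weight_def)

lemma h_pos: "v \<in> V \<Longrightarrow> 0 < h v"
  and ennreal_h: "v \<in> V \<Longrightarrow> ennreal (h v) = hausdorff_measure s (E v)"
  using mass_pos[of v] mass_finite[of v] by (auto simp: h_def enn2real_positive_iff)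

lemma weight_\<tau>: "v \<in> V \<Longrightarrow> weight (\<tau> v) = h v"
  unfolding weight_def h_def by (rule mass_eq[symmetric])

lemma edge_pos:
  assumes "v \<in> V" "(j, u) \<in> set (\<tau> v)"
  shows "0 < r j" "0 < r j powr s" "0 < h u" "0 < r j powr s * h u"
  using \<tau>_closed[OF assms] ratio(1)[of j] h_pos[of u] by auto

lemma weight_nonneg: "v \<in> V \<Longrightarrow> set L \<subseteq> set (\<tau> v) \<Longrightarrow> 0 \<le> weight L"
proof (induction L)
  case (Cons p L)
  then show ?case using edge_pos[of v "fst p" "snd p"] by (cases p) auto
qed simp

lemma weight_pos: "v \<in> V \<Longrightarrow> set L \<subseteq> set (\<tau> v) \<Longrightarrow> L \<noteq> [] \<Longrightarrow> 0 < weight L"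
  using weight_nonneg[of v "tl L"] edge_pos(4)[of v "fst (hd L)" "snd (hd L)"]
  by (cases L) (auto intro!: add_pos_nonneg simp del: mult_pos_pos)

lemma position_exists_aux:
  assumes "L \<noteq> []" "\<And>j u. (j, u) \<in> set L \<Longrightarrow> 0 < r j" "0 \<le> x" "x \<le> weight L"
  shows "\<exists>xs j u ys y. L = xs @ (j, u) # ys \<and> 0 \<le> y \<and> y \<le> h u \<and> x = weight xs + r j powr s * y"
  using assms
proof (induction L arbitrary: x)
  case (Cons p L)
  obtain j u where p: "p = (j, u)" by (cases p)
  have r: "0 < r j powr s" using Cons.prems(2)[of j u] p by simp
  show ?case
  proof (cases "x \<le> r j powr s * h u")
    case True
    then show ?thesis using r Cons.prems(3) p
      by (intro exI[of _ "[]"] exI[of _ j] exI[of _ u] exI[of _ L] exI[of _ "x / r j powr s"])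
         (auto simp: field_simps)
  next
    case False
    then have "L \<noteq> []" using Cons.prems(4) p by auto
    then have "\<exists>xs k w ys y. L = xs @ (k, w) # ys \<and> 0 \<le> y \<and> y \<le> h w \<and>
      x - r j powr s * h u = weight xs + r k powr s * y"
      using Cons.prems(2,4) False p by (intro Cons.IH) auto
    then obtain xs k w ys y where *: "L = xs @ (k, w) # ys" "0 \<le> y" "y \<le> h w"
      "x - r j powr s * h u = weight xs + r k powr s * y"
      by blast
    then show ?thesis using p
      by (intro exI[of _ "p # xs"] exI[of _ k] exI[of _ w] exI[of _ ys] exI[of _ y]) auto
  qed
qed simp

lemma position:
  assumes "v \<in> V" "0 \<le> x" "x \<le> h v"
  obtains xs j u ys y where "\<tau> v = xs @ (j, u) # ys" "0 \<le> y" "y \<le> h u" "x = weight xs + r j powr s * y"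
    "j < N" "u \<in> V"
proof -
  have "\<tau> v \<noteq> []" using weight_\<tau>[OF assms(1)] h_pos[OF assms(1)] by auto
  then obtain xs j u ys y where *: "\<tau> v = xs @ (j, u) # ys" "0 \<le> y" "y \<le> h u" "x = weight xs + r j powr s * y"
    using position_exists_aux[of "\<tau> v" x] assms edge_pos(1)[OF assms(1)] weight_\<tau>[OF assms(1)] by auto
  then show thesis using that \<tau>_closed[OF assms(1), of j u] by auto
qed

lemma position_in_range:
  assumes "v \<in> V" "\<tau> v = xs @ (j, u) # ys" "0 \<le> y" "y \<le> h u"
  shows "0 \<le> weight xs + r j powr s * y" "weight xs + r j powr s * y \<le> h v"
proof -
  have nn: "0 \<le> weight xs" "0 \<le> weight ys" using assms by (auto intro!: weight_nonneg[OF assms(1)])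
  have r: "0 < r j powr s" using edge_pos(2)[OF assms(1), of j u] assms(2) by simp
  show "0 \<le> weight xs + r j powr s * y" using nn r assms(3) by simp
  have "r j powr s * y \<le> r j powr s * h u" using r assms(4) by (intro mult_left_mono) auto
  then show "weight xs + r j powr s * y \<le> h v"
    using weight_\<tau>[OF assms(1)] assms(2) nn by simp
qed

text \<open>All weights are positive, so there is no room for a third piece between two positions of the
  same parameter: it is the end of one piece and the beginning of the next.\<close>
lemma position_unique:
  assumes v: "v \<in> V" and 1: "\<tau> v = xs @ (j, u) # ys" "0 \<le> y" "y \<le> h u"
    and 2: "\<tau> v = xs' @ (k, w) # ys'" "0 \<le> y'" "y' \<le> h w"
    and eq: "weight xs + r j powr s * y = weight xs' + r k powr s * y'"
    and less: "length xs < length xs'"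
  shows "xs' = xs @ [(j, u)]" "y = h u" "y' = 0" "\<tau> v = xs @ (j, u) # (k, w) # ys'"
proof -
  obtain zs where zs: "xs' = xs @ (j, u) # zs" "ys = zs @ (k, w) # ys'"
    using append_positions[OF trans[OF 1(1)[symmetric] 2(1)] less] by blast
  have r: "0 < r j powr s" "0 < r k powr s"
    by (rule edge_pos(2)[OF v, of j u], simp add: 1(1), rule edge_pos(2)[OF v, of k w], simp add: 2(1))
  have "r j powr s * y = r j powr s * h u + weight zs + r k powr s * y'" using eq zs by simp
  moreover have "r j powr s * y \<le> r j powr s * h u" using r 1 by (intro mult_left_mono) auto
  moreover have "0 \<le> weight zs" using 1 zs by (intro weight_nonneg[OF v]) auto
  moreover have "0 \<le> r k powr s * y'" using r 2 by simp
  ultimately have "weight zs = 0" "r k powr s * y' = 0" "r j powr s * y = r j powr s * h u" by linarith+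
  moreover have "zs \<noteq> [] \<Longrightarrow> 0 < weight zs" using 1 zs by (intro weight_pos[OF v]) auto
  ultimately show "xs' = xs @ [(j, u)]" "y = h u" "y' = 0" "\<tau> v = xs @ (j, u) # (k, w) # ys'"
    using r zs 1 by auto
qed

text \<open>Follow a parameter through the nested intervals that contain it; the coding map of this
  dynamical system is the parametrization.  Where a parameter lies in two intervals the choice does
  not matter, since consecutive edges of a trail share an end point.\<close>
lemma parametrization_exists:
  "\<exists>g. (\<forall>v\<in>V. \<forall>xs j u ys y. \<tau> v = xs @ (j, u) # ys \<longrightarrow> 0 \<le> y \<longrightarrow> y \<le> h u \<longrightarrow>
      g v (weight xs + r j powr s * y) = S j (g u y)) \<and>
    (\<forall>v\<in>V. g v 0 = orig v \<and> g v (h v) = dest v) \<and>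
    (\<exists>B. \<forall>v\<in>V. \<forall>x\<in>{0..h v}. dist (g v x) 0 \<le> B)"
proof -
  define X where "X = {(v, x). v \<in> V \<and> 0 \<le> x \<and> x \<le> h v}"
  define P where "P z p \<longleftrightarrow> (case z of (v, x) \<Rightarrow> case p of (xs, j, u, ys, y) \<Rightarrow>
    \<tau> v = xs @ (j, u) # ys \<and> 0 \<le> y \<and> y \<le> h u \<and> x = weight xs + r j powr s * y)" for z p
  define c where "c z = (SOME p. P z p)" for z
  define J where "J z = (case c z of (xs, j, u, ys, y) \<Rightarrow> j)" for z
  define T where "T z = (case c z of (xs, j, u, ys, y) \<Rightarrow> (u, y))" for z
  have JT: "\<exists>xs u ys y. T (v, x) = (u, y) \<and> \<tau> v = xs @ (J (v, x), u) # ys \<and> 0 \<le> y \<and> y \<le> h u \<and>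
      x = weight xs + r (J (v, x)) powr s * y \<and> J (v, x) < N \<and> u \<in> V"
    if vx: "v \<in> V" "0 \<le> x" "x \<le> h v" for v x
  proof -
    obtain xs j u ys y where "\<tau> v = xs @ (j, u) # ys" "0 \<le> y" "y \<le> h u" "x = weight xs + r j powr s * y"
      by (rule position[OF vx])
    then have "P (v, x) (xs, j, u, ys, y)" by (simp add: P_def)
    then have "P (v, x) (c (v, x))" unfolding c_def by (rule someI)
    moreover obtain xs j u ys y where c: "c (v, x) = (xs, j, u, ys, y)" by (metis prod_cases5)
    ultimately have *: "\<tau> v = xs @ (j, u) # ys" "0 \<le> y" "y \<le> h u" "x = weight xs + r j powr s * y"
      by (auto simp: P_def)
    then show ?thesis using \<tau>_closed[OF vx(1), of j u] c by (auto simp: J_def T_def)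
  qed
  define D where "D = (\<Sum>j<N. dist (S j 0) 0)"
  have D: "dist (S j 0) 0 \<le> D" if "j < N" for j
    unfolding D_def using that by (intro member_le_sum) auto
  have "\<exists>G. \<forall>z\<in>X. G z = S (J z) (G (T z)) \<and> dist (G z) 0 \<le> D / (1 - rmax)"
  proof (rule coding_map_exists)
    show "0 \<le> rmax" "rmax < 1" using rmax by auto
    fix z assume "z \<in> X"
    then obtain v x where z: "z = (v, x)" "v \<in> V" "0 \<le> x" "x \<le> h v" by (auto simp: X_def)
    note * = JT[OF z(2-4)]
    show "T z \<in> X" using * z by (auto simp: X_def)
    have j: "J z < N" using * z by auto
    show "dist (S (J z) 0) 0 \<le> D" using D[OF j] .
    show "dist (S (J z) y) (S (J z) y') \<le> rmax * dist y y'" for y y'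
      using similitude[OF j] rmax(3)[OF j] by (simp add: mult_right_mono)
  qed
  then obtain G where G: "\<And>z. z \<in> X \<Longrightarrow> G z = S (J z) (G (T z))"
    and bounded: "\<And>z. z \<in> X \<Longrightarrow> dist (G z) 0 \<le> D / (1 - rmax)" by blast
  define B where "B = D / (1 - rmax) + (\<Sum>v\<in>V. dist (orig v) 0 + dist (dest v) 0)"
  have B: "dist (G z) p \<le> B" if "z \<in> X" "v \<in> V" "p = orig v \<or> p = dest v" for z v p
  proof -
    have "dist p 0 \<le> dist (orig v) 0 + dist (dest v) 0" using that(3) by auto
    also have "\<dots> \<le> (\<Sum>v\<in>V. dist (orig v) 0 + dist (dest v) 0)"
      using finite_V that(2) by (intro member_le_sum) auto
    finally show ?thesis using bounded[OF that(1)] dist_triangle2[of "G z" p 0] by (simp add: B_def)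
  qed
  \<comment> \<open>\<open>e\<close> selects an end of every parameter interval and \<open>p\<close> the point that belongs to this end; zooming
    in on an end shows an end of the same kind.\<close>
  have endpoint: "G (v, e v) = p v"
    if e: "\<And>v. v \<in> V \<Longrightarrow> 0 \<le> e v \<and> e v \<le> h v" and p: "p = orig \<or> p = dest"
      and zoom: "\<And>v xs j u ys y. v \<in> V \<Longrightarrow> \<tau> v = xs @ (j, u) # ys \<Longrightarrow> 0 \<le> y \<Longrightarrow> y \<le> h u \<Longrightarrow>
        e v = weight xs + r j powr s * y \<Longrightarrow> y = e u \<and> p v = S j (p u)"
      and v: "v \<in> V" for e p v
  proof -
    have "dist (G (v, e v)) (p v) \<le> 0"
    proof (rule contraction_vanish[where X = V and R = rmax and B = B])
      fix v assume v: "v \<in> V"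
      have X: "(v, e v) \<in> X" using v e by (simp add: X_def)
      show "dist (G (v, e v)) (p v) \<le> B" using B[OF X v] p by blast
      define j where "j = J (v, e v)"
      obtain xs u ys y where *: "T (v, e v) = (u, y)" "\<tau> v = xs @ (j, u) # ys" "0 \<le> y" "y \<le> h u"
        "e v = weight xs + r j powr s * y" "j < N" "u \<in> V"
        using JT[OF v conjunct1[OF e[OF v]] conjunct2[OF e[OF v]]] unfolding j_def by blast
      have y: "y = e u" "p v = S j (p u)" using zoom[OF v *(2-5)] by simp_all
      have "G (v, e v) = S j (G (u, e u))" using G[OF X] *(1) y(1) by (simp add: j_def)
      then have "dist (G (v, e v)) (p v) = r j * dist (G (u, e u)) (p u)"
        using y(2) similitude[OF *(6)] by simp
      also have "\<dots> \<le> rmax * dist (G (u, e u)) (p u)" using rmax(3)[OF *(6)] by (intro mult_right_mono) auto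
      finally show "\<exists>u\<in>V. dist (G (v, e v)) (p v) \<le> rmax * dist (G (u, e u)) (p u)" using *(7) by blast
    qed (use rmax v in auto)
    then show ?thesis by simp
  qed
  have start: "G (v, 0) = orig v" if "v \<in> V" for v
  proof (rule endpoint[where e = "\<lambda>_. 0" and p = orig])
    fix v xs j u ys y
    assume *: "v \<in> V" "\<tau> v = xs @ (j, u) # ys" "0 \<le> y" "y \<le> h u" "0 = weight xs + r j powr s * y"
    have r: "0 < r j powr s" by (rule edge_pos(2)[OF *(1), of j u]) (simp add: *(2))
    then have "0 \<le> r j powr s * y" using *(3) by simp
    then have "weight xs \<le> 0" using *(5) by linarith
    moreover have "set xs \<subseteq> set (\<tau> v)" using *(2) by auto
    ultimately have "xs = []" using weight_pos[OF *(1), of xs] by (cases "xs = []") auto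
    then show "y = 0 \<and> orig v = S j (orig u)" using *(2,5) r orig_eq[OF *(1)] by simp
  qed (use that h_pos in \<open>auto simp: less_imp_le\<close>)
  have stop: "G (v, h v) = dest v" if "v \<in> V" for v
  proof (rule endpoint[where e = h and p = dest])
    fix v xs j u ys y
    assume *: "v \<in> V" "\<tau> v = xs @ (j, u) # ys" "0 \<le> y" "y \<le> h u" "h v = weight xs + r j powr s * y"
    have r: "0 < r j powr s" by (rule edge_pos(2)[OF *(1), of j u]) (simp add: *(2))
    have le: "r j powr s * y \<le> r j powr s * h u" using r *(4) by (intro mult_left_mono) auto
    have "h v = weight xs + r j powr s * h u + weight ys" using weight_\<tau>[OF *(1)] *(2) by simp
    then have sum: "weight ys + r j powr s * h u = r j powr s * y" using *(5) by simp
    then have "weight ys \<le> 0" using le by simp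
    moreover have "set ys \<subseteq> set (\<tau> v)" using *(2) by auto
    ultimately have "ys = []" using weight_pos[OF *(1), of ys] by (cases "ys = []") auto
    then show "y = h u \<and> dest v = S j (dest u)" using *(2) sum r dest_eq[OF *(1)] by simp
  qed (use that h_pos in \<open>auto simp: less_imp_le\<close>)
  have glue: "S j (G (u, y)) = S k (G (w, y'))"
    if "v \<in> V" "\<tau> v = xs @ (j, u) # ys" "0 \<le> y" "y \<le> h u" "\<tau> v = xs' @ (k, w) # ys'" "0 \<le> y'" "y' \<le> h w"
      "weight xs + r j powr s * y = weight xs' + r k powr s * y'" "length xs < length xs'"
    for v xs j u ys y xs' k w ys' y'
  proof -
    note * = position_unique[OF that]
    have "(j, u) \<in> set (\<tau> v)" using that(2) by simp
    moreover have "(k, w) \<in> set (\<tau> v)" using that(5) by simp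
    ultimately have "u \<in> V" "w \<in> V" using \<tau>_closed[OF that(1)] by blast+
    then show ?thesis using * start stop linked[OF that(1) *(4)] by simp
  qed
  have step: "G (v, weight xs + r j powr s * y) = S j (G (u, y))"
    if v: "v \<in> V" and 1: "\<tau> v = xs @ (j, u) # ys" "0 \<le> y" "y \<le> h u" for v xs j u ys y
  proof -
    define x where "x = weight xs + r j powr s * y"
    have x: "0 \<le> x" "x \<le> h v" using position_in_range[OF v 1] by (auto simp: x_def)
    define k where "k = J (v, x)"
    obtain xs' w ys' y' where *: "T (v, x) = (w, y')" "\<tau> v = xs' @ (k, w) # ys'" "0 \<le> y'" "y' \<le> h w"
      "x = weight xs' + r k powr s * y'" "k < N" "w \<in> V"
      using JT[OF v x] unfolding k_def by blast
    have G': "G (v, x) = S k (G (w, y'))" using G[of "(v, x)"] v x *(1) by (simp add: X_def k_def)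
    consider "length xs < length xs'" | "length xs' < length xs" | "length xs = length xs'" by linarith
    then have "S k (G (w, y')) = S j (G (u, y))"
    proof cases
      case 1
      then show ?thesis using glue[OF v that(2-4) *(2-4)] *(5) by (simp add: x_def)
    next
      case 2
      then show ?thesis using glue[OF v *(2-4) that(2-4)] *(5) by (simp add: x_def)
    next
      case 3
      then have "xs = xs'" "k = j" "w = u" using that(2) *(2) by auto
      moreover have "0 < r j powr s" using edge_pos(2)[OF v, of j u] that(2) by simp
      ultimately show ?thesis using *(5) by (simp add: x_def)
    qed
    then show ?thesis using G' by (simp add: x_def)
  qed
  show ?thesis
    using start stop step bounded
    by (intro exI[of _ "\<lambda>v x. G (v, x)"]) (auto simp: X_def intro!: exI[of _ "D / (1 - rmax)"])
qed

end

text \<open>A parametrization as provided by \<open>parametrization_exists\<close>, with \<open>[0, h v]\<close> as the parameter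
  interval of \<open>E v\<close>.  On intervals of these lengths the functional equation is affine with slope
  exactly \<open>r j powr s\<close>.\<close>
locale parametrized_gifs = linear_gifs S N r V \<tau> E orig dest s
  for S :: "nat \<Rightarrow> 'a::euclidean_space \<Rightarrow> 'a" and N r and V :: "'v set" and \<tau> E orig dest s +
  fixes g :: "'v \<Rightarrow> real \<Rightarrow> 'a"
  assumes g_step: "\<And>v xs j u ys y. v \<in> V \<Longrightarrow> \<tau> v = xs @ (j, u) # ys \<Longrightarrow> 0 \<le> y \<Longrightarrow> y \<le> h u \<Longrightarrow>
      g v (weight xs + r j powr s * y) = S j (g u y)"
    and g_start: "\<And>v. v \<in> V \<Longrightarrow> g v 0 = orig v"
    and g_stop: "\<And>v. v \<in> V \<Longrightarrow> g v (h v) = dest v"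
    and g_bounded: "\<exists>B. \<forall>v\<in>V. \<forall>x\<in>{0..h v}. dist (g v x) 0 \<le> B"
begin

lemma scales_bounded_below: "\<exists>\<delta>>0. \<forall>v\<in>V. \<forall>(j, u)\<in>set (\<tau> v). \<delta> \<le> r j powr s * h u"
proof -
  define A where "A = insert 1 (\<Union>v\<in>V. (\<lambda>(j, u). r j powr s * h u) ` set (\<tau> v))"
  have "finite A" "A \<noteq> {}" using finite_V by (auto simp: A_def)
  moreover have "0 < a" if "a \<in> A" for a
  proof (cases "a = 1")
    case False
    then obtain v j u where "v \<in> V" "(j, u) \<in> set (\<tau> v)" "a = r j powr s * h u"
      using \<open>a \<in> A\<close> by (auto simp: A_def)
    then show ?thesis using edge_pos(4) by simp
  qed simp
  ultimately have "0 < Min A" by simp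
  moreover have "\<forall>v\<in>V. \<forall>(j, u)\<in>set (\<tau> v). Min A \<le> r j powr s * h u"
  proof (intro ballI, clarify)
    fix v j u assume "v \<in> V" "(j, u) \<in> set (\<tau> v)"
    then have "r j powr s * h u \<in> A" by (force simp: A_def)
    then show "Min A \<le> r j powr s * h u" using \<open>finite A\<close> by (intro Min_le)
  qed
  ultimately show ?thesis by blast
qed

lemma weight_ge_scale:
  assumes "\<forall>v\<in>V. \<forall>(j, u)\<in>set (\<tau> v). \<delta> \<le> r j powr s * h u" "v \<in> V" "set L \<subseteq> set (\<tau> v)" "L \<noteq> []"
  shows "\<delta> \<le> weight L"
proof -
  obtain j u L' where L: "L = (j, u) # L'" using assms(4) by (metis list.exhaust surj_pair)
  have "\<delta> \<le> r j powr s * h u" using assms(1-3) L by fastforce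
  moreover have "0 \<le> weight L'" using assms L by (intro weight_nonneg[OF assms(2)]) auto
  ultimately show ?thesis using L by simp
qed

text \<open>The \<open>s\<close>-th root scales like the maps: an interval of length \<open>r powr s * y\<close> is mapped by a
  similitude of ratio \<open>r\<close>.  So zoom in on two parameters until a first-level division point
  separates them.  If they are then at least one piece apart, boundedness suffices; otherwise they
  lie on either side of a division point, and each is compared with it, again by zooming in.\<close>
lemma g_holder:
  "\<exists>C>0. \<forall>v\<in>V. \<forall>x\<in>{0..h v}. \<forall>y\<in>{0..h v}. dist (g v x) (g v y) \<le> C * \<bar>x - y\<bar> powr (1 / s)"
proof -
  obtain \<delta> where \<delta>: "0 < \<delta>" "\<forall>v\<in>V. \<forall>(j, u)\<in>set (\<tau> v). \<delta> \<le> r j powr s * h u"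
    using scales_bounded_below by blast
  obtain B where B: "\<And>v x. v \<in> V \<Longrightarrow> x \<in> {0..h v} \<Longrightarrow> dist (g v x) 0 \<le> B"
    using g_bounded by blast
  define D where "D = 2 * \<bar>B\<bar> + 1"
  have D: "dist (g v x) (g u y) \<le> D" if "v \<in> V" "x \<in> {0..h v}" "u \<in> V" "y \<in> {0..h u}" for v x u y
    using B[OF that(1,2)] B[OF that(3,4)] dist_triangle2[of "g v x" "g u y" 0] by (simp add: D_def)
  have Dpos: "0 < D" by (simp add: D_def)
  \<comment> \<open>\<open>D\<close> bounds all distances, and parameters in non-adjacent pieces differ by at least \<open>\<delta>\<close>.\<close>
  define C where "C = D / \<delta> powr (1 / s)"
  have Cpos: "0 < C" using Dpos \<delta> by (simp add: C_def)
  have far: "D \<le> C * t powr (1 / s)" if "\<delta> \<le> t" for t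
  proof -
    have "D = C * \<delta> powr (1 / s)" using \<delta> by (simp add: C_def)
    also have "\<dots> \<le> C * t powr (1 / s)"
      using that \<delta> Cpos s_pos by (intro mult_left_mono powr_mono2) auto
    finally show ?thesis .
  qed
  have scale: "max 0 (r j * d - c * (r j powr s * t) powr (1 / s)) \<le> rmax * max 0 (d - c * t powr (1 / s))"
    if "j < N" "0 \<le> t" for j d c t
  proof -
    have "r j * d - c * (r j powr s * t) powr (1 / s) = r j * (d - c * t powr (1 / s))"
      using powr_scale_root[OF ratio(1)[OF that(1)] that(2) s_pos] by (simp add: algebra_simps)
    then have "max 0 (r j * d - c * (r j powr s * t) powr (1 / s)) = r j * max 0 (d - c * t powr (1 / s))"
      using ratio(1)[OF that(1)] by (simp add: max_def mult_le_0_iff zero_le_mult_iff)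
    also have "\<dots> \<le> rmax * max 0 (d - c * t powr (1 / s))"
      using rmax(3)[OF that(1)] by (intro mult_right_mono) auto
    finally show ?thesis .
  qed
  \<comment> \<open>\<open>e\<close> selects an end of every parameter interval.  Either \<open>x\<close> is far from the end \<open>e v\<close>, or both lie
    in the same piece and correspond there to \<open>y\<close> and the end \<open>e u\<close>.\<close>
  have endpoint: "dist (g v x) (g v (e v)) \<le> C * \<bar>x - e v\<bar> powr (1 / s)"
    if e: "\<And>v. v \<in> V \<Longrightarrow> 0 \<le> e v \<and> e v \<le> h v"
      and zoom: "\<And>v xs j u ys y. v \<in> V \<Longrightarrow> \<tau> v = xs @ (j, u) # ys \<Longrightarrow> 0 \<le> y \<Longrightarrow> y \<le> h u \<Longrightarrow>
        \<delta> \<le> \<bar>weight xs + r j powr s * y - e v\<bar> \<or> e v = weight xs + r j powr s * e u"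
      and v: "v \<in> V" "0 \<le> x" "x \<le> h v" for e v x
  proof -
    let ?X = "{(v, x). v \<in> V \<and> 0 \<le> x \<and> x \<le> h v}"
    let ?f = "\<lambda>(v, x). max 0 (dist (g v x) (g v (e v)) - C * \<bar>x - e v\<bar> powr (1 / s))"
    have "?f (v, x) \<le> 0"
    proof (rule contraction_vanish[where X = ?X and R = rmax and B = D])
      fix z assume "z \<in> ?X"
      then obtain v x where z: "z = (v, x)" "v \<in> V" "0 \<le> x" "x \<le> h v" by blast
      have d: "dist (g v x) (g v (e v)) \<le> D" using z e[OF z(2)] by (intro D) auto
      have "0 \<le> C * \<bar>x - e v\<bar> powr (1 / s)" using Cpos by simp
      then show "?f z \<le> D" using d Dpos z by simp
      obtain xs j u ys y where p: "\<tau> v = xs @ (j, u) # ys" "0 \<le> y" "y \<le> h u"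
        "x = weight xs + r j powr s * y" "j < N" "u \<in> V" by (rule position[OF z(2-4)])
      from zoom[OF z(2) p(1-3)] show "\<exists>w\<in>?X. ?f z \<le> rmax * ?f w"
      proof
        assume ev: "e v = weight xs + r j powr s * e u"
        have "g v x = S j (g u y)" using g_step[OF z(2) p(1-3)] p(4) by simp
        moreover have "g v (e v) = S j (g u (e u))"
          unfolding ev using g_step[OF z(2) p(1)] e[OF p(6)] by simp
        moreover have "x - e v = r j powr s * (y - e u)" using p(4) ev by (simp add: algebra_simps)
        then have "\<bar>x - e v\<bar> = r j powr s * \<bar>y - e u\<bar>" by (simp add: abs_mult)
        ultimately have "?f z = max 0 (r j * dist (g u y) (g u (e u)) - C * (r j powr s * \<bar>y - e u\<bar>) powr (1 / s))"
          using z(1) similitude[OF p(5)] by simp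
        also have "\<dots> \<le> rmax * ?f (u, y)" using scale[OF p(5), of "\<bar>y - e u\<bar>"] by simp
        finally show ?thesis using p by (intro bexI[of _ "(u, y)"]) auto
      next
        assume "\<delta> \<le> \<bar>weight xs + r j powr s * y - e v\<bar>"
        then have "?f z = 0" using far d z p(4) by fastforce
        then show ?thesis using z by (intro bexI[of _ z]) auto
      qed
    qed (use rmax v in auto)
    then show ?thesis by simp
  qed
  have start: "dist (g v x) (g v 0) \<le> C * x powr (1 / s)" if v: "v \<in> V" "0 \<le> x" "x \<le> h v" for v x
  proof -
    have "\<delta> \<le> \<bar>weight xs + r j powr s * y - 0\<bar> \<or> 0 = weight xs + r j powr s * 0"
      if "v \<in> V" "\<tau> v = xs @ (j, u) # ys" "0 \<le> y" "y \<le> h u" for v xs j u ys y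
    proof (cases "xs = []")
      case False
      have "\<delta> \<le> weight xs" using that(2) False by (intro weight_ge_scale[OF \<delta>(2) that(1)]) auto
      moreover have "0 \<le> r j powr s * y" using that(3) by simp
      ultimately show ?thesis by linarith
    qed simp
    then show ?thesis using endpoint[of "\<lambda>_. 0", OF _ _ v] h_pos v(2) by (simp add: less_imp_le)
  qed
  have stop: "dist (g v x) (g v (h v)) \<le> C * (h v - x) powr (1 / s)" if v: "v \<in> V" "0 \<le> x" "x \<le> h v" for v x
  proof -
    have "\<delta> \<le> \<bar>weight xs + r j powr s * y - h v\<bar> \<or> h v = weight xs + r j powr s * h u"
      if "v \<in> V" "\<tau> v = xs @ (j, u) # ys" "0 \<le> y" "y \<le> h u" for v xs j u ys y
    proof -
      have hv: "h v = weight xs + r j powr s * h u + weight ys" using weight_\<tau>[OF that(1)] that(2) by simp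
      show ?thesis
      proof (cases "ys = []")
        case False
        have "\<delta> \<le> weight ys" using that(2) False by (intro weight_ge_scale[OF \<delta>(2) that(1)]) auto
        moreover have "r j powr s * y \<le> r j powr s * h u" using that(4) by (intro mult_left_mono) auto
        ultimately show ?thesis using hv by linarith
      qed (use hv in simp)
    qed
    then show ?thesis using endpoint[of h, OF _ _ v] h_pos v(3) by (simp add: less_imp_le abs_minus_commute)
  qed
  have main: "dist (g v x) (g v y) \<le> 2 * C * \<bar>x - y\<bar> powr (1 / s)"
    if "v \<in> V" "0 \<le> x" "x \<le> y" "y \<le> h v" for v x y
  proof -
    let ?X = "{(v, x, y). v \<in> V \<and> 0 \<le> x \<and> x \<le> y \<and> y \<le> h v}"
    let ?f = "\<lambda>(v, x, y). max 0 (dist (g v x) (g v y) - 2 * C * (y - x) powr (1 / s))"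
    have "?f (v, x, y) \<le> 0"
    proof (rule contraction_vanish[where X = ?X and R = rmax and B = D])
      fix z assume "z \<in> ?X"
      then obtain v x y where z: "z = (v, x, y)" "v \<in> V" "0 \<le> x" "x \<le> y" "y \<le> h v" by blast
      have d: "dist (g v x) (g v y) \<le> D" using z by (intro D) auto
      have "0 \<le> 2 * C * (y - x) powr (1 / s)" using Cpos by simp
      then show "?f z \<le> D" using d Dpos z by simp
      have trivial: "\<exists>w\<in>?X. ?f z \<le> rmax * ?f w" if "dist (g v x) (g v y) \<le> 2 * C * (y - x) powr (1 / s)"
        using that z by (intro bexI[of _ z]) auto
      obtain xs j u ys x' where p: "\<tau> v = xs @ (j, u) # ys" "0 \<le> x'" "x' \<le> h u"
        "x = weight xs + r j powr s * x'" "j < N" "u \<in> V"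
        using z by (elim position[of v x]) auto
      obtain xs' k w ys' y' where q: "\<tau> v = xs' @ (k, w) # ys'" "0 \<le> y'" "y' \<le> h w"
        "y = weight xs' + r k powr s * y'" "k < N" "w \<in> V"
        using z by (elim position[of v y]) auto
      have gx: "g v x = S j (g u x')" using g_step[OF z(2) p(1-3)] p(4) by simp
      have gy: "g v y = S k (g w y')" using g_step[OF z(2) q(1-3)] q(4) by simp
      have rp: "0 < r j powr s" "0 < r k powr s" using ratio(1)[OF p(5)] ratio(1)[OF q(5)] by simp_all
      have x'le: "r j powr s * x' \<le> r j powr s * h u" and y'le: "r k powr s * y' \<le> r k powr s * h w"
        using rp p(3) q(3) by (auto intro!: mult_left_mono)
      consider "length xs = length xs'" | "length xs < length xs'" | "length xs' < length xs" by linarith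
      then show "\<exists>w\<in>?X. ?f z \<le> rmax * ?f w"
      proof cases
        case 1
        then have eq: "xs' = xs" "k = j" "w = u" using p(1) q(1) by auto
        have yx: "y - x = r j powr s * (y' - x')" using p(4) q(4) eq by (simp add: algebra_simps)
        have "0 \<le> r j powr s * (y' - x')" using yx z(4) by linarith
        then have le: "x' \<le> y'" using rp(1) unfolding zero_le_mult_iff by linarith
        have "?f z = max 0 (r j * dist (g u x') (g u y') - 2 * C * (r j powr s * (y' - x')) powr (1 / s))"
          using z(1) gx gy eq yx similitude[OF p(5)] by simp
        also have "\<dots> \<le> rmax * ?f (u, x', y')" using scale[OF p(5), of "y' - x'"] le by simp
        finally show ?thesis using p q eq le by (intro bexI[of _ "(u, x', y')"]) auto
      next
        case 2
        obtain zs where zs: "xs' = xs @ (j, u) # zs" "ys = zs @ (k, w) # ys'"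
          using append_positions[OF trans[OF p(1)[symmetric] q(1)] 2] by blast
        have yx: "y - x = r j powr s * (h u - x') + weight zs + r k powr s * y'"
          using p(4) q(4) zs by (simp add: algebra_simps)
        have nn: "0 \<le> r j powr s * (h u - x')" "0 \<le> r k powr s * y'" using rp p(3) q(2) by auto
        show ?thesis
        proof (cases "zs = []")
          case True
          have \<tau>v: "\<tau> v = xs @ (j, u) # (k, w) # ys'" using p(1) zs True by simp
          \<comment> \<open>The parameters lie in adjacent pieces, on either side of the division point.\<close>
          have mid: "S j (g u (h u)) = S k (g w 0)"
            using linked[OF z(2) \<tau>v] g_start[OF q(6)] g_stop[OF p(6)] by simp
          have "dist (g v x) (g v y) \<le> dist (g v x) (S j (g u (h u))) + dist (S k (g w 0)) (g v y)"
            unfolding mid by (rule dist_triangle)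
          also have "\<dots> = r j * dist (g u x') (g u (h u)) + r k * dist (g w y') (g w 0)"
            using gx gy similitude[OF p(5)] similitude[OF q(5)] by (simp add: dist_commute)
          also have "\<dots> \<le> r j * (C * (h u - x') powr (1 / s)) + r k * (C * y' powr (1 / s))"
            using start[OF q(6,2,3)] stop[OF p(6,2,3)] ratio(1)[OF p(5)] ratio(1)[OF q(5)]
            by (intro add_mono mult_left_mono) auto
          also have "\<dots> = C * (r j powr s * (h u - x')) powr (1 / s) + C * (r k powr s * y') powr (1 / s)"
            using powr_scale_root[OF ratio(1)[OF p(5)] _ s_pos, of "h u - x'"] p(3)
              powr_scale_root[OF ratio(1)[OF q(5)] q(2) s_pos] by simp
          also have "\<dots> \<le> C * (y - x) powr (1 / s) + C * (y - x) powr (1 / s)"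
            using yx True nn s_pos Cpos by (intro add_mono mult_left_mono powr_mono2) auto
          finally show ?thesis by (intro trivial) simp
        next
          case False
          have "\<delta> \<le> weight zs" using p(1) zs False by (intro weight_ge_scale[OF \<delta>(2) z(2)]) auto
          then have "\<delta> \<le> y - x" using yx nn by linarith
          then have "dist (g v x) (g v y) \<le> C * (y - x) powr (1 / s)" using far d by (meson order_trans)
          also have "\<dots> \<le> 2 * C * (y - x) powr (1 / s)" using Cpos by (intro mult_right_mono) auto
          finally show ?thesis by (rule trivial)
        qed
      next
        case 3
        obtain zs where zs: "xs = xs' @ (k, w) # zs" "ys' = zs @ (j, u) # ys"
          using append_positions[OF trans[OF q(1)[symmetric] p(1)] 3] by blast
        have "0 \<le> weight zs" using q(1) zs by (intro weight_nonneg[OF z(2)]) auto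
        moreover have "0 \<le> r j powr s * x'" using p by simp
        ultimately have "y \<le> x" using p(4) q(4) zs y'le by simp
        then show ?thesis using z(4) by (intro trivial) simp
      qed
    qed (use rmax that in auto)
    then show ?thesis using that by (simp add: abs_minus_commute)
  qed
  have "dist (g v x) (g v y) \<le> 2 * C * \<bar>x - y\<bar> powr (1 / s)"
    if "v \<in> V" "x \<in> {0..h v}" "y \<in> {0..h v}" for v x y
    using main[of v x y] main[of v y x] that by (cases "x \<le> y") (auto simp: dist_commute abs_minus_commute)
  then show ?thesis using Cpos by (intro exI[of _ "2 * C"]) auto
qed

lemma g_continuous: "v \<in> V \<Longrightarrow> continuous_on {0..h v} (g v)"
proof -
  obtain C where "\<forall>v\<in>V. \<forall>x\<in>{0..h v}. \<forall>y\<in>{0..h v}. dist (g v x) (g v y) \<le> C * \<bar>x - y\<bar> powr (1 / s)"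
    using g_holder by blast
  then show "v \<in> V \<Longrightarrow> continuous_on {0..h v} (g v)"
    using s_pos by (intro continuous_on_holder[where \<alpha> = "1 / s" and C = C]) auto
qed

text \<open>By the functional equation the images of the parameter intervals solve the set equations, whose
  solution is unique.\<close>
lemma g_image: "v \<in> V \<Longrightarrow> g v ` {0..h v} = E v"
proof -
  have comp: "compact (g v ` {0..h v})" if "v \<in> V" for v
    using g_continuous[OF that] by (intro compact_continuous_image) auto
  have ne: "g v ` {0..h v} \<noteq> {}" "E v \<noteq> {}" if "v \<in> V" for v
    using h_pos[OF that] mass_pos[OF that] by auto
  assume v: "v \<in> V"
  show "g v ` {0..h v} = E v"
  proof
    show "g v ` {0..h v} \<subseteq> E v"
    proof (rule gifs_subset[OF finite_V \<tau>_closed _ _ _ _ _ v])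
      fix v assume v: "v \<in> V"
      show "g v ` {0..h v} \<subseteq> (\<Union>(j, u)\<in>set (\<tau> v). S j ` g u ` {0..h u})"
      proof
        fix p assume "p \<in> g v ` {0..h v}"
        then obtain x where x: "0 \<le> x" "x \<le> h v" "p = g v x" by auto
        obtain xs j u ys y where q: "\<tau> v = xs @ (j, u) # ys" "0 \<le> y" "y \<le> h u"
          "x = weight xs + r j powr s * y" by (rule position[OF v x(1,2)])
        have "p = S j (g u y)" using g_step[OF v q(1-3)] q(4) x(3) by simp
        moreover have "(j, u) \<in> set (\<tau> v)" using q by simp
        ultimately show "p \<in> (\<Union>(j, u)\<in>set (\<tau> v). S j ` g u ` {0..h u})" using q(2,3) by force
      qed
      show "bounded (g v ` {0..h v})" using comp[OF v] by (rule compact_imp_bounded)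
      show "(\<Union>(j, u)\<in>set (\<tau> v). S j ` E u) \<subseteq> E v" using E_eq[OF v] by simp
      show "closed (E v)" "E v \<noteq> {}" using E_compact[OF v] ne[OF v] by (auto intro: compact_imp_closed)
    qed
    show "E v \<subseteq> g v ` {0..h v}"
    proof (rule gifs_subset[OF finite_V \<tau>_closed _ _ _ _ _ v])
      fix v assume v: "v \<in> V"
      show "E v \<subseteq> (\<Union>(j, u)\<in>set (\<tau> v). S j ` E u)" using E_eq[OF v] by simp
      show "bounded (E v)" using E_compact[OF v] by (rule compact_imp_bounded)
      show "closed (g v ` {0..h v})" "g v ` {0..h v} \<noteq> {}"
        using comp[OF v] ne[OF v] by (auto intro: compact_imp_closed)
      show "(\<Union>(j, u)\<in>set (\<tau> v). S j ` g u ` {0..h u}) \<subseteq> g v ` {0..h v}"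
      proof clarify
        fix j u y assume ju: "(j, u) \<in> set (\<tau> v)" and y: "y \<in> {0..h u}"
        obtain xs ys where \<tau>: "\<tau> v = xs @ (j, u) # ys" using split_list[OF ju] by blast
        have "S j (g u y) = g v (weight xs + r j powr s * y)" using g_step[OF v \<tau>] y by simp
        then show "S j (g u y) \<in> g v ` {0..h v}" using position_in_range[OF v \<tau>] y by auto
      qed
    qed
  qed
qed

end

section \<open>Measure and double points of the parametrization\<close>

context linear_gifs
begin

definition pieces :: "'v \<Rightarrow> 'a set list" where
  "pieces v = map (\<lambda>(j, u). S j ` E u) (\<tau> v)"

lemma length_pieces [simp]: "length (pieces v) = length (\<tau> v)"
  by (simp add: pieces_def)

lemma pieces_nth: "\<tau> v = xs @ (j, u) # ys \<Longrightarrow> pieces v ! length xs = S j ` E u"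
  by (simp add: pieces_def nth_append)

lemma Union_pieces: "v \<in> V \<Longrightarrow> \<Union>(set (pieces v)) = E v"
  using E_eq[of v] by (simp add: pieces_def split_def)

lemma hausdorff_measure_S_image:
  "j < N \<Longrightarrow> hausdorff_measure s (S j ` X) = ennreal (r j powr s) * hausdorff_measure s X"
  using s_pos ratio similitude by (intro hausdorff_measure_similitude)

lemma sum_pieces:
  assumes v: "v \<in> V"
  shows "(\<Sum>Y\<leftarrow>pieces v. hausdorff_measure s Y) = hausdorff_measure s (E v)"
proof -
  have "hausdorff_measure s (S j ` E u) = ennreal (r j powr s * h u)" if "(j, u) \<in> set (\<tau> v)" for j u
  proof -
    have "j < N" "u \<in> V" using \<tau>_closed[OF v that] by auto
    then show ?thesis using hausdorff_measure_S_image[of j "E u"] ennreal_h[of u] h_pos[of u]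
      by (simp add: ennreal_mult less_imp_le)
  qed
  then have "(\<Sum>Y\<leftarrow>pieces v. hausdorff_measure s Y) = (\<Sum>(j, u)\<leftarrow>\<tau> v. ennreal (r j powr s * h u))"
    by (auto simp: pieces_def comp_def intro!: arg_cong[where f = sum_list] map_cong)
  also have "\<dots> = ennreal (weight (\<tau> v))"
    unfolding weight_def split_def using edge_pos(4)[OF v]
    by (intro sum_list_ennreal) (metis less_imp_le prod.collapse)
  finally show ?thesis using weight_\<tau>[OF v] ennreal_h[OF v] by simp
qed

lemma pieces_borel: "v \<in> V \<Longrightarrow> Y \<in> set (pieces v) \<Longrightarrow> Y \<in> sets borel"
  using \<tau>_closed E_compact compact_S_image
  by (fastforce simp: pieces_def intro: borel_closed compact_imp_closed)

lemma additive_pieces: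
  assumes "v \<in> V" "B \<in> sets borel"
  shows "(\<Sum>Y\<leftarrow>pieces v. hausdorff_measure s (Y \<inter> B)) = hausdorff_measure s (E v \<inter> B)"
  using hausdorff_measure_additive_pieces[of s "pieces v" B] s_pos sum_pieces[OF assms(1)]
    mass_finite[OF assms(1)] assms(2) by (simp add: Union_pieces[OF assms(1)])

lemma pieces_null:
  assumes "v \<in> V" "i < length (\<tau> v)" "k < length (\<tau> v)" "i \<noteq> k"
  shows "hausdorff_measure s (pieces v ! i \<inter> pieces v ! k) = 0"
  using hausdorff_measure_pieces_null[of s "pieces v" i k] s_pos sum_pieces[OF assms(1)]
    mass_finite[OF assms(1)] pieces_borel[OF assms(1)] assms(2-)
  by (simp add: Union_pieces[OF assms(1)])

end

context parametrized_gifs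
begin

definition time_in :: "'v \<Rightarrow> 'a set \<Rightarrow> ennreal" where
  "time_in v B = emeasure lborel (g v -` B \<inter> {0..h v})"

lemma g_vimage_borel:
  assumes "v \<in> V" "B \<in> sets borel" "a \<le> h v" "0 \<le> b"
  shows "g v -` B \<inter> {b..a} \<in> sets borel"
proof (rule borel_vimage_continuous_on[OF _ _ assms(2)])
  show "continuous_on {b..a} (g v)"
    using g_continuous[OF assms(1)] assms(3,4) by (elim continuous_on_subset) auto
qed simp

text \<open>Cut the parameter interval into the intervals of the pieces; the affine change of variable on
  each of them contributes the factor \<open>r j powr s\<close>.\<close>
lemma time_in_le_pieces:
  assumes v: "v \<in> V" and B: "B \<in> sets borel"
  shows "time_in v B \<le> (\<Sum>(j, u)\<leftarrow>\<tau> v. ennreal (r j powr s) * time_in u (S j -` B))"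
proof -
  have "emeasure lborel (g v -` B \<inter> {0..weight xs})
      \<le> (\<Sum>(j, u)\<leftarrow>xs. ennreal (r j powr s) * time_in u (S j -` B))" if "\<tau> v = xs @ ys" for xs ys
    using that
  proof (induction xs arbitrary: ys rule: rev_induct)
    case Nil
    have "emeasure lborel (g v -` B \<inter> {0..0}) \<le> emeasure lborel {0::real}" by (rule emeasure_mono) auto
    then show ?case by simp
  next
    case (snoc p xs)
    obtain j u where p: "p = (j, u)" by (cases p)
    have \<tau>: "\<tau> v = xs @ (j, u) # ys" using snoc.prems p by simp
    have ju: "j < N" "u \<in> V" using \<tau>_closed[OF v, of j u] \<tau> by auto
    define c where "c = r j powr s"
    have c: "0 < c" using ratio(1)[OF ju(1)] by (simp add: c_def)
    have nn: "0 \<le> weight xs" "0 \<le> weight ys" using \<tau> by (auto intro!: weight_nonneg[OF v])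
    have hv: "h v = weight xs + c * h u + weight ys" using weight_\<tau>[OF v] \<tau> by (simp add: c_def)
    define A where "A = g v -` B \<inter> {0..weight xs}"
    define A' where "A' = g v -` B \<inter> {weight xs..weight xs + c * h u}"
    have bor: "A \<in> sets borel" "A' \<in> sets borel"
      unfolding A_def A'_def using g_vimage_borel[OF v B] hv nn c h_pos[OF ju(2)] by simp_all
    have A': "A' = (\<lambda>y. c *\<^sub>R y + weight xs) ` (g u -` (S j -` B) \<inter> {0..h u})"
    proof (intro set_eqI iffI)
      fix x assume "x \<in> A'"
      then have x: "g v x \<in> B" "weight xs \<le> x" "x \<le> weight xs + c * h u" by (auto simp: A'_def)
      define y where "y = (x - weight xs) / c"
      have y: "0 \<le> y" "y \<le> h u" "x = weight xs + c * y"
        using x c by (auto simp: y_def divide_simps mult.commute)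
      then have "g v x = S j (g u y)" using g_step[OF v \<tau>] by (simp add: c_def)
      then show "x \<in> (\<lambda>y. c *\<^sub>R y + weight xs) ` (g u -` (S j -` B) \<inter> {0..h u})"
        using x(1) y by (intro image_eqI[of _ _ y]) auto
    next
      fix x assume "x \<in> (\<lambda>y. c *\<^sub>R y + weight xs) ` (g u -` (S j -` B) \<inter> {0..h u})"
      then obtain y where "y \<in> g u -` (S j -` B) \<inter> {0..h u}" "x = c *\<^sub>R y + weight xs" by (rule imageE)
      then have "x = c * y + weight xs" and y: "S j (g u y) \<in> B" "0 \<le> y" "y \<le> h u" by auto
      then have x: "x = weight xs + c * y" by simp
      then have "g v x = S j (g u y)" using g_step[OF v \<tau>] y by (simp add: c_def)
      then show "x \<in> A'" using x y c by (auto simp: A'_def)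
    qed
    have "emeasure lebesgue A' = ennreal c * emeasure lebesgue (g u -` (S j -` B) \<inter> {0..h u})"
      unfolding A' emeasure_lebesgue_affine using c by simp
    then have eA': "emeasure lborel A' = ennreal c * time_in u (S j -` B)"
      using bor(2) g_vimage_borel[OF ju(2) S_vimage_borel[OF ju(1) B] order_refl order_refl]
      by (simp add: time_in_def)
    have wt: "weight (xs @ [p]) = weight xs + c * h u" using p by (simp add: c_def)
    have "0 \<le> c * h u" using c h_pos[OF ju(2)] by simp
    then have "g v -` B \<inter> {0..weight (xs @ [p])} = A \<union> A'"
      unfolding wt A_def A'_def using nn by auto
    then have "emeasure lborel (g v -` B \<inter> {0..weight (xs @ [p])}) \<le> emeasure lborel A + emeasure lborel A'"
      using emeasure_subadditive[of A lborel A'] bor by simp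
    also have "\<dots> \<le> (\<Sum>(j, u)\<leftarrow>xs. ennreal (r j powr s) * time_in u (S j -` B)) + ennreal c * time_in u (S j -` B)"
      using snoc.IH[OF \<tau>] eA' unfolding A_def by (intro add_mono) auto
    finally show ?case using p by (simp add: c_def)
  qed
  from this[of "\<tau> v" "[]"] show ?thesis using weight_\<tau>[OF v] by (simp add: time_in_def)
qed

text \<open>After \<open>n\<close> zooms every piece has diameter less than \<open>\<epsilon>\<close>, and a piece that meets \<open>B\<close> then lies
  in the \<open>\<epsilon>\<close>-neighbourhood of \<open>B\<close>; the time spent in a whole piece is its measure.\<close>
lemma time_in_le_neighbourhood:
  assumes D: "\<And>v x y. v \<in> V \<Longrightarrow> x \<in> E v \<Longrightarrow> y \<in> E v \<Longrightarrow> dist x y \<le> D" "0 \<le> D"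
  shows "v \<in> V \<Longrightarrow> B \<in> sets borel \<Longrightarrow> D * rmax ^ n < \<epsilon> \<Longrightarrow>
    time_in v B \<le> hausdorff_measure s (E v \<inter> (\<Union>x\<in>B. ball x \<epsilon>))"
proof (induction n arbitrary: v B \<epsilon>)
  case 0
  show ?case
  proof (cases "E v \<inter> B = {}")
    case True
    then have "g v -` B \<inter> {0..h v} = {}" using g_image[OF 0(1)] by blast
    then show ?thesis by (simp add: time_in_def)
  next
    case False
    then obtain x where x: "x \<in> E v" "x \<in> B" by blast
    have "E v \<subseteq> ball x \<epsilon>" using D(1)[OF 0(1) x(1)] 0(3) by fastforce
    then have eq: "E v \<inter> (\<Union>x\<in>B. ball x \<epsilon>) = E v" using x(2) by blast
    have "time_in v B \<le> emeasure lborel {0..h v}"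
      unfolding time_in_def by (intro emeasure_mono) auto
    also have "\<dots> = hausdorff_measure s (E v)" using ennreal_h[OF 0(1)] h_pos[OF 0(1)] by simp
    finally show ?thesis by (simp only: eq)
  qed
next
  case (Suc n)
  define Q where "Q = (\<Union>x\<in>B. ball x \<epsilon>)"
  have "time_in v B \<le> (\<Sum>(j, u)\<leftarrow>\<tau> v. ennreal (r j powr s) * time_in u (S j -` B))"
    by (rule time_in_le_pieces[OF Suc.prems(1,2)])
  also have "\<dots> \<le> (\<Sum>(j, u)\<leftarrow>\<tau> v. hausdorff_measure s (S j ` E u \<inter> Q))"
  proof (rule sum_list_mono, clarify)
    fix j u assume "(j, u) \<in> set (\<tau> v)"
    then have ju: "j < N" "u \<in> V" using \<tau>_closed[OF Suc.prems(1)] by auto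
    have rj: "0 < r j" using ratio ju by simp
    have "D * rmax ^ n * r j \<le> D * rmax ^ n * rmax"
      using rmax D(2) ju by (intro mult_left_mono) auto
    then have "D * rmax ^ n * r j < \<epsilon>" using Suc.prems(3) by (simp add: mult_ac)
    then have "D * rmax ^ n < \<epsilon> / r j" using rj by (simp add: pos_less_divide_eq)
    then have "time_in u (S j -` B) \<le> hausdorff_measure s (E u \<inter> (\<Union>x\<in>S j -` B. ball x (\<epsilon> / r j)))"
      using Suc.IH ju S_vimage_borel[OF ju(1) Suc.prems(2)] by blast
    then have "ennreal (r j powr s) * time_in u (S j -` B)
        \<le> ennreal (r j powr s) * hausdorff_measure s (E u \<inter> (\<Union>x\<in>S j -` B. ball x (\<epsilon> / r j)))"
      by (rule mult_left_mono) simp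
    also have "\<dots> = hausdorff_measure s (S j ` (E u \<inter> (\<Union>x\<in>S j -` B. ball x (\<epsilon> / r j))))"
      by (rule hausdorff_measure_S_image[OF ju(1), symmetric])
    also have "\<dots> \<le> hausdorff_measure s (S j ` E u \<inter> Q)"
    proof (rule hausdorff_measure_mono, clarify)
      fix y x assume "y \<in> E u" "S j x \<in> B" "y \<in> ball x (\<epsilon> / r j)"
      then have "S j y \<in> ball (S j x) \<epsilon>" using similitude[OF ju(1)] rj by (simp add: field_simps)
      then show "S j y \<in> S j ` E u \<inter> Q" using \<open>S j x \<in> B\<close> \<open>y \<in> E u\<close> by (auto simp: Q_def)
    qed
    finally show "ennreal (r j powr s) * time_in u (S j -` B) \<le> hausdorff_measure s (S j ` E u \<inter> Q)" .
  qed
  also have "\<dots> = (\<Sum>Y\<leftarrow>pieces v. hausdorff_measure s (Y \<inter> Q))"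
    by (simp add: pieces_def split_def comp_def)
  also have "\<dots> = hausdorff_measure s (E v \<inter> Q)"
    by (rule additive_pieces[OF Suc.prems(1)]) (auto simp: Q_def intro!: borel_open)
  finally show ?case by (simp add: Q_def)
qed

text \<open>Let \<open>\<epsilon>\<close> tend to zero: the neighbourhoods of a compact set shrink to it.\<close>
lemma time_in_le_compact:
  assumes v: "v \<in> V" and B: "compact B"
  shows "time_in v B \<le> hausdorff_measure s (E v \<inter> B)"
proof (cases "B = {}")
  case True
  then show ?thesis by (simp add: time_in_def)
next
  case False
  have "bounded (\<Union>v\<in>V. E v)" using finite_V E_compact by (auto intro: compact_imp_bounded)
  then obtain D where D: "\<forall>x\<in>(\<Union>v\<in>V. E v). \<forall>y\<in>(\<Union>v\<in>V. E v). dist x y \<le> D"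
    unfolding bounded_two_points by (rule exE)
  define Q where "Q n = (\<Union>x\<in>B. ball x (1 / Suc n))" for n
  have Bb: "B \<in> sets borel" using B by (simp add: compact_imp_closed borel_closed)
  have Ev: "E v \<in> sets borel" using E_compact[OF v] by (simp add: compact_imp_closed borel_closed)
  have le: "time_in v B \<le> hausdorff_measure s (E v \<inter> Q n)" for n
  proof -
    have "(\<lambda>n. max D 0 * rmax ^ n) \<longlonglongrightarrow> max D 0 * 0"
      using rmax by (intro tendsto_intros LIMSEQ_power_zero) auto
    then have "\<forall>\<^sub>F k in sequentially. max D 0 * rmax ^ k < 1 / Suc n" by (intro order_tendstoD) auto
    then obtain k where "max D 0 * rmax ^ k < 1 / Suc n" using eventually_happens'[OF sequentially_bot] by blast
    then show ?thesis unfolding Q_def using D v Bb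
      by (intro time_in_le_neighbourhood[where D = "max D 0" and n = k]) (auto simp: le_max_iff_disj)
  qed
  have dec: "decseq (\<lambda>n. E v \<inter> Q n)"
  proof (rule decseq_SucI)
    fix n
    have "1 / real (Suc (Suc n)) \<le> 1 / Suc n" by (simp add: frac_le)
    then show "E v \<inter> Q (Suc n) \<subseteq> E v \<inter> Q n"
      unfolding Q_def by (intro Int_mono order_refl UN_mono subset_ball)
  qed
  have INT: "(\<Inter>n. E v \<inter> Q n) = E v \<inter> B"
  proof (intro set_eqI iffI)
    fix x assume x: "x \<in> (\<Inter>n. E v \<inter> Q n)"
    have "infdist x B \<le> 1 / Suc n" for n
    proof -
      obtain b where "b \<in> B" "dist b x < 1 / Suc n" using x by (auto simp: Q_def)
      then show ?thesis using infdist_le[of b B x] by (simp add: dist_commute)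
    qed
    moreover have "(\<lambda>n. 1 / real (Suc n)) \<longlonglongrightarrow> 0" by (rule lim_inverse_n'[THEN LIMSEQ_Suc])
    ultimately have "infdist x B \<le> 0" by (intro LIMSEQ_le_const[of "\<lambda>n. 1 / real (Suc n)"]) auto
    then have "infdist x B = 0" using infdist_nonneg[of x B] by simp
    then have "x \<in> B" using in_closed_iff_infdist_zero[OF compact_imp_closed[OF B] False] by blast
    then show "x \<in> E v \<inter> B" using x by auto
  next
    fix x assume "x \<in> E v \<inter> B"
    then show "x \<in> (\<Inter>n. E v \<inter> Q n)" by (force simp: Q_def)
  qed
  have sets: "E v \<inter> Q n \<in> sets borel" for n
  proof (rule sets.Int[OF Ev])
    show "Q n \<in> sets borel" unfolding Q_def by (intro borel_open open_UN ballI open_ball)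
  qed
  have meas: "emeasure (hausdorff_borel s) A = hausdorff_measure s A" if "A \<in> sets borel" for A :: "'a set"
    by (rule emeasure_hausdorff_borel[OF less_imp_le[OF s_pos] that])
  have "(INF n. emeasure (hausdorff_borel s) (E v \<inter> Q n)) = emeasure (hausdorff_borel s) (\<Inter>n. E v \<inter> Q n)"
  proof (rule INF_emeasure_decseq)
    show "range (\<lambda>n. E v \<inter> Q n) \<subseteq> sets (hausdorff_borel s)" using sets by auto
    show "emeasure (hausdorff_borel s) (E v \<inter> Q n) \<noteq> \<infinity>" for n
      using hausdorff_measure_mono[of "E v \<inter> Q n" "E v" s] mass_finite[OF v] meas[OF sets] by auto
  qed (rule dec)
  then have "(INF n. hausdorff_measure s (E v \<inter> Q n)) = hausdorff_measure s (E v \<inter> B)"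
    unfolding INT using meas sets Ev Bb by simp
  then show ?thesis using le by (metis INF_greatest)
qed

text \<open>Both sides are finite Borel measures with the same total mass.  One inequality extends from
  compact sets to Borel sets by inner regularity, and for the complement it is the converse
  inequality.\<close>
lemma time_in_eq:
  assumes v: "v \<in> V" and B: "B \<in> sets borel"
  shows "time_in v B = hausdorff_measure s (E v \<inter> B)"
proof -
  define M where "M = distr (restrict_space lborel {0..h v}) borel (g v)"
  have meas: "g v \<in> restrict_space lborel {0..h v} \<rightarrow>\<^sub>M borel"
    using borel_measurable_continuous_on_restrict[OF g_continuous[OF v]]
    by (simp add: measurable_def sets_restrict_space space_restrict_space)
  have M: "emeasure M A = time_in v A" if "A \<in> sets borel" for A
    using that meas unfolding M_def time_in_def
    by (subst emeasure_distr) (auto simp: space_restrict_space emeasure_restrict_space Int_commute intro!: arg_cong[where f = "emeasure lborel"])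
  have tot: "emeasure M UNIV = hausdorff_measure s (E v)"
    using h_pos[OF v] ennreal_h[OF v] by (simp add: M time_in_def)
  have le: "time_in v A \<le> hausdorff_measure s (E v \<inter> A)" if A: "A \<in> sets borel" for A
  proof -
    have "emeasure M A = (SUP K \<in> {K. K \<subseteq> A \<and> compact K}. emeasure M K)"
      using tot mass_finite[OF v] A by (intro inner_regular) (auto simp: M_def)
    also have "\<dots> \<le> hausdorff_measure s (E v \<inter> A)"
    proof (rule SUP_least)
      fix K assume "K \<in> {K. K \<subseteq> A \<and> compact K}"
      then have K: "K \<subseteq> A" "compact K" by auto
      have "emeasure M K = time_in v K" using K by (intro M) (simp add: compact_imp_closed borel_closed)
      also have "\<dots> \<le> hausdorff_measure s (E v \<inter> K)" by (rule time_in_le_compact[OF v K(2)])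
      also have "\<dots> \<le> hausdorff_measure s (E v \<inter> A)" using K by (intro hausdorff_measure_mono) auto
      finally show "emeasure M K \<le> hausdorff_measure s (E v \<inter> A)" .
    qed
    finally show ?thesis using M[OF A] by simp
  qed
  have "hausdorff_measure s (E v \<inter> - B) + hausdorff_measure s (E v \<inter> B) = hausdorff_measure s (E v)"
    using hausdorff_measure_split[OF less_imp_le[OF s_pos] B, of "E v"] by (simp add: Diff_eq add.commute)
  also have "\<dots> = emeasure M (- B \<union> B)" using tot by simp
  also have "\<dots> \<le> emeasure M (- B) + emeasure M B"
    using B by (intro emeasure_subadditive) (auto simp: M_def)
  also have "\<dots> = time_in v (- B) + time_in v B" using B by (simp add: M)
  also have "\<dots> \<le> hausdorff_measure s (E v \<inter> - B) + time_in v B"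
    using le[of "- B"] B by (intro add_right_mono) auto
  finally have "hausdorff_measure s (E v \<inter> - B) + hausdorff_measure s (E v \<inter> B)
      \<le> hausdorff_measure s (E v \<inter> - B) + time_in v B" .
  moreover have "hausdorff_measure s (E v \<inter> - B) \<noteq> top"
    using hausdorff_measure_mono[of "E v \<inter> - B" "E v" s] mass_finite[OF v] by auto
  ultimately have "hausdorff_measure s (E v \<inter> B) \<le> time_in v B"
    unfolding ennreal_add_left_cancel_le by auto
  then show ?thesis using le[OF B] by (rule antisym[rotated])
qed

text \<open>The points that are common to two pieces into which a piece of level \<open>n\<close> is divided.\<close>
primrec overlaps :: "nat \<Rightarrow> 'v \<Rightarrow> 'a set" where
  "overlaps 0 v = (\<Union>i<length (\<tau> v). \<Union>k\<in>{..<length (\<tau> v)} - {i}. pieces v ! i \<inter> pieces v ! k)"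
| "overlaps (Suc n) v = (\<Union>(j, u)\<in>set (\<tau> v). S j ` overlaps n u)"

lemma overlaps:
  assumes "v \<in> V"
  shows "compact (overlaps n v)" "overlaps n v \<subseteq> E v" "hausdorff_measure s (overlaps n v) = 0"
proof -
  have "compact (overlaps n v) \<and> overlaps n v \<subseteq> E v \<and> hausdorff_measure s (overlaps n v) = 0"
    using assms
  proof (induction n arbitrary: v)
    case 0
    have "compact (pieces v ! i)" if "i < length (\<tau> v)" for i
      using that nth_mem[OF that] \<tau>_closed[OF 0, of "fst (\<tau> v ! i)" "snd (\<tau> v ! i)"] E_compact
      by (auto simp: pieces_def split_def intro!: compact_S_image)
    then have "compact (overlaps 0 v)" by (auto intro!: compact_UN compact_Int)
    moreover have "pieces v ! i \<subseteq> E v" if "i < length (\<tau> v)" for i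
      using Union_upper[OF nth_mem[of i "pieces v"]] Union_pieces[OF 0] that by simp
    then have "overlaps 0 v \<subseteq> E v" by auto
    moreover have "hausdorff_measure s (overlaps 0 v) = 0"
      unfolding overlaps.simps using pieces_null[OF 0]
      by (intro hausdorff_measure_finite_UN_null) auto
    ultimately show ?case by blast
  next
    case (Suc n)
    have *: "j < N" "compact (overlaps n u)" "overlaps n u \<subseteq> E u" "hausdorff_measure s (overlaps n u) = 0"
      if "(j, u) \<in> set (\<tau> v)" for j u
      using \<tau>_closed[OF Suc.prems that] Suc.IH[of u] by auto
    have "compact (overlaps (Suc n) v)"
      using * by (auto intro!: compact_UN compact_S_image)
    moreover have "overlaps (Suc n) v \<subseteq> E v"
      using *(3) E_eq[OF Suc.prems] by fastforce
    moreover have "hausdorff_measure s (overlaps (Suc n) v) = 0"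
      unfolding overlaps.simps using * hausdorff_measure_S_image
      by (intro hausdorff_measure_finite_UN_null) auto
    ultimately show ?case by blast
  qed
  then show "compact (overlaps n v)" "overlaps n v \<subseteq> E v" "hausdorff_measure s (overlaps n v) = 0" by auto
qed

text \<open>Zooming in stretches the distance of two parameters by a factor of at least
  \<open>1 / rmax powr s > 1\<close>, so they cannot stay in a common piece for ever.  At the level where they are
  separated, their common image lies in two pieces.\<close>
lemma double_point:
  assumes "v \<in> V" "x \<in> {0..h v}" "y \<in> {0..h v}" "g v x = g v y" "x \<noteq> y"
  shows "g v x \<in> (\<Union>n. overlaps n v)"
proof (rule ccontr)
  assume no: "g v x \<notin> (\<Union>n. overlaps n v)"
  let ?X = "{(v, x, y). v \<in> V \<and> x \<in> {0..h v} \<and> y \<in> {0..h v} \<and> g v x = g v y \<and> g v x \<notin> (\<Union>n. overlaps n v)}"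
  let ?f = "\<lambda>(v, x, y). \<bar>x - y\<bar> :: real"
  have "?f (v, x, y) \<le> 0"
  proof (rule contraction_vanish[where X = ?X and R = "rmax powr s" and B = "\<Sum>v\<in>V. h v"])
    show "0 \<le> rmax powr s" by simp
    show "rmax powr s < 1" using powr_less_mono2[of s rmax 1] rmax s_pos by simp
    show "(v, x, y) \<in> ?X" using assms no by blast
    fix z assume "z \<in> ?X"
    then obtain v x y where z: "z = (v, x, y)" "v \<in> V" "x \<in> {0..h v}" "y \<in> {0..h v}" "g v x = g v y"
      "g v x \<notin> (\<Union>n. overlaps n v)" by blast
    have "h v \<le> (\<Sum>v\<in>V. h v)" using finite_V z(2) h_pos by (intro member_le_sum) (auto simp: less_imp_le)
    then show "?f z \<le> (\<Sum>v\<in>V. h v)" using z by auto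
    obtain xs j u ys x' where p: "\<tau> v = xs @ (j, u) # ys" "0 \<le> x'" "x' \<le> h u"
      "x = weight xs + r j powr s * x'" "j < N" "u \<in> V"
      using z by (elim position[of v x]) auto
    obtain xs' k w ys' y' where q: "\<tau> v = xs' @ (k, w) # ys'" "0 \<le> y'" "y' \<le> h w"
      "y = weight xs' + r k powr s * y'" "k < N" "w \<in> V"
      using z by (elim position[of v y]) auto
    have gx: "g v x = S j (g u x')" using g_step[OF z(2) p(1-3)] p(4) by simp
    have gy: "g v y = S k (g w y')" using g_step[OF z(2) q(1-3)] q(4) by simp
    have len: "length xs = length xs'"
    proof (rule ccontr)
      assume ne: "length xs \<noteq> length xs'"
      have "g u x' \<in> E u" "g w y' \<in> E w" using g_image p q by fastforce+
      moreover have "pieces v ! length xs = S j ` E u" "pieces v ! length xs' = S k ` E w"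
        using pieces_nth[OF p(1)] pieces_nth[OF q(1)] .
      ultimately have "g v x \<in> pieces v ! length xs \<inter> pieces v ! length xs'"
        using gx gy z(5) by (metis IntI imageI)
      moreover have "length xs < length (\<tau> v)" by (simp add: p(1))
      moreover have "length xs' < length (\<tau> v)" by (simp add: q(1))
      ultimately have "g v x \<in> overlaps 0 v" using ne by auto
      then show False using z(6) by blast
    qed
    then have eq: "xs' = xs" "k = j" "w = u" using p(1) q(1) by auto
    have "g u x' = g u y'" using gx gy z(5) eq inj_S[OF p(5)] by (simp add: inj_eq)
    moreover have "g u x' \<notin> (\<Union>n. overlaps n u)"
    proof
      assume "g u x' \<in> (\<Union>n. overlaps n u)"
      then obtain n where "g u x' \<in> overlaps n u" by blast
      moreover have "(j, u) \<in> set (\<tau> v)" using p(1) by simp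
      ultimately have "g v x \<in> overlaps (Suc n) v" using gx by auto
      then show False using z(6) by blast
    qed
    ultimately have mem: "(u, x', y') \<in> ?X" using p q eq by auto
    have "x - y = r j powr s * (x' - y')" using p(4) q(4) eq by (simp add: algebra_simps)
    then have "?f z = r j powr s * \<bar>x' - y'\<bar>" using z(1) by (simp add: abs_mult)
    also have "\<dots> \<le> rmax powr s * \<bar>x' - y'\<bar>"
      using ratio(1)[OF p(5)] rmax(3)[OF p(5)] s_pos by (intro mult_right_mono powr_mono2) auto
    finally have "?f z \<le> rmax powr s * ?f (u, x', y')" by simp
    with mem show "\<exists>w\<in>?X. ?f z \<le> rmax powr s * ?f w" by blast
  qed
  then show False using assms(5) by simp
qed

theorem optimal_parametrization_g:
  assumes v: "v \<in> V"
  shows "optimal_parametrization s (E v) (\<lambda>t. g v (h v * t))"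
proof -
  obtain C where C: "0 < C" "\<forall>v\<in>V. \<forall>x\<in>{0..h v}. \<forall>y\<in>{0..h v}. dist (g v x) (g v y) \<le> C * \<bar>x - y\<bar> powr (1 / s)"
    using g_holder by blast
  define Z where "Z = (\<Union>n. overlaps n v)"
  show ?thesis
  proof (rule optimal_parametrizationI[where C = C and Z = Z])
    show "emeasure lborel (g v -` B \<inter> {0..h v}) = hausdorff_measure s B" if "B \<in> sets borel" "B \<subseteq> E v" for B
      using time_in_eq[OF v that(1)] that(2) by (simp add: time_in_def Int_absorb1)
    show "Z \<in> sets borel"
      unfolding Z_def using overlaps(1)[OF v] by (intro sets.countable_UN) (auto simp: compact_imp_closed borel_closed)
    show "Z \<subseteq> E v" using overlaps(2)[OF v] by (auto simp: Z_def)
    show "hausdorff_measure s Z = 0"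
      using hausdorff_measure_countably_subadditive[of s "\<lambda>n. overlaps n v"] overlaps(3)[OF v]
      by (simp add: Z_def)
    show "g v x \<in> Z" if "x \<in> {0..h v}" "y \<in> {0..h v}" "g v x = g v y" "x \<noteq> y" for x y
      unfolding Z_def using double_point[OF v that] .
  qed (use s_pos h_pos[OF v] E_compact[OF v] ennreal_h[OF v] g_image[OF v] C v in auto)
qed

end

section \<open>The system induced by an Euler partition\<close>

lemma inv_edge_inv_edge [simp]: "inv_edge (inv_edge u) = u"
  by (cases u) auto

lemma edge_origin_inv [simp]: "edge_origin a m (inv_edge u) = edge_terminus a m u"
  and edge_terminus_inv [simp]: "edge_terminus a m (inv_edge u) = edge_origin a m u"
  by (cases u; simp)+

lemma inv_edge_Vall [simp]: "inv_edge u \<in> Vall m \<longleftrightarrow> u \<in> Vall m"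
  by (cases u) (auto simp: Vall_def Vpos_def Vneg_def)

lemma finite_Vpos [simp]: "finite (Vpos m)" and finite_Vall [simp]: "finite (Vall m)"
  by (simp_all add: Vall_def Vpos_def Vneg_def)

lemma Fwd_Vall [simp]: "Fwd i \<in> Vall m \<longleftrightarrow> i < m" and Bwd_Vall [simp]: "Bwd i \<in> Vall m \<longleftrightarrow> i < m"
  by (auto simp: Vall_def Vpos_def Vneg_def)

lemma Vall_cases:
  assumes "u \<in> Vall m"
  obtains i where "i < m" "u = Fwd i" | i where "i < m" "u = Bwd i"
  using assms by (auto simp: Vall_def Vpos_def Vneg_def)

lemma abs_edge_Vpos: "u \<in> Vall m \<Longrightarrow> abs_edge u \<in> Vpos m"
  by (elim Vall_cases) (auto simp: Vpos_def)

lemma inv_trail_simps [simp]: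
  "inv_trail [] = []" "inv_trail ((k, u) # p) = inv_trail p @ [(k, inv_edge u)]"
  "inv_trail (p @ q) = inv_trail q @ inv_trail p"
  by (simp_all add: inv_trail_def)

lemma inv_trail_inv_trail [simp]: "inv_trail (inv_trail p) = p"
  by (induction p) (auto simp: inv_trail_def)

lemma set_inv_trail: "set (inv_trail p) = (\<lambda>(k, u). (k, inv_edge u)) ` set p"
  by (simp add: inv_trail_def)

lemma set_Lam: "b \<in> {-1, 1} \<Longrightarrow> set (Lam m b) = Vpos m \<or> set (Lam m b) = Vneg m"
  by (auto simp: Lam_def Vpos_def Vneg_def atLeast0LessThan)

lemma (in pre_digraph) cas_consecutive:
  "cas x (xs @ e # f # ys) y \<Longrightarrow> head G e = tail G f"
  by (induction xs arbitrary: x) (auto simp: cas.simps)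

text \<open>The data of an Euler partition together with an exponent \<open>s\<close> for which \<open>K\<close> has positive finite
  measure, as the open set condition provides.\<close>
locale induced_system = similitudes S N r
  for S :: "nat \<Rightarrow> 'a::euclidean_space \<Rightarrow> 'a" and N r +
  fixes K :: "'a set" and a :: "nat \<Rightarrow> 'a" and m :: nat and \<beta> :: "nat \<Rightarrow> int"
    and Ps :: "(nat \<times> fedge) list list" and E :: "fedge \<Rightarrow> 'a set" and s :: real
  assumes K: "is_invariant_set S N K"
    and m_pos: "0 < m"
    and beta: "\<forall>j<N. \<beta> j \<in> {-1, 1}"
    and partition: "euler_partition (skel_graph S N a m \<beta>) a m Ps"
    and consistent: "consistent_partition (skel_graph S N a m \<beta>) a m Ps"
    and primitive: "primitive_subst m (subst_edge Ps)"
    and pure: "potentially_pure N m (subst_edge Ps)"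
    and E: "gifs_invariant_sets S m (subst_edge Ps) E"
    and s_pos: "0 < s" and moran: "(\<Sum>i<N. r i powr s) = 1"
    and K_pos: "0 < hausdorff_measure s K" and K_finite: "hausdorff_measure s K < \<infinity>"
begin

abbreviation "G \<equiv> skel_graph S N a m \<beta>"
abbreviation "\<tau> \<equiv> subst_edge Ps"
abbreviation "orig \<equiv> edge_origin a m"
abbreviation "dest \<equiv> edge_terminus a m"

definition h :: "fedge \<Rightarrow> real" where "h v = enn2real (hausdorff_measure s (E v))"

lemma tail_G: "tail G (k, u) = S k (orig u)" and head_G: "head G (k, u) = S k (dest u)"
  by (simp_all add: skel_graph_def)

lemma length_Ps: "length Ps = m"
  using partition by (simp add: euler_partition_def)

lemma arcs_G: "arcs G = Sigma {..<N} (\<lambda>k. set (Lam m (\<beta> k)))"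
  by (auto simp: skel_graph_def)

lemma tour: "distinct (concat Ps)" "set (concat Ps) = arcs G" "\<exists>x. pre_digraph.cas G x (concat Ps) x"
  using partition
  by (auto simp: euler_partition_def euler_tour_def pre_digraph.trail_def pre_digraph.awalk_def)

lemma Ps_nonempty: "j < m \<Longrightarrow> Ps ! j \<noteq> []"
  using partition nth_mem[of j Ps] length_Ps by (auto simp: euler_partition_def)

lemma Ps_linked: "j < m \<Longrightarrow> Ps ! j = xs @ (k, u) # (l, w) # ys \<Longrightarrow> S k (dest u) = S l (orig w)"
proof -
  assume j: "j < m" and eq: "Ps ! j = xs @ (k, u) # (l, w) # ys"
  have "Ps ! j \<in> set Ps" using j length_Ps by simp
  then obtain x y where "pre_digraph.cas G x (Ps ! j) y"
    using partition by (auto simp: euler_partition_def pre_digraph.trail_def pre_digraph.awalk_def)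
  then show ?thesis
    unfolding eq using pre_digraph.cas_consecutive[of G x xs "(k, u)" "(l, w)" ys y] by (simp add: tail_G head_G)
qed

lemma Lam_Vall: "k < N \<Longrightarrow> u \<in> set (Lam m (\<beta> k)) \<Longrightarrow> u \<in> Vall m"
  using set_Lam[of "\<beta> k" m] beta by (auto simp: Vall_def)

lemma concat_Ps_closed: "(k, u) \<in> set (concat Ps) \<Longrightarrow> k < N \<and> u \<in> Vall m"
  using Lam_Vall unfolding tour(2) arcs_G by auto

lemma Ps_closed: "j < m \<Longrightarrow> (k, u) \<in> set (Ps ! j) \<Longrightarrow> k < N \<and> u \<in> Vall m"
  using concat_Ps_closed[of k u] length_Ps by fastforce

lemma \<tau>_inv: "\<tau> (inv_edge v) = inv_trail (\<tau> v)"
  by (cases v) auto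

lemma \<tau>_closed: "v \<in> Vall m \<Longrightarrow> (k, u) \<in> set (\<tau> v) \<Longrightarrow> k < N \<and> u \<in> Vall m"
  using Ps_closed by (elim Vall_cases) (fastforce simp: set_inv_trail)+

lemma \<tau>_linked:
  assumes "v \<in> Vall m" "\<tau> v = xs @ (k, u) # (l, w) # ys"
  shows "S k (dest u) = S l (orig w)"
  using assms(1)
proof (cases rule: Vall_cases)
  case (1 i)
  then show ?thesis using Ps_linked assms(2) by simp
next
  case (2 i)
  have "Ps ! i = inv_trail (\<tau> v)" using 2 by simp
  then have "Ps ! i = inv_trail ys @ (l, inv_edge w) # (k, inv_edge u) # inv_trail xs"
    unfolding assms(2) by simp
  from Ps_linked[OF 2(1) this] show ?thesis by simp
qed

lemma \<tau>_orig:
  assumes "v \<in> Vall m" "\<tau> v = (k, u) # ys"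
  shows "orig v = S k (orig u)"
  using assms(1)
proof (cases rule: Vall_cases)
  case (1 i)
  then have "tail G (hd (Ps ! i)) = a i" using consistent by (simp add: consistent_partition_def)
  then show ?thesis using 1 assms(2) by (simp add: tail_G)
next
  case (2 i)
  have "Ps ! i = inv_trail (\<tau> v)" using 2 by simp
  then have "Ps ! i = inv_trail ys @ [(k, inv_edge u)]" unfolding assms(2) by simp
  moreover have "head G (last (Ps ! i)) = a (Suc i mod m)"
    using consistent 2 by (simp add: consistent_partition_def)
  ultimately show ?thesis using 2 by (simp add: head_G)
qed

lemma \<tau>_dest:
  assumes "v \<in> Vall m" "\<tau> v = xs @ [(k, u)]"
  shows "dest v = S k (dest u)"
proof -
  have "\<tau> (inv_edge v) = (k, inv_edge u) # inv_trail xs" by (simp add: \<tau>_inv assms(2))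
  then show ?thesis using \<tau>_orig[of "inv_edge v" k "inv_edge u"] assms(1) by simp
qed

lemma E_compact: "v \<in> Vall m \<Longrightarrow> compact (E v)"
  and E_nonempty: "v \<in> Vall m \<Longrightarrow> E v \<noteq> {}"
  and E_eq: "v \<in> Vall m \<Longrightarrow> E v = (\<Union>(k, u)\<in>set (\<tau> v). S k ` E u)"
  using E by (auto simp: gifs_invariant_sets_def)

lemma E_borel: "v \<in> Vall m \<Longrightarrow> E v \<in> sets borel"
  using E_compact by (simp add: compact_imp_closed borel_closed)

lemma E_inv_subset: "v \<in> Vall m \<Longrightarrow> E v \<subseteq> E (inv_edge v)"
proof (rule gifs_subset[OF finite_Vall \<tau>_closed, where E = E and F = "\<lambda>v. E (inv_edge v)"])
  fix v assume v: "v \<in> Vall m"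
  show "E v \<subseteq> (\<Union>(k, u)\<in>set (\<tau> v). S k ` E u)" using E_eq[OF v] by simp
  show "bounded (E v)" using E_compact[OF v] by (rule compact_imp_bounded)
  have v': "inv_edge v \<in> Vall m" using v by simp
  show "closed (E (inv_edge v))" "E (inv_edge v) \<noteq> {}"
    using E_compact[OF v'] E_nonempty[OF v'] by (auto intro: compact_imp_closed)
  show "(\<Union>(k, u)\<in>set (\<tau> v). S k ` E (inv_edge u)) \<subseteq> E (inv_edge v)"
    unfolding E_eq[OF v'] by (force simp: \<tau>_inv set_inv_trail)
qed auto

text \<open>Reversing all edges permutes the equations of the system, so by uniqueness an edge and its
  reverse have the same set.\<close>
lemma E_inv: "v \<in> Vall m \<Longrightarrow> E (inv_edge v) = E v"
  using E_inv_subset[of v] E_inv_subset[of "inv_edge v"] by simp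

lemma h_inv: "v \<in> Vall m \<Longrightarrow> h (inv_edge v) = h v"
  by (simp add: h_def E_inv)

lemma UN_Lam: "k < N \<Longrightarrow> (\<Union>u\<in>set (Lam m (\<beta> k)). E u) = (\<Union>v\<in>Vpos m. E v)"
proof -
  have "(\<Union>u\<in>Vneg m. E u) = (\<Union>v\<in>Vpos m. E v)"
    using E_inv[of "Fwd _"] by (simp add: Vneg_def Vpos_def)
  then show "k < N \<Longrightarrow> ?thesis" using set_Lam[of "\<beta> k" m] beta by auto
qed

lemma K_compact: "compact K" and K_nonempty: "K \<noteq> {}" and K_eq: "K = (\<Union>j<N. S j ` K)"
  using K by (auto simp: is_invariant_set_def)

text \<open>The one-vertex case of \<open>gifs_subset\<close>.\<close>
lemma invariant_set_subset:
  assumes "compact X" "X \<subseteq> (\<Union>j<N. S j ` X)" "compact Y" "Y \<noteq> {}" "(\<Union>j<N. S j ` Y) \<subseteq> Y"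
  shows "X \<subseteq> Y"
proof -
  have "(\<lambda>_::unit. X) () \<subseteq> (\<lambda>_. Y) ()"
    by (rule gifs_subset[where V = "{()}" and \<tau> = "\<lambda>_. map (\<lambda>j. (j, ())) [0..<N]"])
       (use assms in \<open>auto simp: compact_imp_bounded compact_imp_closed atLeast0LessThan\<close>)
  then show ?thesis by simp
qed

lemma UN_concat_Ps: "(\<Union>(k, u)\<in>set (concat Ps). S k ` E u) = (\<Union>k<N. S k ` (\<Union>v\<in>Vpos m. E v))"
proof -
  have "(\<Union>(k, u)\<in>set (concat Ps). S k ` E u) = (\<Union>k<N. \<Union>u\<in>set (Lam m (\<beta> k)). S k ` E u)"
    unfolding tour(2) arcs_G by auto
  also have "\<dots> = (\<Union>k<N. S k ` (\<Union>u\<in>set (Lam m (\<beta> k)). E u))" by (simp add: image_UN)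
  also have "\<dots> = (\<Union>k<N. S k ` (\<Union>v\<in>Vpos m. E v))" using UN_Lam by simp
  finally show ?thesis .
qed

text \<open>An Euler tour visits every edge of every \<open>S\<^sub>k(\<Lambda>\<^sup>\<plusminus>\<^sup>1)\<close> exactly once, so the union of the
  sets of all edges solves the equation that characterizes \<open>K\<close>.\<close>
lemma K_eq_UN: "K = (\<Union>v\<in>Vpos m. E v)"
proof -
  let ?W = "\<Union>v\<in>Vpos m. E v"
  have "?W = (\<Union>i<m. \<Union>(k, u)\<in>set (Ps ! i). S k ` E u)"
    using E_eq[of "Fwd _"] by (simp add: Vpos_def)
  also have "\<dots> = (\<Union>(k, u)\<in>set (concat Ps). S k ` E u)"
    using length_Ps by (fastforce simp: in_set_conv_nth[of _ Ps])
  also have "\<dots> = (\<Union>k<N. S k ` ?W)" by (rule UN_concat_Ps)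
  finally have W: "?W = (\<Union>k<N. S k ` ?W)" .
  have c: "compact ?W" using E_compact by (intro compact_UN) (auto simp: Vall_def)
  have "E (Fwd 0) \<noteq> {}" "Fwd 0 \<in> Vpos m" using E_nonempty m_pos by (auto simp: Vpos_def)
  then have ne: "?W \<noteq> {}" by blast
  show ?thesis
  proof
    show "K \<subseteq> ?W"
      by (rule invariant_set_subset[OF K_compact equalityD1[OF K_eq] c ne equalityD2[OF W]])
    show "?W \<subseteq> K"
      by (rule invariant_set_subset[OF c equalityD1[OF W] K_compact K_nonempty equalityD2[OF K_eq]])
  qed
qed

lemma K_eq_concat: "K = (\<Union>(k, u)\<in>set (concat Ps). S k ` E u)"
  unfolding UN_concat_Ps using K_eq K_eq_UN by simp

lemma E_subset_K: "v \<in> Vall m \<Longrightarrow> E v \<subseteq> K"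
  using E_inv[of "Fwd _"] unfolding K_eq_UN by (elim Vall_cases) (auto simp: Vpos_def)

lemma E_finite: "v \<in> Vall m \<Longrightarrow> hausdorff_measure s (E v) < \<infinity>"
  using hausdorff_measure_mono[OF E_subset_K, of v s] K_finite by (auto simp: order_le_less_trans)

lemma ennreal_h: "v \<in> Vall m \<Longrightarrow> ennreal (h v) = hausdorff_measure s (E v)"
  using E_finite by (simp add: h_def)

lemma h_nonneg [simp]: "0 \<le> h v"
  by (simp add: h_def)

lemma hausdorff_measure_word_image:
  assumes "set I \<subseteq> {..<N}"
  shows "hausdorff_measure s (foldr S I ` X) = ennreal (word_ratio I powr s) * hausdorff_measure s X"
  using s_pos word_ratio_pos[OF assms] dist_foldr[OF assms] by (intro hausdorff_measure_similitude)

lemma hausdorff_measure_S_image_E: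
  assumes "k < N" "u \<in> Vall m"
  shows "hausdorff_measure s (S k ` E u) = ennreal (r k powr s * h u)"
  using hausdorff_measure_word_image[of "[k]" "E u"] assms ennreal_h[OF assms(2)]
  by (simp add: ennreal_mult comp_def)

lemma h_le:
  assumes v: "v \<in> Vall m"
  shows "h v \<le> (\<Sum>(k, u)\<leftarrow>\<tau> v. r k powr s * h u)"
proof -
  have "ennreal (h v) = hausdorff_measure s (\<Union>(set (map (\<lambda>(k, u). S k ` E u) (\<tau> v))))"
    using ennreal_h[OF v] E_eq[OF v] by (simp add: split_def)
  also have "\<dots> \<le> (\<Sum>Y\<leftarrow>map (\<lambda>(k, u). S k ` E u) (\<tau> v). hausdorff_measure s Y)"
    by (rule hausdorff_measure_Union_list_le)
  also have "\<dots> = (\<Sum>(k, u)\<leftarrow>\<tau> v. ennreal (r k powr s * h u))"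
    using \<tau>_closed[OF v] by (auto simp: comp_def intro!: arg_cong[where f = sum_list] map_cong hausdorff_measure_S_image_E)
  also have "\<dots> = ennreal (\<Sum>(k, u)\<leftarrow>\<tau> v. r k powr s * h u)"
    unfolding split_def by (rule sum_list_ennreal) simp
  finally show ?thesis by (subst (asm) ennreal_le_iff) (auto intro!: sum_list_nonneg)
qed

lemma sum_concat_Ps: "(\<Sum>(k, u)\<leftarrow>concat Ps. r k powr s * h u) = (\<Sum>v\<in>Vpos m. h v)"
proof -
  have Lam: "(\<Sum>u\<in>set (Lam m (\<beta> k)). h u) = (\<Sum>v\<in>Vpos m. h v)" if "k < N" for k
  proof -
    have "(\<Sum>u\<in>Vneg m. h u) = (\<Sum>i<m. h (Bwd i))"
      unfolding Vneg_def by (subst sum.reindex) (auto simp: inj_on_def)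
    also have "\<dots> = (\<Sum>i<m. h (Fwd i))" using h_inv[of "Fwd _"] by simp
    also have "\<dots> = (\<Sum>v\<in>Vpos m. h v)"
      unfolding Vpos_def by (subst sum.reindex) (auto simp: inj_on_def)
    finally show ?thesis using set_Lam[of "\<beta> k" m] beta that by auto
  qed
  have "(\<Sum>(k, u)\<leftarrow>concat Ps. r k powr s * h u) = (\<Sum>(k, u)\<in>set (concat Ps). r k powr s * h u)"
    by (rule sum_list_distinct_conv_sum_set[OF tour(1)])
  also have "\<dots> = (\<Sum>k<N. \<Sum>u\<in>set (Lam m (\<beta> k)). r k powr s * h u)"
    unfolding tour(2) arcs_G by (rule sum.Sigma[symmetric]) auto
  also have "\<dots> = (\<Sum>k<N. r k powr s * (\<Sum>v\<in>Vpos m. h v))"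
    by (simp add: sum_distrib_left[symmetric] Lam)
  also have "\<dots> = (\<Sum>v\<in>Vpos m. h v)" by (simp add: sum_distrib_right[symmetric] moran)
  finally show ?thesis .
qed

text \<open>Subadditivity gives an inequality for each edge.  Summed over all edges both sides agree by
  the Euler tour and Moran's equation, so no inequality is strict.\<close>
lemma h_eq:
  assumes v: "v \<in> Vall m"
  shows "h v = (\<Sum>(k, u)\<leftarrow>\<tau> v. r k powr s * h u)"
proof -
  have Fwd: "h (Fwd i) = (\<Sum>(k, u)\<leftarrow>Ps ! i. r k powr s * h u)" if "i < m" for i
  proof -
    let ?d = "\<lambda>i. (\<Sum>(k, u)\<leftarrow>Ps ! i. r k powr s * h u) - h (Fwd i)"
    have "(\<Sum>i<m. \<Sum>(k, u)\<leftarrow>Ps ! i. r k powr s * h u) = (\<Sum>(k, u)\<leftarrow>concat Ps. r k powr s * h u)"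
    proof -
      have "(\<Sum>x\<leftarrow>concat xss. f x) = (\<Sum>xs\<leftarrow>xss. \<Sum>x\<leftarrow>xs. f x)"
        for xss :: "(nat \<times> fedge) list list" and f :: "nat \<times> fedge \<Rightarrow> real"
        by (induction xss) auto
      then show ?thesis by (simp add: sum_list_sum_nth[of "map _ Ps"] length_Ps atLeast0LessThan)
    qed
    also have "\<dots> = (\<Sum>i<m. h (Fwd i))"
      unfolding sum_concat_Ps Vpos_def by (subst sum.reindex) (auto simp: inj_on_def)
    finally have "(\<Sum>i<m. ?d i) = 0" by (simp add: sum_subtractf)
    moreover have "0 \<le> ?d i" if "i \<in> {..<m}" for i using h_le[of "Fwd i"] that by simp
    ultimately have "\<forall>i\<in>{..<m}. ?d i = 0"
      using sum_nonneg_eq_0_iff[of "{..<m}" ?d] by blast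
    then show ?thesis using that by simp
  qed
  show ?thesis
    using v
  proof (cases rule: Vall_cases)
    case (1 i)
    then show ?thesis using Fwd by simp
  next
    case (2 i)
    have "(\<Sum>(k, u)\<leftarrow>inv_trail p. r k powr s * h u) = (\<Sum>(k, u)\<leftarrow>p. r k powr s * h u)"
      if "\<And>k u. (k, u) \<in> set p \<Longrightarrow> u \<in> Vall m" for p
      using that
    proof (induction p)
      case (Cons x p)
      obtain k u where x: "x = (k, u)" by (cases x)
      then have "h (inv_edge u) = h u" using Cons.prems[of k u] by (intro h_inv) simp
      moreover have "(\<Sum>(k, u)\<leftarrow>inv_trail p. r k powr s * h u) = (\<Sum>(k, u)\<leftarrow>p. r k powr s * h u)"
        using Cons.prems by (intro Cons.IH) auto
      ultimately show ?case using x by simp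
    qed simp
    then have "(\<Sum>(k, u)\<leftarrow>\<tau> v. r k powr s * h u) = (\<Sum>(k, u)\<leftarrow>Ps ! i. r k powr s * h u)"
      using 2 Ps_closed by simp
    also have "\<dots> = h (Fwd i)" using Fwd 2 by simp
    finally show ?thesis using h_inv[of "Fwd i"] 2 by simp
  qed
qed

lemma h_abs_edge: "u \<in> Vall m \<Longrightarrow> h (abs_edge u) = h u"
  using h_inv[of u] by (cases u) auto

text \<open>The set of an edge contains similar copies of the sets of all edges in its substitution, so
  positive measure is inherited from the iterate by the word that is substituted.\<close>
lemma induced_morphism_pos:
  "v \<in> set ((induced_morphism \<tau> ^^ n) ws) \<Longrightarrow> set ws \<subseteq> Vpos m \<Longrightarrow> 0 < h v \<Longrightarrow> \<exists>w\<in>set ws. 0 < h w"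
proof (induction n arbitrary: ws)
  case (Suc n)
  have "set (induced_morphism \<tau> ws) \<subseteq> Vpos m"
  proof
    fix w assume "w \<in> set (induced_morphism \<tau> ws)"
    then obtain w' k u where u: "w' \<in> set ws" "(k, u) \<in> set (\<tau> w')" "w = abs_edge u"
      by (auto simp: induced_morphism_def)
    have "w' \<in> Vall m" using u(1) Suc.prems(2) by (auto simp: Vall_def)
    then have "u \<in> Vall m" using \<tau>_closed u(2) by blast
    then show "w \<in> Vpos m" unfolding u(3) by (rule abs_edge_Vpos)
  qed
  moreover have "v \<in> set ((induced_morphism \<tau> ^^ n) (induced_morphism \<tau> ws))"
    using Suc.prems(1) by (simp add: funpow_Suc_right del: funpow.simps)
  ultimately obtain w where w: "w \<in> set (induced_morphism \<tau> ws)" "0 < h w"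
    using Suc.IH Suc.prems(3) by blast
  then obtain w' k u where u: "w' \<in> set ws" "(k, u) \<in> set (\<tau> w')" "w = abs_edge u"
    by (auto simp: induced_morphism_def)
  have w': "w' \<in> Vall m" using u Suc.prems by (auto simp: Vall_def)
  have ku: "k < N" "u \<in> Vall m" using \<tau>_closed[OF w' u(2)] by auto
  have "0 < r k powr s * h u" using ku ratio(1)[OF ku(1)] w(2) u(3) h_abs_edge[OF ku(2)] by simp
  also have "\<dots> \<le> (\<Sum>(k, u)\<leftarrow>\<tau> w'. r k powr s * h u)"
    using u(2) by (intro member_le_sum_list) force+
  also have "\<dots> = h w'" using h_eq[OF w'] by simp
  finally show ?case using u(1) by blast
qed auto

lemma h_pos:
  assumes "v \<in> Vall m"
  shows "0 < h v"
proof -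
  have pos: "0 < h w" if w: "w \<in> Vpos m" for w
  proof -
    have "\<exists>v\<in>Vpos m. 0 < h v"
    proof (rule ccontr)
      assume no: "\<not> ?thesis"
      have "hausdorff_measure s (E v) = 0" if "v \<in> Vpos m" for v
      proof -
        have "\<not> 0 < h v" using no that by blast
        then have "h v = 0" using h_nonneg[of v] by linarith
        then show ?thesis using ennreal_h[of v] that by (simp add: Vall_def)
      qed
      then have "hausdorff_measure s K = 0"
        unfolding K_eq_UN by (intro hausdorff_measure_finite_UN_null) auto
      then show False using K_pos by simp
    qed
    then obtain v where v: "v \<in> Vpos m" "0 < h v" by blast
    obtain n where "v \<in> set ((induced_morphism \<tau> ^^ n) [w])"
      using primitive v(1) w unfolding primitive_subst_def by blast
    from induced_morphism_pos[OF this] show ?thesis using w v(2) by simp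
  qed
  show ?thesis
    using assms
  proof (cases rule: Vall_cases)
    case (1 i)
    then show ?thesis using pos by (simp add: Vpos_def)
  next
    case (2 i)
    then show ?thesis using pos[of "Fwd i"] h_inv[of "Fwd i"] by (simp add: Vpos_def)
  qed
qed

text \<open>By \<open>E_eq\<close> and \<open>h_eq\<close> a piece is the union of its parts and its measure is the sum of theirs,
  so a refinement loses neither points nor measure.\<close>
lemma subst_walk_decomposes:
  assumes "\<And>I v. (I, v) \<in> set w \<Longrightarrow> set I \<subseteq> {..<N} \<and> v \<in> Vall m"
  shows "\<And>I v. (I, v) \<in> set (subst_walk \<tau> w) \<Longrightarrow> set I \<subseteq> {..<N} \<and> v \<in> Vall m"
    "(\<Union>(I, v)\<in>set (subst_walk \<tau> w). foldr S I ` E v) = (\<Union>(I, v)\<in>set w. foldr S I ` E v)"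
    "(\<Sum>(I, v)\<leftarrow>subst_walk \<tau> w. word_ratio I powr s * h v) = (\<Sum>(I, v)\<leftarrow>w. word_ratio I powr s * h v)"
proof -
  show "set I \<subseteq> {..<N} \<and> v \<in> Vall m" if "(I, v) \<in> set (subst_walk \<tau> w)" for I v
    using that assms \<tau>_closed by (fastforce simp: subst_walk_def)
  have "foldr S I ` E v = (\<Union>(k, u)\<in>set (\<tau> v). foldr S (I @ [k]) ` E u)" if "(I, v) \<in> set w" for I v
    using E_eq[of v] assms[OF that] by (simp add: image_UN image_image split_def)
  then show "(\<Union>(I, v)\<in>set (subst_walk \<tau> w). foldr S I ` E v) = (\<Union>(I, v)\<in>set w. foldr S I ` E v)"
    by (fastforce simp: subst_walk_def)
  show "(\<Sum>(I, v)\<leftarrow>subst_walk \<tau> w. word_ratio I powr s * h v) = (\<Sum>(I, v)\<leftarrow>w. word_ratio I powr s * h v)"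
    using assms
  proof (induction w)
    case (Cons p w)
    obtain I v where p: "p = (I, v)" by (cases p)
    have I: "set I \<subseteq> {..<N}" "v \<in> Vall m" using Cons.prems p by auto
    have "(\<Sum>(k, u)\<leftarrow>\<tau> v. word_ratio (I @ [k]) powr s * h u)
        = (\<Sum>(k, u)\<leftarrow>\<tau> v. word_ratio I powr s * (r k powr s * h u))"
      using \<tau>_closed[OF I(2)] ratio word_ratio_pos[OF I(1)]
      by (intro arg_cong[where f = sum_list] map_cong) (auto simp: powr_mult less_imp_le)
    also have "\<dots> = word_ratio I powr s * h v"
      unfolding h_eq[OF I(2)] by (simp add: split_def sum_list_const_mult)
    finally have "(\<Sum>(k, u)\<leftarrow>\<tau> v. word_ratio (I @ [k]) powr s * h u) = word_ratio I powr s * h v" .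
    moreover have "(\<Sum>(I, v)\<leftarrow>subst_walk \<tau> w. word_ratio I powr s * h v) = (\<Sum>(I, v)\<leftarrow>w. word_ratio I powr s * h v)"
      using Cons.prems by (intro Cons.IH) auto
    ultimately show ?case using p by (simp add: subst_walk_def split_def comp_def)
  qed (simp add: subst_walk_def)
qed

text \<open>The measures of the level-\<open>n\<close> pieces of \<open>E u\<close> add up to that of \<open>E u\<close>, so they overlap in null
  sets only.  If the positive or the negative cell of a word \<open>I\<close> occurs among them, the similitude
  \<open>S\<^sub>I\<close> can be cancelled.\<close>
lemma E_overlap_null:
  assumes "v \<in> Vpos m" "w \<in> Vpos m" "v \<noteq> w"
  shows "hausdorff_measure s (E v \<inter> E w) = 0"
proof -
  obtain n I u where n: "set I \<subseteq> {..<N}" "u \<in> Vall m"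
    "{(I, v) | v. v \<in> Vpos m} \<subseteq> set ((subst_walk \<tau> ^^ n) [([], u)]) \<or>
     {(I, v) | v. v \<in> Vneg m} \<subseteq> set ((subst_walk \<tau> ^^ n) [([], u)])"
    using pure unfolding potentially_pure_def by blast
  define L where "L n = (subst_walk \<tau> ^^ n) [([], u)]" for n
  have L: "(\<forall>(I, v)\<in>set (L n). set I \<subseteq> {..<N} \<and> v \<in> Vall m) \<and>
      (\<Union>(I, v)\<in>set (L n). foldr S I ` E v) = E u \<and>
      (\<Sum>(I, v)\<leftarrow>L n. word_ratio I powr s * h v) = h u" for n
  proof (induction n)
    case 0
    then show ?case using n(2) by (simp add: L_def)
  next
    case (Suc n)
    have step: "L (Suc n) = subst_walk \<tau> (L n)" by (simp add: L_def)
    have valid: "set I \<subseteq> {..<N} \<and> v \<in> Vall m" if "(I, v) \<in> set (L n)" for I v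
      using conjunct1[OF Suc] that by blast
    show ?case
      unfolding step
    proof (intro conjI)
      show "\<forall>(I, v)\<in>set (subst_walk \<tau> (L n)). set I \<subseteq> {..<N} \<and> v \<in> Vall m"
        using subst_walk_decomposes(1)[of "L n", OF valid] by blast
      show "(\<Union>(I, v)\<in>set (subst_walk \<tau> (L n)). foldr S I ` E v) = E u"
        using subst_walk_decomposes(2)[of "L n", OF valid] conjunct1[OF conjunct2[OF Suc]] by (rule trans)
      show "(\<Sum>(I, v)\<leftarrow>subst_walk \<tau> (L n). word_ratio I powr s * h v) = h u"
        using subst_walk_decomposes(3)[of "L n", OF valid] conjunct2[OF conjunct2[OF Suc]] by (rule trans)
    qed
  qed
  have overlap: "hausdorff_measure s (E v \<inter> E w) = 0"
    if vw: "(I, v) \<in> set (L n)" "(I, w) \<in> set (L n)" "v \<noteq> w" for v w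
  proof -
    define Ys where "Ys = map (\<lambda>(I, v). foldr S I ` E v) (L n)"
    have U: "\<Union>(set Ys) = E u" using L[of n] by (simp add: Ys_def split_def)
    have meas: "hausdorff_measure s (foldr S I ` E v) = ennreal (word_ratio I powr s * h v)"
      if "(I, v) \<in> set (L n)" for I v
    proof -
      have "set I \<subseteq> {..<N}" "v \<in> Vall m" using conjunct1[OF L] that by blast+
      then show ?thesis using hausdorff_measure_word_image ennreal_h by (simp add: ennreal_mult)
    qed
    have "(\<Sum>Y\<leftarrow>Ys. hausdorff_measure s Y) = (\<Sum>(I, v)\<leftarrow>L n. ennreal (word_ratio I powr s * h v))"
      unfolding Ys_def using meas by (auto simp: comp_def intro!: arg_cong[where f = sum_list] map_cong)
    also have "\<dots> = ennreal (\<Sum>(I, v)\<leftarrow>L n. word_ratio I powr s * h v)"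
      unfolding split_def by (rule sum_list_ennreal) simp
    finally have sum: "(\<Sum>Y\<leftarrow>Ys. hausdorff_measure s Y) = hausdorff_measure s (E u)"
      using L[of n] ennreal_h[OF n(2)] by simp
    obtain i j where ij: "i < length (L n)" "L n ! i = (I, v)" "j < length (L n)" "L n ! j = (I, w)"
      using vw by (auto simp: in_set_conv_nth)
    have bor: "Y \<in> sets borel" if Y: "Y \<in> set Ys" for Y
    proof -
      obtain I v where Iv: "(I, v) \<in> set (L n)" "Y = foldr S I ` E v" using Y by (auto simp: Ys_def)
      then have I: "set I \<subseteq> {..<N}" "v \<in> Vall m" using conjunct1[OF L] by blast+
      have "continuous_on (E v) (foldr S I)"
        by (rule lipschitz_on_continuous_on[of "word_ratio I"], rule lipschitz_onI)
           (use dist_foldr[OF I(1)] word_ratio_pos[OF I(1)] in auto)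
      then have "compact (foldr S I ` E v)" using E_compact[OF I(2)] by (rule compact_continuous_image)
      then show ?thesis using Iv by (simp add: compact_imp_closed borel_closed)
    qed
    have "hausdorff_measure s (Ys ! i \<inter> Ys ! j) = 0"
      using s_pos sum U E_finite[OF n(2)] bor ij vw(3)
      by (intro hausdorff_measure_pieces_null) (auto simp: Ys_def)
    also have "Ys ! i \<inter> Ys ! j = foldr S I ` (E v \<inter> E w)"
    proof -
      have "inj (foldr S I)"
        using dist_foldr[OF n(1)] word_ratio_pos[OF n(1)]
        by (intro injI) (metis dist_eq_0_iff mult_eq_0_iff less_irrefl)
      then show ?thesis using ij by (simp add: Ys_def image_Int)
    qed
    finally show ?thesis
      using hausdorff_measure_word_image[OF n(1), of "E v \<inter> E w"] word_ratio_pos[OF n(1)] by simp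
  qed
  from n(3) show ?thesis
  proof
    assume "{(I, v) | v. v \<in> Vpos m} \<subseteq> set ((subst_walk \<tau> ^^ n) [([], u)])"
    then show ?thesis using assms by (intro overlap) (auto simp: L_def)
  next
    assume neg: "{(I, v) | v. v \<in> Vneg m} \<subseteq> set ((subst_walk \<tau> ^^ n) [([], u)])"
    have "inv_edge v \<in> Vneg m" "inv_edge w \<in> Vneg m" "inv_edge v \<noteq> inv_edge w"
      using assms by (auto simp: Vpos_def Vneg_def)
    then have "hausdorff_measure s (E (inv_edge v) \<inter> E (inv_edge w)) = 0"
      using neg by (intro overlap) (auto simp: L_def)
    then show ?thesis using E_inv assms by (simp add: Vall_def)
  qed
qed

lemma measure_K: "enn2real (hausdorff_measure s K) = (\<Sum>v\<in>Vpos m. h v)"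
proof -
  have "hausdorff_measure s K = (\<Sum>v\<in>Vpos m. hausdorff_measure s (E v))"
    unfolding K_eq_UN using s_pos E_overlap_null E_borel
    by (intro hausdorff_measure_UN_eq_sum) (auto simp: Vall_def)
  also have "\<dots> = (\<Sum>v\<in>Vpos m. ennreal (h v))"
    using ennreal_h by (intro sum.cong) (auto simp: Vall_def)
  also have "\<dots> = ennreal (\<Sum>v\<in>Vpos m. h v)" by simp
  finally show ?thesis by (simp add: sum_nonneg)
qed

end

section \<open>The space-filling curve\<close>

lemma trail_formal_graph:
  assumes "0 < m"
  shows "pre_digraph.trail (formal_graph a m) (a 0) (map Fwd [0..<m]) (a 0)"
proof -
  interpret pre_digraph "formal_graph a m" .
  have "cas (a (i mod m)) (map Fwd [i..<m]) (a 0)" if "i \<le> m" for i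
    using that
  proof (induction rule: inc_induct)
    case base
    then show ?case by simp
  next
    case (step i)
    then show ?case by (simp add: upt_conv_Cons cas.simps) (simp add: formal_graph_def)
  qed
  from this[of 0] assms show ?thesis
    unfolding trail_def awalk_def
    by (auto simp: distinct_map inj_on_def formal_graph_def Vall_def Vpos_def)
qed

context induced_system
begin

text \<open>The invariant set \<open>K\<close> joins the system as the additional vertex \<open>None\<close>, whose trail is the
  whole Euler tour.  Its parametrization is then the concatenation of those of the \<open>E v\<close>.\<close>

definition lift :: "(nat \<times> fedge) list \<Rightarrow> (nat \<times> fedge option) list" where
  "lift = map (\<lambda>(k, u). (k, Some u))"

definition root_subst :: "fedge option \<Rightarrow> (nat \<times> fedge option) list" where
  "root_subst v = lift (case v of None \<Rightarrow> concat Ps | Some u \<Rightarrow> \<tau> u)"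

definition root_set :: "fedge option \<Rightarrow> 'a set" where
  "root_set = case_option K E"

lemma root_set_simps [simp]: "root_set None = K" "root_set (Some v) = E v"
  by (simp_all add: root_set_def)

definition root_orig :: "fedge option \<Rightarrow> 'a" where
  "root_orig = case_option (a 0) orig"

definition root_dest :: "fedge option \<Rightarrow> 'a" where
  "root_dest = case_option (a 0) dest"

definition root_V :: "fedge option set" where
  "root_V = insert None (Some ` Vall m)"

lemma lift_eq_appendD:
  assumes "lift L = xs @ (k, w) # ys"
  obtains xs' u ys' where "L = xs' @ (k, u) # ys'" "w = Some u" "xs = lift xs'" "ys = lift ys'"
  using assms unfolding lift_def by (auto simp: map_eq_append_conv map_eq_Cons_conv)

lemma lift_simps [simp]:
  "lift [] = []" "lift ((k, u) # L) = (k, Some u) # lift L" "lift (L @ M) = lift L @ lift M"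
  "lift L = [] \<longleftrightarrow> L = []" "[] = lift L \<longleftrightarrow> L = []"
  by (simp_all add: lift_def)

lemma set_lift: "set (lift L) = (\<lambda>(k, u). (k, Some u)) ` set L"
  by (simp add: lift_def)

lemma concat_Ps_orig: "concat Ps = (k, u) # ys \<Longrightarrow> a 0 = S k (orig u)"
proof -
  assume eq: "concat Ps = (k, u) # ys"
  have "Ps \<noteq> []" using length_Ps m_pos by auto
  then have "Ps = Ps ! 0 # tl Ps" by (cases Ps) auto
  then have "concat Ps = Ps ! 0 @ concat (tl Ps)" by (metis concat.simps(2))
  then have "hd (Ps ! 0) = (k, u)" using eq Ps_nonempty[OF m_pos] by (metis hd_append2 list.sel(1))
  moreover have "tail G (hd (Ps ! 0)) = a 0" using consistent m_pos by (simp add: consistent_partition_def)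
  ultimately show ?thesis by (simp add: tail_G)
qed

lemma concat_Ps_dest: "concat Ps = xs @ [(k, u)] \<Longrightarrow> a 0 = S k (dest u)"
proof -
  assume eq: "concat Ps = xs @ [(k, u)]"
  have "Ps \<noteq> []" using length_Ps m_pos by auto
  then have "Ps = butlast Ps @ [Ps ! (m - 1)]" using length_Ps by (metis append_butlast_last_id last_conv_nth)
  then have "concat Ps = concat (butlast Ps) @ Ps ! (m - 1)"
    by (metis append_Nil2 concat.simps concat_append)
  moreover have ne: "Ps ! (m - 1) \<noteq> []" using Ps_nonempty[of "m - 1"] m_pos by simp
  ultimately have "last (Ps ! (m - 1)) = (k, u)" using eq by (metis last_appendR last_snoc)
  moreover have "head G (last (Ps ! (m - 1))) = a (Suc (m - 1) mod m)"
    using consistent m_pos by (simp add: consistent_partition_def)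
  ultimately show ?thesis using m_pos by (simp add: head_G)
qed

lemma concat_Ps_linked:
  assumes "concat Ps = xs @ (k, u) # (l, w) # ys"
  shows "S k (dest u) = S l (orig w)"
proof -
  obtain x where "pre_digraph.cas G x (concat Ps) x" using tour(3) by blast
  then show ?thesis
    unfolding assms using pre_digraph.cas_consecutive[of G x xs "(k, u)" "(l, w)" ys x]
    by (simp add: tail_G head_G)
qed

sublocale root: linear_gifs S N r root_V root_subst root_set root_orig root_dest s
proof unfold_locales
  have Some_eq: "v = None \<or> (\<exists>u\<in>Vall m. v = Some u)" if "v \<in> root_V" for v
    using that by (auto simp: root_V_def)
  show "finite root_V" by (simp add: root_V_def)
  show "0 < s" by (rule s_pos)
  fix v assume "v \<in> root_V"
  then consider "v = None" | u where "u \<in> Vall m" "v = Some u" using Some_eq by blast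
  note v_cases = this
  show "compact (root_set v)"
    using v_cases by cases (auto simp: K_compact E_compact)
  show "0 < hausdorff_measure s (root_set v)"
    using v_cases
  proof cases
    case (2 u)
    then show ?thesis using h_pos[OF 2(1)] ennreal_h[OF 2(1)] by (simp flip: ennreal_h)
  qed (simp add: K_pos)
  show "hausdorff_measure s (root_set v) < \<infinity>"
    using v_cases K_finite E_finite by cases auto
  show "root_set v = (\<Union>(j, u)\<in>set (root_subst v). S j ` root_set u)"
    using v_cases
  proof cases
    case 1
    have "(\<Union>(j, u)\<in>set (root_subst None). S j ` root_set u) = (\<Union>(k, u)\<in>set (concat Ps). S k ` E u)"
      by (simp add: root_subst_def set_lift split_def)
    also have "\<dots> = K" by (rule K_eq_concat[symmetric])
    finally show ?thesis using 1 by simp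
  next
    case (2 u)
    then show ?thesis using E_eq[OF 2(1)] by (simp add: root_subst_def set_lift split_def)
  qed
  have lift_sum: "(\<Sum>(j, u)\<leftarrow>lift L. r j powr s * enn2real (hausdorff_measure s (root_set u)))
      = (\<Sum>(j, u)\<leftarrow>L. r j powr s * h u)" for L
    by (simp add: lift_def h_def comp_def split_def)
  show "enn2real (hausdorff_measure s (root_set v)) =
      (\<Sum>(j, u)\<leftarrow>root_subst v. r j powr s * enn2real (hausdorff_measure s (root_set u)))"
    using v_cases
  proof cases
    case 1
    then show ?thesis unfolding root_subst_def lift_sum
      using measure_K sum_concat_Ps by simp
  next
    case (2 u)
    then show ?thesis unfolding root_subst_def lift_sum
      using h_eq[OF 2(1)] by (simp add: h_def)
  qed
  show "j < N \<and> u \<in> root_V" if "(j, u) \<in> set (root_subst v)" for j u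
    using v_cases
  proof cases
    case 1
    then show ?thesis using that concat_Ps_closed by (force simp: root_subst_def set_lift root_V_def)
  next
    case (2 w)
    then show ?thesis using that \<tau>_closed[OF 2(1)] by (force simp: root_subst_def set_lift root_V_def)
  qed
  show "root_orig v = S j (root_orig u)" if eq: "root_subst v = (j, u) # ys" for j u ys
    using v_cases
  proof cases
    case 1
    then have "lift (concat Ps) = [] @ (j, u) # ys" using eq by (simp add: root_subst_def)
    then obtain u' ys' where "concat Ps = (j, u') # ys'" "u = Some u'"
      by (elim lift_eq_appendD) simp
    then show ?thesis using concat_Ps_orig 1 by (simp add: root_orig_def)
  next
    case (2 w)
    then have "lift (\<tau> w) = [] @ (j, u) # ys" using eq by (simp add: root_subst_def)
    then obtain u' ys' where "\<tau> w = (j, u') # ys'" "u = Some u'"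
      by (elim lift_eq_appendD) simp
    then show ?thesis using \<tau>_orig[OF 2(1)] 2 by (simp add: root_orig_def)
  qed
  show "root_dest v = S j (root_dest u)" if eq: "root_subst v = xs @ [(j, u)]" for j u xs
    using v_cases
  proof cases
    case 1
    then have "lift (concat Ps) = xs @ (j, u) # []" using eq by (simp add: root_subst_def)
    then obtain u' xs' where "concat Ps = xs' @ [(j, u')]" "u = Some u'"
      by (elim lift_eq_appendD) simp
    then show ?thesis using concat_Ps_dest 1 by (simp add: root_dest_def)
  next
    case (2 w)
    then have "lift (\<tau> w) = xs @ (j, u) # []" using eq by (simp add: root_subst_def)
    then obtain u' xs' where "\<tau> w = xs' @ [(j, u')]" "u = Some u'"
      by (elim lift_eq_appendD) simp
    then show ?thesis using \<tau>_dest[OF 2(1)] 2 by (simp add: root_dest_def)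
  qed
  show "S j (root_dest u) = S k (root_orig w)" if eq: "root_subst v = xs @ (j, u) # (k, w) # ys"
    for xs j u k w ys
  proof -
    define L where "L = (case v of None \<Rightarrow> concat Ps | Some u \<Rightarrow> \<tau> u)"
    have "lift L = xs @ (j, u) # (k, w) # ys" using eq by (simp add: L_def root_subst_def)
    then obtain xs' u' ys' where 1: "L = xs' @ (j, u') # ys'" "u = Some u'" "lift ys' = [] @ (k, w) # ys"
      by (elim lift_eq_appendD) simp
    from 1(3) obtain w' ys'' where 2: "ys' = (k, w') # ys''" "w = Some w'"
      by (elim lift_eq_appendD) simp
    have L: "L = xs' @ (j, u') # (k, w') # ys''" using 1 2 by simp
    have "S j (dest u') = S k (orig w')"
      using v_cases
    proof cases
      case 1
      then show ?thesis using concat_Ps_linked L by (simp add: L_def)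
    next
      case (2 x)
      then show ?thesis using \<tau>_linked[OF 2(1)] L by (simp add: L_def)
    qed
    then show ?thesis using 1 2 by (simp add: root_dest_def root_orig_def)
  qed
qed

lemma root_h: "root.h (Some v) = h v" "root.h None = (\<Sum>v\<in>Vpos m. h v)"
  using measure_K by (simp_all add: root.h_def h_def)

lemma root_weight: "root.weight (lift L) = (\<Sum>(k, u)\<leftarrow>L. r k powr s * h u)"
  by (simp add: root.weight_def lift_def comp_def split_def root_h)

lemma root_weight_take:
  assumes "i \<le> m"
  shows "root.weight (lift (concat (take i Ps))) = (\<Sum>p<i. h (Fwd p))"
  using assms
proof (induction i)
  case (Suc i)
  have "root.weight (lift (Ps ! i)) = h (Fwd i)"
    using h_eq[of "Fwd i"] Suc.prems unfolding root_weight by simp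
  then show ?case using Suc length_Ps by (simp add: take_Suc_conv_app_nth)
qed simp

theorem space_filling: "leads_to_space_filling_curve s a m E K"
proof -
  obtain g where g: "\<And>v xs j u ys y. v \<in> root_V \<Longrightarrow> root_subst v = xs @ (j, u) # ys \<Longrightarrow> 0 \<le> y \<Longrightarrow>
      y \<le> root.h u \<Longrightarrow> g v (root.weight xs + r j powr s * y) = S j (g u y)"
    "\<And>v. v \<in> root_V \<Longrightarrow> g v 0 = root_orig v" "\<And>v. v \<in> root_V \<Longrightarrow> g v (root.h v) = root_dest v"
    "\<exists>B. \<forall>v\<in>root_V. \<forall>x\<in>{0..root.h v}. dist (g v x) 0 \<le> B"
    using root.parametrization_exists by blast
  interpret P: parametrized_gifs S N r root_V root_subst root_set root_orig root_dest s g
    by unfold_locales (use g in auto)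
  define c where "c = root.h None"
  have c: "c = enn2real (hausdorff_measure s K)" by (simp add: c_def root.h_def)
  have c_pos: "0 < c" unfolding c_def by (rule root.h_pos) (simp add: root_V_def)
  have V: "Some (Fwd i) \<in> root_V" if "i < m" for i using that by (simp add: root_V_def)
  define \<phi> where "\<phi> i t = g (Some (Fwd i)) (h (Fwd i) * t)" for i t
  define \<psi> where "\<psi> t = g None (c * t)" for t
  have concat: "g None ((\<Sum>p<i. h (Fwd p)) + x) = g (Some (Fwd i)) x"
    if i: "i < m" and x: "0 \<le> x" "x \<le> h (Fwd i)" for i x
  proof -
    obtain xs j u ys y where p: "root_subst (Some (Fwd i)) = xs @ (j, u) # ys" "0 \<le> y" "y \<le> root.h u"
      "x = root.weight xs + r j powr s * y"
      by (rule root.position[OF V[OF i], of x]) (use x in \<open>simp_all add: root_h\<close>)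
    have "concat Ps = concat (take i Ps) @ Ps ! i @ concat (drop (Suc i) Ps)"
      using i length_Ps by (metis concat.simps(2) concat_append id_take_nth_drop)
    then have "root_subst None = lift (concat (take i Ps)) @ lift (Ps ! i) @ lift (concat (drop (Suc i) Ps))"
      by (simp add: root_subst_def)
    also have "lift (Ps ! i) = xs @ (j, u) # ys" using p(1) by (simp add: root_subst_def)
    finally have "root_subst None = (lift (concat (take i Ps)) @ xs) @ (j, u) # (ys @ lift (concat (drop (Suc i) Ps)))"
      by simp
    then have "g None (root.weight (lift (concat (take i Ps)) @ xs) + r j powr s * y) = S j (g u y)"
      using p(2,3) by (intro g(1)) (auto simp: root_V_def)
    moreover have "g (Some (Fwd i)) x = S j (g u y)" using g(1)[OF V[OF i] p(1-3)] p(4) by simp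
    ultimately show ?thesis using p(4) i root_weight_take[of i] by (simp add: add.assoc)
  qed
  show ?thesis
    unfolding leads_to_space_filling_curve_def
  proof (intro exI conjI allI impI)
    show "pre_digraph.trail (formal_graph a m) (a 0) (map Fwd [0..<m]) (a 0)"
      using m_pos by (rule trail_formal_graph)
    show "K = (\<Union>w\<in>set (map Fwd [0..<m]). E w)"
      using K_eq_UN by (simp add: Vpos_def atLeast0LessThan)
    fix i assume i: "i < length (map Fwd [0..<m])"
    then have im: "i < m" by simp
    show "hausdorff_measure s (E (map Fwd [0..<m] ! i) \<inter> E (map Fwd [0..<m] ! j)) = 0"
      if "j < length (map Fwd [0..<m])" "i \<noteq> j" for j
      using that im by (simp add: E_overlap_null Vpos_def)
    show "optimal_parametrization s (E (map Fwd [0..<m] ! i)) (\<phi> i)"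
      using P.optimal_parametrization_g[OF V[OF im]] im
      by (simp add: root_h \<phi>_def[abs_def])
    show "\<phi> i 0 = orig (map Fwd [0..<m] ! i)" "\<phi> i 1 = dest (map Fwd [0..<m] ! i)"
      using g(2,3)[OF V[OF im]] im by (simp_all add: \<phi>_def root_h root_orig_def root_dest_def)
  next
    show "is_concatenation (length (map Fwd [0..<m]))
      (\<lambda>i. enn2real (hausdorff_measure s (E (map Fwd [0..<m] ! i))) / enn2real (hausdorff_measure s K)) \<phi> \<psi>"
      unfolding is_concatenation_def
    proof (intro allI impI ballI)
      fix i x assume "i < length (map Fwd [0..<m])" and x: "x \<in> {0..1::real}"
      then have i: "i < m" by simp
      have "c * ((\<Sum>p<i. h (Fwd p) / c) + h (Fwd i) / c * x) = (\<Sum>p<i. h (Fwd p)) + h (Fwd i) * x"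
        using c_pos by (simp add: distrib_left flip: sum_divide_distrib)
      moreover have "h (Fwd i) * x \<le> h (Fwd i)" using x by (simp add: mult_left_le)
      moreover have "(\<Sum>p<i. enn2real (hausdorff_measure s (E (map Fwd [0..<m] ! p))) / enn2real (hausdorff_measure s K))
          = (\<Sum>p<i. h (Fwd p) / c)"
        using i by (intro sum.cong) (auto simp: h_def c)
      ultimately show "\<psi> ((\<Sum>p<i. enn2real (hausdorff_measure s (E (map Fwd [0..<m] ! p))) / enn2real (hausdorff_measure s K)) +
          enn2real (hausdorff_measure s (E (map Fwd [0..<m] ! i))) / enn2real (hausdorff_measure s K) * x) = \<phi> i x"
        using concat[OF i, of "h (Fwd i) * x"] x i by (simp add: \<psi>_def \<phi>_def c h_def)
    qed
    show "optimal_parametrization s K \<psi>"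
      using P.optimal_parametrization_g[of None]
      by (simp add: root_V_def \<psi>_def[abs_def] c_def)
  qed
qed

end

theorem theorem8p2:
  fixes S :: "nat \<Rightarrow> real ^ 'd \<Rightarrow> real ^ 'd" and N :: nat
    and K :: "(real ^ 'd) set"
    and a :: "nat \<Rightarrow> real ^ 'd" and m :: nat
    and \<beta> :: "nat \<Rightarrow> int"
    and Ps :: "(nat \<times> fedge) list list"
    and E :: "fedge \<Rightarrow> (real ^ 'd) set"
  assumes ifs: "is_ifs S N"
    and osc: "open_set_condition S N"
    and K: "is_invariant_set S N K"
    and a_distinct: "inj_on a {..<m}"
    and skeleton: "is_skeleton S N K (a ` {..<m})"
    and beta: "\<forall>j<N. \<beta> j \<in> {-1, 1}"
    and partition: "euler_partition (skel_graph S N a m \<beta>) a m Ps"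
    and consistent: "consistent_partition (skel_graph S N a m \<beta>) a m Ps"
    and primitive: "primitive_subst m (subst_edge Ps)"
    and pure: "potentially_pure N m (subst_edge Ps)"
    and E: "gifs_invariant_sets S m (subst_edge Ps) E"
  shows "K = (\<Union>v\<in>Vpos m. E v) \<and>
         (\<forall>v\<in>Vpos m. \<forall>w\<in>Vpos m. v \<noteq> w \<longrightarrow>
            hausdorff_measure (hausdorff_dim K) (E v \<inter> E w) = 0) \<and>
         leads_to_space_filling_curve (hausdorff_dim K) a m E K"
proof -
  have N: "2 \<le> N" using ifs by (simp add: is_ifs_def)
  have "\<forall>i. \<exists>\<rho>. i < N \<longrightarrow> 0 < \<rho> \<and> \<rho> < 1 \<and> (\<forall>x y. dist (S i x) (S i y) = \<rho> * dist x y)"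
    using ifs by (auto simp: is_ifs_def contractive_similitude_def)
  then obtain r where r: "\<forall>i<N. 0 < r i \<and> r i < 1 \<and> (\<forall>x y. dist (S i x) (S i y) = r i * dist x y)"
    by metis
  interpret similitudes S N r by unfold_locales (use r N in auto)
  obtain s where s: "0 < s" "(\<Sum>i<N. r i powr s) = 1" using similarity_exponent by blast
  have K': "compact K" "K \<noteq> {}" "K = (\<Union>j<N. S j ` K)" using K by (auto simp: is_invariant_set_def)
  have pos: "0 < hausdorff_measure s K"
    by (rule hausdorff_measure_invariant_set_pos[OF K' osc s])
  have fin: "hausdorff_measure s K < \<infinity>"
    by (rule hausdorff_measure_invariant_set_finite[OF K'(1,3) s])
  have dim: "hausdorff_dim K = s" by (rule hausdorff_dim_eqI[OF s(1) pos fin])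
  \<comment> \<open>An empty skeleton has a Hata graph without edges, which is not connected on two vertices.\<close>
  have "m \<noteq> 0"
  proof
    assume "m = 0"
    then have "hata_adj S N (a ` {..<m}) = {}" by (simp add: hata_adj_def)
    moreover have "(0, 1) \<in> (hata_adj S N (a ` {..<m}))\<^sup>*"
      using skeleton N by (simp add: is_skeleton_def hata_connected_def)
    ultimately show False by simp
  qed
  interpret induced_system S N r K a m \<beta> Ps E s
    by unfold_locales (use assms s pos fin \<open>m \<noteq> 0\<close> in auto)
  show ?thesis
    unfolding dim using K_eq_UN E_overlap_null space_filling by blast
qed

end
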